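(* Let $I$ be an infinite set and let $p,q$ be two numbers such that $p>\max\{2,q\}$. If $Y$ is a finite-dimensional subspace of any $L_q(\mu)$, then the norm of the projective tensor product $\ell_p(I)\widehat{\otimes}_\pi Y^*$ is SSD.
   Context: All Banach spaces are real. $S_X$ denotes the unit sphere of a Banach space $X$; a subspace carries the inherited norm, and $Y^*$ is the topological dual of $Y$ with the dual norm. $\ell_p(I)$ is the classical generalisation of the sequence space $\ell_p$ to the index set $I$, and $L_q(\mu)$ is the usual Lebesgue space of a measure $\mu$. SSD: the norm of $X$ is strongly subdifferentiable (SSD) at $x\in S_X$ if the one-sided limit $\lim_{t\to 0^+}\frac{\|x+th\|-1}{t}$ exists uniformly in $h\in S_X$. The norm of $X$ is SSD if it is SSD at every $x\in S_X$. Projective tensor product: $X\widehat{\otimes}_\pi Z$ is the completion of the algebraic tensor product $X\otimes Z$ under the norm $\|u\|_\pi=\inf\{\sum_{n=1}^k\|x_n\|\|z_n\|: u=\sum_{n=1}^k x_n\otimes z_n\}$, the infimum being taken over all such representations of $u$.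
   Formalization: The number q is assumed to satisfy q > 1; for q = 1 the claim fails (p = 4, Y an isometric copy of the two-dimensional l_4 inside L_1), and for q < 1 the space L_q is not a Banach space. *)

theory Defs
  imports "HOL-Analysis.Analysis"
begin

text \<open>
  The spaces below depend on term parameters (an exponent, a measure, a subspace), so a real
  normed space is a record with an explicit carrier. The operations are only meaningful on the
  carrier.
\<close>

record 'a nspace =
  carr  :: "'a set"
  nplus :: "'a \<Rightarrow> 'a \<Rightarrow> 'a"
  nzero :: "'a"
  scale :: "real \<Rightarrow> 'a \<Rightarrow> 'a"
  nrm   :: "'a \<Rightarrow> real"

definition unit_sphere :: "'a nspace \<Rightarrow> 'a set" where
  "unit_sphere X = {x \<in> carr X. nrm X x = 1}"

definition nminus :: "'a nspace \<Rightarrow> 'a \<Rightarrow> 'a \<Rightarrow> 'a" where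
  "nminus X x y = nplus X x (scale X (-1) y)"

definition SSD_at :: "'a nspace \<Rightarrow> 'a \<Rightarrow> bool" where
  "SSD_at X x \<longleftrightarrow>
     (\<exists>l. uniform_limit (unit_sphere X)
            (\<lambda>t h. (nrm X (nplus X x (scale X t h)) - 1) / t) l (at_right 0))"

definition SSD :: "'a nspace \<Rightarrow> bool" where
  "SSD X \<longleftrightarrow> (\<forall>x \<in> unit_sphere X. SSD_at X x)"


definition linear_subspace :: "'a nspace \<Rightarrow> 'a set \<Rightarrow> bool" where
  "linear_subspace X S \<longleftrightarrow>
     S \<subseteq> carr X \<and> nzero X \<in> S \<and>
     (\<forall>x\<in>S. \<forall>y\<in>S. nplus X x y \<in> S) \<and> (\<forall>c. \<forall>x\<in>S. scale X c x \<in> S)"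

definition subspace_of :: "'a nspace \<Rightarrow> 'a set \<Rightarrow> 'a nspace" where
  "subspace_of X S = X\<lparr>carr := S\<rparr>"

definition linear_span :: "'a nspace \<Rightarrow> 'a set \<Rightarrow> 'a set" where
  "linear_span X B = \<Inter>{S. linear_subspace X S \<and> B \<subseteq> S}"

definition finite_dimensional :: "'a nspace \<Rightarrow> bool" where
  "finite_dimensional X \<longleftrightarrow> (\<exists>B. finite B \<and> B \<subseteq> carr X \<and> linear_span X B = carr X)"


definition linear_form :: "'a nspace \<Rightarrow> ('a \<Rightarrow> real) \<Rightarrow> bool" where
  "linear_form X f \<longleftrightarrow>
     (\<forall>x\<in>carr X. \<forall>y\<in>carr X. f (nplus X x y) = f x + f y) \<and>
     (\<forall>c. \<forall>x\<in>carr X. f (scale X c x) = c * f x)"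

text \<open>
  Functionals are set to 0 off the carrier, so that equality of functions is equality of
  functionals.
\<close>

definition dual_space :: "'a nspace \<Rightarrow> ('a \<Rightarrow> real) nspace" where
  "dual_space X =
     \<lparr>carr = {f. linear_form X f \<and> (\<forall>x. x \<notin> carr X \<longrightarrow> f x = 0) \<and>
                 (\<exists>C. \<forall>x\<in>carr X. \<bar>f x\<bar> \<le> C * nrm X x)},
      nplus = (\<lambda>f g x. f x + g x),
      nzero = (\<lambda>x. 0),
      scale = (\<lambda>c f x. c * f x),
      nrm = (\<lambda>f. SUP x\<in>{x \<in> carr X. nrm X x \<le> 1}. \<bar>f x\<bar>)\<rparr>"


text \<open>The elements of \<open>\<ell>\<^sub>p(I)\<close> are functions on the whole type that vanish off \<open>I\<close>.\<close>

definition lp_space :: "real \<Rightarrow> 'i set \<Rightarrow> ('i \<Rightarrow> real) nspace" where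
  "lp_space p I =
     \<lparr>carr = {x. (\<forall>i. i \<notin> I \<longrightarrow> x i = 0) \<and> (\<lambda>i. \<bar>x i\<bar> powr p) summable_on I},
      nplus = (\<lambda>x y i. x i + y i),
      nzero = (\<lambda>i. 0),
      scale = (\<lambda>c x i. c * x i),
      nrm = (\<lambda>x. (\<Sum>\<^sub>\<infinity>i\<in>I. \<bar>x i\<bar> powr p) powr (1 / p))\<rparr>"


definition Lq_functions :: "real \<Rightarrow> 'm measure \<Rightarrow> ('m \<Rightarrow> real) set" where
  "Lq_functions q M = {f \<in> borel_measurable M. integrable M (\<lambda>x. \<bar>f x\<bar> powr q)}"

definition ae_rel :: "real \<Rightarrow> 'm measure \<Rightarrow> (('m \<Rightarrow> real) \<times> ('m \<Rightarrow> real)) set" where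
  "ae_rel q M =
     {(f, g). f \<in> Lq_functions q M \<and> g \<in> Lq_functions q M \<and> (AE x in M. f x = g x)}"

text \<open>
  In \<open>Lq_space\<close> and \<open>completion\<close> the elements are equivalence classes; unions over representatives
  and \<open>the_elem\<close> pick the common value of an expression that is independent of the representative.
\<close>

definition Lq_space :: "real \<Rightarrow> 'm measure \<Rightarrow> ('m \<Rightarrow> real) set nspace" where
  "Lq_space q M =
     \<lparr>carr = Lq_functions q M // ae_rel q M,
      nplus = (\<lambda>P Q. \<Union>f\<in>P. \<Union>g\<in>Q. ae_rel q M `` {\<lambda>x. f x + g x}),
      nzero = ae_rel q M `` {\<lambda>x. 0},
      scale = (\<lambda>c P. \<Union>f\<in>P. ae_rel q M `` {\<lambda>x. c * f x}),
      nrm = (\<lambda>P. the_elem ((\<lambda>f. (\<integral>x. \<bar>f x\<bar> powr q \<partial>M) powr (1 / q)) ` P))\<rparr>"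


definition cauchy_seqs :: "'a nspace \<Rightarrow> (nat \<Rightarrow> 'a) set" where
  "cauchy_seqs X =
     {s. (\<forall>n. s n \<in> carr X) \<and>
         (\<forall>e>0. \<exists>N. \<forall>m\<ge>N. \<forall>n\<ge>N. nrm X (nminus X (s m) (s n)) < e)}"

definition null_rel :: "'a nspace \<Rightarrow> ((nat \<Rightarrow> 'a) \<times> (nat \<Rightarrow> 'a)) set" where
  "null_rel X =
     {(s, t). s \<in> cauchy_seqs X \<and> t \<in> cauchy_seqs X \<and>
              (\<lambda>n. nrm X (nminus X (s n) (t n))) \<longlonglongrightarrow> 0}"

definition completion :: "'a nspace \<Rightarrow> (nat \<Rightarrow> 'a) set nspace" where
  "completion X =
     \<lparr>carr = cauchy_seqs X // null_rel X,
      nplus = (\<lambda>P Q. \<Union>s\<in>P. \<Union>t\<in>Q. null_rel X `` {\<lambda>n. nplus X (s n) (t n)}),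
      nzero = null_rel X `` {\<lambda>n. nzero X},
      scale = (\<lambda>c P. \<Union>s\<in>P. null_rel X `` {\<lambda>n. scale X c (s n)}),
      nrm = (\<lambda>P. the_elem ((\<lambda>s. lim (\<lambda>n. nrm X (s n))) ` P))\<rparr>"


definition bilinear_forms :: "'a nspace \<Rightarrow> 'b nspace \<Rightarrow> ('a \<Rightarrow> 'b \<Rightarrow> real) set" where
  "bilinear_forms X Z =
     {\<beta>. (\<forall>z\<in>carr Z. linear_form X (\<lambda>x. \<beta> x z)) \<and> (\<forall>x\<in>carr X. linear_form Z (\<beta> x))}"

text \<open>
  The algebraic tensor product is realised in the usual way as the space of functionals on the
  bilinear forms spanned by the evaluations \<open>\<beta> \<mapsto> \<beta> x z\<close>. Lists of pairs are
  representations of a tensor as a finite sum of elementary tensors; these sums exhaust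
  the span because scalars can be absorbed into the first factor.
\<close>

definition elem_tensor ::
  "'a nspace \<Rightarrow> 'b nspace \<Rightarrow> 'a \<Rightarrow> 'b \<Rightarrow> ('a \<Rightarrow> 'b \<Rightarrow> real) \<Rightarrow> real" where
  "elem_tensor X Z x z = (\<lambda>\<beta>. if \<beta> \<in> bilinear_forms X Z then \<beta> x z else 0)"

definition tensor_sum ::
  "'a nspace \<Rightarrow> 'b nspace \<Rightarrow> ('a \<times> 'b) list \<Rightarrow> ('a \<Rightarrow> 'b \<Rightarrow> real) \<Rightarrow> real" where
  "tensor_sum X Z r = (\<lambda>\<beta>. \<Sum>(x, z)\<leftarrow>r. elem_tensor X Z x z \<beta>)"

definition alg_tensor_pi ::
  "'a nspace \<Rightarrow> 'b nspace \<Rightarrow> (('a \<Rightarrow> 'b \<Rightarrow> real) \<Rightarrow> real) nspace" where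
  "alg_tensor_pi X Z =
     \<lparr>carr = {tensor_sum X Z r | r. set r \<subseteq> carr X \<times> carr Z},
      nplus = (\<lambda>u v \<beta>. u \<beta> + v \<beta>),
      nzero = (\<lambda>\<beta>. 0),
      scale = (\<lambda>c u \<beta>. c * u \<beta>),
      nrm = (\<lambda>u. Inf {\<Sum>(x, z)\<leftarrow>r. nrm X x * nrm Z z | r.
                        set r \<subseteq> carr X \<times> carr Z \<and> u = tensor_sum X Z r})\<rparr>"

definition proj_tensor ::
  "'a nspace \<Rightarrow> 'b nspace \<Rightarrow> (nat \<Rightarrow> ('a \<Rightarrow> 'b \<Rightarrow> real) \<Rightarrow> real) set nspace" where
  "proj_tensor X Z = completion (alg_tensor_pi X Z)"

end

theory Submission
  imports Defs
begin

text \<open>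
  The dual of the projective tensor product of \<open>X = \<ell>\<^sub>p(I)\<close> and \<open>Z = Y\<^sup>*\<close> consists of the bounded
  bilinear forms on \<open>X \<times> Z\<close>, and by Hahn-Banach the projective norm of a tensor is the maximum of its
  values at the forms of norm at most one (\<open>ex_norming_form\<close>). For a norm given as such a supremum,
  strong subdifferentiability at a unit vector \<open>u\<close> follows once the forms with value close to 1 at
  \<open>u\<close> are uniformly close, in norm, to forms with value exactly 1 (\<open>SSD_at_criterion\<close>).

  Suppose that forms \<open>\<beta>\<close> satisfy \<open>u(\<beta>) \<rightarrow> 1\<close>. The ball of forms is compact for pointwise
  convergence, so the \<open>\<beta>\<close> cluster pointwise at some \<open>\<tau>\<close>, and \<open>u(\<tau>) = 1\<close>. It remains to see that
  they cluster at \<open>\<tau>\<close> in norm (\<open>slices_near_face\<close>). Split \<open>\<ell>\<^sub>p(I)\<close> into finitely many coordinates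
  and the rest. On finitely many coordinates pointwise convergence is uniform, because \<open>Z\<close> is
  finite-dimensional. On the remaining coordinates each of the forms, and \<open>\<tau>\<close> itself, has small norm;
  this is where the exponents enter.

  The space \<open>L\<^sub>q(\<mu>)\<close> is uniformly convex of power type \<open>r = max 2 q\<close>, hence so is \<open>Y\<close>, and dually
  \<open>\<parallel>f + c g\<parallel> + \<parallel>f - c g\<parallel> \<le> 2 + C c\<^sup>s\<close> for \<open>f\<close>, \<open>g\<close> in the unit ball of \<open>Z\<close>, with \<open>s = r / (r - 1)\<close>.
  Let \<open>x\<close> and \<open>y\<close> be disjointly supported in the unit ball of \<open>\<ell>\<^sub>p\<close>, and let \<open>\<beta>(x, f)\<close> be almost 1. In
  \<open>\<beta>(x + b y, f + c g) + \<beta>(x - b y, f - c g) = 2 \<beta>(x, f) + 2 b c \<beta>(y, g)\<close> the left-hand side is at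
  most \<open>(1 + b\<^sup>p)\<^sup>1\<^sup>/\<^sup>p (2 + C c\<^sup>s)\<close>. Taking \<open>b\<^sup>p = c\<^sup>s = t\<close>, the right-hand side gains
  \<open>2 t\<^sup>1\<^sup>/\<^sup>p\<^sup>+\<^sup>1\<^sup>/\<^sup>s \<beta>(y, g)\<close>, whereas the bound exceeds 2 only by a multiple of \<open>t\<close>. Since \<open>p > r\<close>
  means \<open>1/p + 1/s < 1\<close>, the value \<open>\<beta>(y, g)\<close> has to be small (\<open>tail_bound\<close>). A form with \<open>u(\<beta>)\<close>
  close to 1 does almost attain its norm at some pair \<open>(x, f)\<close> with \<open>x\<close> supported in a fixed finite
  set, because \<open>u\<close> is close to a sum of elementary tensors with such first factors
  (\<open>near_norming_concentrates\<close>).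
\<close>

section \<open>Midpoint convexity of the power function\<close>

text \<open>
  Subtracting \<open>q (q - 1) / 2 * t\<^sup>2\<close> from \<open>t\<^sup>q\<close> leaves a convex function on the unit interval, because
  the second derivative \<open>q (q - 1) t\<^sup>q\<^sup>-\<^sup>2\<close> is at least \<open>q (q - 1)\<close> there.
\<close>

lemma powr_midpoint_gap_nonneg:
  fixes q a b :: real
  assumes q: "1 < q" "q \<le> 2" and a: "0 \<le> a" "a \<le> 1" and b: "0 \<le> b" "b \<le> 1"
  shows "((a + b) / 2) powr q + q * (q - 1) / 8 * (a - b)\<^sup>2 \<le> (a powr q + b powr q) / 2"
proof -
  define c where "c = q * (q - 1) / 2"
  define g where "g = (\<lambda>t::real. t powr q - c * t\<^sup>2)"
  have "convex_on {0<..1} g"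
  proof (rule f''_ge0_imp_convex)
    show "DERIV g x :> q * x powr (q - 1) - 2 * c * x" if "x \<in> {0<..1}" for x
      unfolding g_def using that by (auto intro!: derivative_eq_intros)
    show "DERIV (\<lambda>x. q * x powr (q - 1) - 2 * c * x) x :> q * ((q - 1) * x powr (q - 2)) - 2 * c"
      if "x \<in> {0<..1}" for x
      using that by (auto intro!: derivative_eq_intros simp: algebra_simps)
    show "0 \<le> q * ((q - 1) * x powr (q - 2)) - 2 * c" if "x \<in> {0<..1}" for x
    proof -
      have "1 \<le> x powr (q - 2)"
        using that q powr_mono'[of "q - 2" 0 x] by simp
      then have "q * (q - 1) * 1 \<le> q * (q - 1) * x powr (q - 2)"
        using q by (intro mult_left_mono) auto
      then have "2 * c \<le> q * (q - 1) * x powr (q - 2)" by (simp add: c_def)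
      then show ?thesis by (simp only: mult.assoc)
    qed
  qed (rule convex_real_interval)
  then have mid: "g ((x + y) / 2) \<le> (g x + g y) / 2" if "x \<in> {0<..1}" "y \<in> {0<..1}" for x y
    using convex_onD[of "{0<..1}" g "1/2" x y] that by (simp add: field_simps)
  have "g ((a + b) / 2) \<le> (g a + g b) / 2"
  proof (rule tendsto_le[of "at_left (1::real)"])
    \<comment> \<open>push both points into the open interval, where the second derivative exists\<close>
    let ?x = "\<lambda>s::real. s * a + (1 - s)" and ?y = "\<lambda>s::real. s * b + (1 - s)"
    have cont: "continuous_on {0..1} g"
      unfolding g_def using q by (intro continuous_intros continuous_on_powr') auto
    have lim: "((\<lambda>s. g (f s)) \<longlongrightarrow> g (f 1)) (at_left 1)"
      if "continuous_on {0..1} f" "\<And>s. s \<in> {0..1} \<Longrightarrow> f s \<in> {0..1}" for f :: "real \<Rightarrow> real"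
    proof -
      have "continuous_on {0..1} (g \<circ> f)"
        using that by (intro continuous_on_compose continuous_on_subset[OF cont]) auto
      then have "((g \<circ> f) \<longlongrightarrow> (g \<circ> f) 1) (at 1 within {0..1})"
        unfolding continuous_on_def by auto
      then show ?thesis
        unfolding at_within_Icc_at_left[OF zero_less_one] o_def .
    qed
    have in01: "s * x + (1 - s) \<in> {0..1}" if "s \<in> {0..1}" "0 \<le> x" "x \<le> 1" for s x :: real
      using that mult_left_le[of x s] by auto
    have lx: "((\<lambda>s. g (?x s)) \<longlongrightarrow> g (?x 1)) (at_left 1)"
      by (rule lim) (use in01 a in \<open>auto intro!: continuous_intros simp del: atLeastAtMost_iff\<close>)
    have ly: "((\<lambda>s. g (?y s)) \<longlongrightarrow> g (?y 1)) (at_left 1)"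
      by (rule lim) (use in01 b in \<open>auto intro!: continuous_intros simp del: atLeastAtMost_iff\<close>)
    have "((\<lambda>s. g ((?x s + ?y s) / 2)) \<longlongrightarrow> g ((?x 1 + ?y 1) / 2)) (at_left 1)"
    proof (rule lim)
      show "(?x s + ?y s) / 2 \<in> {0..1}" if "s \<in> {0..1}" for s
        using in01[OF that a] in01[OF that b] by auto
    qed (auto intro!: continuous_intros)
    then show "((\<lambda>s. g ((?x s + ?y s) / 2)) \<longlongrightarrow> g ((a + b) / 2)) (at_left 1)" by simp
    show "((\<lambda>s. (g (?x s) + g (?y s)) / 2) \<longlongrightarrow> (g a + g b) / 2) (at_left 1)"
      using lx ly by (auto intro!: tendsto_intros)
    have "eventually (\<lambda>s. s \<in> {0<..<1::real}) (at_left 1)"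
      by (rule eventually_at_leftI[of 0]) auto
    then show "\<forall>\<^sub>F s in at_left 1. g ((?x s + ?y s) / 2) \<le> (g (?x s) + g (?y s)) / 2"
    proof eventually_elim
      case (elim s)
      have "s * x + (1 - s) \<in> {0<..1}" if "0 \<le> x" "x \<le> 1" for x :: real
        using elim that mult_left_le[of x s] mult_nonneg_nonneg[of s x]
        by (auto intro: add_nonneg_pos)
      then show ?case using a b by (intro mid) auto
    qed
  qed simp
  then show ?thesis
    by (simp add: g_def c_def field_simps power2_eq_square)
qed


text \<open>
  Monotonicity of the same convex function reduces arguments of arbitrary sign to their absolute
  values.
\<close>

lemma powr_minus_square_mono:
  fixes q s t :: real
  assumes q: "1 < q" "q \<le> 2" and st: "0 \<le> s" "s \<le> t" "t \<le> 1"
  shows "s powr q - q * (q - 1) / 2 * s\<^sup>2 \<le> t powr q - q * (q - 1) / 2 * t\<^sup>2"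
proof -
  define c where "c = q * (q - 1) / 2"
  have "q * (q - 1) \<le> 2 * 1" using q by (intro mult_mono) auto
  then have c: "c \<le> 1" by (simp add: c_def)
  have "s powr q - c * s\<^sup>2 \<le> t powr q - c * t\<^sup>2"
  proof (cases "s = 0")
    case True
    have "t\<^sup>2 \<le> t powr q"
    proof (cases "t = 0")
      case False
      then show ?thesis
        using powr_mono'[of q 2 t] q st by (simp add: powr_numeral)
    qed simp
    moreover have "c * t\<^sup>2 \<le> 1 * t\<^sup>2" using c by (intro mult_right_mono) auto
    ultimately show ?thesis using True by simp
  next
    case False
    show ?thesis
    proof (rule DERIV_nonneg_imp_nondecreasing[OF st(2)])
      fix x assume "s \<le> x" "x \<le> t"
      then have x: "0 < x" "x \<le> 1" using False st by auto
      have "((\<lambda>x. x powr q - c * x\<^sup>2) has_real_derivative q * x powr (q - 1) - 2 * c * x) (at x)"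
        using x by (auto intro!: derivative_eq_intros)
      moreover have "x \<le> x powr (q - 1)"
        using powr_mono'[of "q - 1" 1 x] q x by simp
      then have "q * x \<le> q * x powr (q - 1)" using q by simp
      moreover have "(q - 1) * (q * x) \<le> 1 * (q * x)" using q x by (intro mult_right_mono) auto
      then have "2 * c * x \<le> q * x" by (simp add: c_def algebra_simps)
      ultimately show "\<exists>y. ((\<lambda>x. x powr q - c * x\<^sup>2) has_real_derivative y) (at x) \<and> 0 \<le> y"
        by (intro exI[of _ "q * x powr (q - 1) - 2 * c * x"]) simp
    qed
  qed
  then show ?thesis by (simp add: c_def)
qed

lemma powr_midpoint_gap_unit:
  fixes q a b :: real
  assumes q: "1 < q" "q \<le> 2" and ab: "\<bar>a\<bar> \<le> 1" "\<bar>b\<bar> \<le> 1"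
  shows "\<bar>(a + b) / 2\<bar> powr q + q * (q - 1) / 8 * (a - b)\<^sup>2 \<le> (\<bar>a\<bar> powr q + \<bar>b\<bar> powr q) / 2"
proof -
  define c where "c = q * (q - 1) / 2"
  have "\<bar>(a + b) / 2\<bar> powr q - c * \<bar>(a + b) / 2\<bar>\<^sup>2
      \<le> ((\<bar>a\<bar> + \<bar>b\<bar>) / 2) powr q - c * ((\<bar>a\<bar> + \<bar>b\<bar>) / 2)\<^sup>2"
    unfolding c_def using ab by (intro powr_minus_square_mono q) auto
  moreover have "((\<bar>a\<bar> + \<bar>b\<bar>) / 2) powr q + c / 4 * (\<bar>a\<bar> - \<bar>b\<bar>)\<^sup>2 \<le> (\<bar>a\<bar> powr q + \<bar>b\<bar> powr q) / 2"
    using powr_midpoint_gap_nonneg[OF q, of "\<bar>a\<bar>" "\<bar>b\<bar>"] ab by (simp add: c_def)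
  moreover have "c / 4 * (a - b)\<^sup>2 + c * \<bar>(a + b) / 2\<bar>\<^sup>2
      = c / 4 * (\<bar>a\<bar> - \<bar>b\<bar>)\<^sup>2 + c * ((\<bar>a\<bar> + \<bar>b\<bar>) / 2)\<^sup>2"
    by (simp add: power2_eq_square field_simps)
  ultimately have "\<bar>(a + b) / 2\<bar> powr q + c / 4 * (a - b)\<^sup>2 \<le> (\<bar>a\<bar> powr q + \<bar>b\<bar> powr q) / 2"
    by linarith
  then show ?thesis by (simp add: c_def)
qed

lemma powr_midpoint_gap:
  fixes q a b m :: real
  assumes q: "1 < q" "q \<le> 2" and m: "0 < m" "\<bar>a\<bar> \<le> m" "\<bar>b\<bar> \<le> m"
  shows "\<bar>(a + b) / 2\<bar> powr q + q * (q - 1) / 8 * (m powr (q - 2) * (a - b)\<^sup>2)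
           \<le> (\<bar>a\<bar> powr q + \<bar>b\<bar> powr q) / 2"
proof -
  define x y where "x = a / m" and "y = b / m"
  have ab: "a = m * x" "b = m * y"
    using m by (auto simp: x_def y_def)
  have xy: "\<bar>x\<bar> \<le> 1" "\<bar>y\<bar> \<le> 1"
    using m by (auto simp: x_def y_def)
  have powr_m: "\<bar>m * t\<bar> powr q = m powr q * \<bar>t\<bar> powr q" for t
    using m by (simp add: abs_mult powr_mult)
  have "m powr (q - 2) * (a - b)\<^sup>2 = (m powr (q - 2) * m powr 2) * (x - y)\<^sup>2"
    using m by (simp add: ab powr_numeral power_mult_distrib flip: right_diff_distrib)
  also have "\<dots> = m powr q * (x - y)\<^sup>2"
    using m by (simp only: flip: powr_add) simp
  finally have sq: "m powr (q - 2) * (a - b)\<^sup>2 = m powr q * (x - y)\<^sup>2" .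
  have mid: "\<bar>(a + b) / 2\<bar> powr q = m powr q * \<bar>(x + y) / 2\<bar> powr q"
    using powr_m[of "(x + y) / 2"] by (simp add: ab algebra_simps)
  have "m powr q * (\<bar>(x + y) / 2\<bar> powr q + q * (q - 1) / 8 * (x - y)\<^sup>2)
     \<le> m powr q * ((\<bar>x\<bar> powr q + \<bar>y\<bar> powr q) / 2)"
    by (intro mult_left_mono powr_midpoint_gap_unit q xy) auto
  then show ?thesis
    unfolding sq mid by (simp add: ab powr_m algebra_simps)
qed

lemma powr_midpoint_convex:
  fixes s x y :: real
  assumes s: "1 \<le> s"
  shows "\<bar>(x + y) / 2\<bar> powr s \<le> (\<bar>x\<bar> powr s + \<bar>y\<bar> powr s) / 2"
proof -
  have "\<bar>(x + y) / 2\<bar> powr s \<le> ((\<bar>x\<bar> + \<bar>y\<bar>) / 2) powr s"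
    using s by (intro powr_mono2) auto
  also have "\<dots> \<le> (\<bar>x\<bar> powr s + \<bar>y\<bar> powr s) / 2"
  proof (cases "x = 0 \<or> y = 0")
    case True
    have "(z / 2) powr s \<le> z powr s / 2" if "0 \<le> z" for z :: real
    proof -
      have "(1 / 2) powr s \<le> (1 / 2 :: real) powr 1" using s by (intro powr_mono') auto
      then have "z powr s * (1 / 2) powr s \<le> z powr s * (1 / 2)" by (intro mult_left_mono) auto
      then show ?thesis using that by (simp add: powr_divide)
    qed
    with True show ?thesis by auto
  next
    case False
    then have "\<bar>x\<bar> \<in> {0<..}" "\<bar>y\<bar> \<in> {0<..}" by auto
    with convex_onD[OF powr_convex[OF s], of "1/2" "\<bar>x\<bar>" "\<bar>y\<bar>"] show ?thesis
      by (simp add: field_simps)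
  qed
  finally show ?thesis .
qed

text \<open>
  Either \<open>a\<close> and \<open>b\<close> are \<open>\<theta>\<close>-close relative to their size, and the second summand dominates, or
  \<open>\<bar>a - b\<bar>\<^sup>q \<le> (\<theta> m)\<^sup>q\<^sup>-\<^sup>2 \<bar>a - b\<bar>\<^sup>2\<close> with \<open>m = max \<bar>a\<bar> \<bar>b\<bar>\<close>, and the quadratic midpoint gap dominates.
  In this form the inequality can be integrated directly, and \<open>\<theta>\<close> optimised afterwards.
\<close>

lemma powr_diff_le_gap:
  fixes q a b \<theta> :: real
  assumes q: "1 < q" "q \<le> 2" and \<theta>: "0 < \<theta>"
  shows "\<bar>a - b\<bar> powr q \<le> 8 / (q * (q - 1)) * \<theta> powr (q - 2) *
             ((\<bar>a\<bar> powr q + \<bar>b\<bar> powr q) / 2 - \<bar>(a + b) / 2\<bar> powr q)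
           + \<theta> powr q * (\<bar>a\<bar> powr q + \<bar>b\<bar> powr q)"
    (is "_ \<le> ?K * _ * ?gap + _")
proof -
  define m where "m = max \<bar>a\<bar> \<bar>b\<bar>"
  have m: "\<bar>a\<bar> \<le> m" "\<bar>b\<bar> \<le> m" "0 \<le> m" by (auto simp: m_def)
  have K: "0 < q * (q - 1) / 8" using q by simp
  have gap0: "0 \<le> ?gap" using powr_midpoint_convex[of q a b] q by simp
  have Kpos: "0 \<le> ?K" using q by simp
  show ?thesis
  proof (cases "\<bar>a - b\<bar> \<le> \<theta> * m")
    case True
    have "\<bar>a - b\<bar> powr q \<le> (\<theta> * m) powr q"
      using True q by (intro powr_mono2) auto
    also have "\<dots> = \<theta> powr q * m powr q" using \<theta> m by (simp add: powr_mult)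
    also have "\<dots> \<le> \<theta> powr q * (\<bar>a\<bar> powr q + \<bar>b\<bar> powr q)"
      by (intro mult_left_mono) (auto simp: m_def max_def)
    finally have "\<bar>a - b\<bar> powr q \<le> \<theta> powr q * (\<bar>a\<bar> powr q + \<bar>b\<bar> powr q)" .
    moreover have "0 \<le> ?K * \<theta> powr (q - 2) * ?gap"
      using gap0 Kpos by (intro mult_nonneg_nonneg) auto
    ultimately show ?thesis by linarith
  next
    case False
    then have "0 < m" using m by (cases "m = 0") auto
    have "0 \<le> \<theta> * m" using \<theta> m by simp
    then have d: "0 < \<bar>a - b\<bar>" using False by linarith
    have "\<bar>a - b\<bar> powr q = \<bar>a - b\<bar> powr (q - 2) * (a - b)\<^sup>2"
    proof -
      have "(a - b)\<^sup>2 = \<bar>a - b\<bar> powr 2" using d by (simp add: powr_numeral)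
      then show ?thesis by (simp only: flip: powr_add) simp
    qed
    also have "\<dots> \<le> (\<theta> * m) powr (q - 2) * (a - b)\<^sup>2"
      using False \<theta> \<open>0 < m\<close> q by (intro mult_right_mono powr_mono2') auto
    also have "\<dots> = \<theta> powr (q - 2) * (m powr (q - 2) * (a - b)\<^sup>2)"
      using \<theta> m by (simp add: powr_mult)
    also have "m powr (q - 2) * (a - b)\<^sup>2 \<le> ?K * ?gap"
    proof -
      have "q * (q - 1) / 8 * (m powr (q - 2) * (a - b)\<^sup>2) \<le> ?gap"
        using powr_midpoint_gap[OF q \<open>0 < m\<close> m(1,2)] by linarith
      then show ?thesis using K by (simp add: field_simps)
    qed
    finally have "\<bar>a - b\<bar> powr q \<le> \<theta> powr (q - 2) * (?K * ?gap)"
      by (simp add: mult_left_mono)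
    also have "\<dots> = ?K * \<theta> powr (q - 2) * ?gap" by (simp only: ac_simps)
    finally have "\<bar>a - b\<bar> powr q \<le> ?K * \<theta> powr (q - 2) * ?gap" .
    moreover have "0 \<le> \<theta> powr q * (\<bar>a\<bar> powr q + \<bar>b\<bar> powr q)" by simp
    ultimately show ?thesis by linarith
  qed
qed

text \<open>
  With \<open>u = ((a + b) / 2)\<^sup>2\<close> and \<open>v = ((a - b) / 2)\<^sup>2\<close> one has \<open>u + v = (a\<^sup>2 + b\<^sup>2) / 2\<close>, and the power
  \<open>t\<^sup>q\<^sup>/\<^sup>2\<close> is superadditive and convex.
\<close>

lemma Clarkson_scalar:
  fixes q a b :: real
  assumes q: "2 \<le> q"
  shows "\<bar>(a + b) / 2\<bar> powr q + \<bar>(a - b) / 2\<bar> powr q \<le> (\<bar>a\<bar> powr q + \<bar>b\<bar> powr q) / 2"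
proof -
  have sq: "\<bar>t\<bar> powr q = (t\<^sup>2) powr (q / 2)" for t :: real
  proof (cases "t = 0")
    case False
    then have "t\<^sup>2 = \<bar>t\<bar> powr 2" by (simp add: powr_numeral)
    then show ?thesis by (simp only: powr_powr) simp
  qed simp
  have super: "x powr s + y powr s \<le> (x + y) powr s" if "0 \<le> x" "0 \<le> y" "1 \<le> s" for x y s :: real
  proof (cases "x + y = 0")
    case False
    then have p: "0 < x + y" using that by simp
    have frac: "u powr s \<le> u / (x + y) * (x + y) powr s" if "0 \<le> u" "u \<le> x + y" for u
    proof -
      have "(u / (x + y)) powr s \<le> (u / (x + y)) powr 1"
        using that p \<open>1 \<le> s\<close> by (intro powr_mono') auto
      then have "(u / (x + y)) powr s * (x + y) powr s \<le> u / (x + y) * (x + y) powr s"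
        using that p by (intro mult_right_mono) auto
      then show ?thesis using that p by (simp flip: powr_mult)
    qed
    have "x powr s + y powr s \<le> x / (x + y) * (x + y) powr s + y / (x + y) * (x + y) powr s"
      using that by (intro add_mono frac) auto
    also have "\<dots> = (x + y) powr s"
      using p by (simp flip: distrib_right add_divide_distrib)
    finally show ?thesis .
  next
    case True
    then have "x = 0" "y = 0" using that by auto
    then show ?thesis by simp
  qed
  have "\<bar>(a + b) / 2\<bar> powr q + \<bar>(a - b) / 2\<bar> powr q \<le> (((a + b) / 2)\<^sup>2 + ((a - b) / 2)\<^sup>2) powr (q / 2)"
    unfolding sq using q by (intro super) auto
  also have "((a + b) / 2)\<^sup>2 + ((a - b) / 2)\<^sup>2 = (a\<^sup>2 + b\<^sup>2) / 2"
    by (simp add: power2_eq_square field_simps)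
  also have "((a\<^sup>2 + b\<^sup>2) / 2) powr (q / 2) \<le> (\<bar>a\<bar> powr q + \<bar>b\<bar> powr q) / 2"
    unfolding sq using powr_midpoint_convex[of "q / 2" "a\<^sup>2" "b\<^sup>2"] q by simp
  finally show ?thesis .
qed

section \<open>Uniform convexity of the spaces \<open>L\<^sub>q\<close>\<close>

lemma abs_add_powr_le:
  fixes a b q :: real
  assumes "0 \<le> q"
  shows "\<bar>a + b\<bar> powr q \<le> 2 powr q * (\<bar>a\<bar> powr q + \<bar>b\<bar> powr q)"
proof -
  have "\<bar>a + b\<bar> powr q \<le> (2 * max \<bar>a\<bar> \<bar>b\<bar>) powr q"
    using assms by (intro powr_mono2) auto
  also have "\<dots> = 2 powr q * max \<bar>a\<bar> \<bar>b\<bar> powr q" by (simp add: powr_mult)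
  also have "\<dots> \<le> 2 powr q * (\<bar>a\<bar> powr q + \<bar>b\<bar> powr q)"
    by (intro mult_left_mono) (auto simp: max_def)
  finally show ?thesis .
qed

lemma Lq_functions_cmult:
  assumes "f \<in> Lq_functions q M"
  shows "(\<lambda>x. c * f x) \<in> Lq_functions q M"
  using assms by (auto simp: Lq_functions_def abs_mult powr_mult)

lemma Lq_functions_add:
  assumes q: "0 \<le> q" and f: "f \<in> Lq_functions q M" and g: "g \<in> Lq_functions q M"
  shows "(\<lambda>x. f x + g x) \<in> Lq_functions q M"
proof -
  have [measurable]: "f \<in> borel_measurable M" "g \<in> borel_measurable M"
    using f g by (auto simp: Lq_functions_def)
  have "integrable M (\<lambda>x. 2 powr q * (\<bar>f x\<bar> powr q + \<bar>g x\<bar> powr q))"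
    using f g by (auto simp: Lq_functions_def)
  then have "integrable M (\<lambda>x. \<bar>f x + g x\<bar> powr q)"
    by (rule Bochner_Integration.integrable_bound) (use abs_add_powr_le[OF q] in auto)
  then show ?thesis by (simp add: Lq_functions_def)
qed

text \<open>
  For \<open>q \<ge> 2\<close> this is Clarkson's inequality. For \<open>q < 2\<close> write \<open>D\<close> for the integral of \<open>\<bar>f - g\<bar>\<^sup>q\<close>; in the
  integrated form of \<open>powr_diff_le_gap\<close> the choice \<open>\<theta>\<^sup>q = D / 4\<close> leaves a gap of order
  \<open>\<theta>\<^sup>2\<^sup>-\<^sup>q D\<close>, that is \<open>D\<^sup>2\<^sup>/\<^sup>q\<close>.
\<close>

lemma Lq_functions_uniformly_convex:
  fixes q :: real
  assumes q: "1 < q"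
  obtains \<kappa> where "0 < \<kappa>"
    "\<And>(M :: 'm measure) f g. f \<in> Lq_functions q M \<Longrightarrow> g \<in> Lq_functions q M \<Longrightarrow>
       (\<integral>x. \<bar>f x\<bar> powr q \<partial>M) \<le> 1 \<Longrightarrow> (\<integral>x. \<bar>g x\<bar> powr q \<partial>M) \<le> 1 \<Longrightarrow>
       (\<integral>x. \<bar>(f x + g x) / 2\<bar> powr q \<partial>M)
         \<le> 1 - \<kappa> * (\<integral>x. \<bar>f x - g x\<bar> powr q \<partial>M) powr (max 2 q / q)"
proof -
  have int: "integrable M (\<lambda>x. \<bar>(f x + g x) / 2\<bar> powr q)" "integrable M (\<lambda>x. \<bar>f x - g x\<bar> powr q)"
    "integrable M (\<lambda>x. \<bar>f x\<bar> powr q)" "integrable M (\<lambda>x. \<bar>g x\<bar> powr q)"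
    if "f \<in> Lq_functions q M" "g \<in> Lq_functions q M" for f g and M :: "'m measure"
    using Lq_functions_cmult[OF Lq_functions_add[OF _ that], of "1/2"] q that
      Lq_functions_add[OF _ that(1) Lq_functions_cmult[OF that(2), of "-1"]]
    by (auto simp: Lq_functions_def)
  show ?thesis
  proof (cases "2 \<le> q")
    case True
    show ?thesis
    proof (rule that[of "2 powr (-q)"])
      fix M :: "'m measure" and f g
      assume fg: "f \<in> Lq_functions q M" "g \<in> Lq_functions q M"
        and le: "(\<integral>x. \<bar>f x\<bar> powr q \<partial>M) \<le> 1" "(\<integral>x. \<bar>g x\<bar> powr q \<partial>M) \<le> 1"
      note I = int[OF fg]
      have "(\<integral>x. \<bar>(f x + g x) / 2\<bar> powr q \<partial>M) + 2 powr (-q) * (\<integral>x. \<bar>f x - g x\<bar> powr q \<partial>M)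
          = (\<integral>x. \<bar>(f x + g x) / 2\<bar> powr q + 2 powr (-q) * \<bar>f x - g x\<bar> powr q \<partial>M)"
        using I by simp
      also have "\<dots> \<le> (\<integral>x. (\<bar>f x\<bar> powr q + \<bar>g x\<bar> powr q) / 2 \<partial>M)"
      proof (rule integral_mono)
        fix x
        have "\<bar>(f x - g x) / 2\<bar> powr q = 2 powr (-q) * \<bar>f x - g x\<bar> powr q"
          by (simp add: powr_divide powr_minus_divide)
        then show "\<bar>(f x + g x) / 2\<bar> powr q + 2 powr (-q) * \<bar>f x - g x\<bar> powr q
            \<le> (\<bar>f x\<bar> powr q + \<bar>g x\<bar> powr q) / 2"
          using Clarkson_scalar[OF True, of "f x" "g x"] by simp
      qed (use I in auto)
      also have "\<dots> \<le> 1" using I le by simp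
      finally show "(\<integral>x. \<bar>(f x + g x) / 2\<bar> powr q \<partial>M)
         \<le> 1 - 2 powr (-q) * (\<integral>x. \<bar>f x - g x\<bar> powr q \<partial>M) powr (max 2 q / q)"
        using True q by (simp add: max_absorb2)
    qed simp
  next
    case False
    define K where "K = 8 / (q * (q - 1))"
    have K: "0 < K" using q by (simp add: K_def)
    define \<kappa> where "\<kappa> = (1 / 4) powr ((2 - q) / q) / (2 * K)"
    show ?thesis
    proof (rule that[of \<kappa>])
      show "0 < \<kappa>" using K by (simp add: \<kappa>_def)
      fix M :: "'m measure" and f g
      assume fg: "f \<in> Lq_functions q M" "g \<in> Lq_functions q M"
        and le: "(\<integral>x. \<bar>f x\<bar> powr q \<partial>M) \<le> 1" "(\<integral>x. \<bar>g x\<bar> powr q \<partial>M) \<le> 1"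
      note I = int[OF fg]
      define D where "D = (\<integral>x. \<bar>f x - g x\<bar> powr q \<partial>M)"
      define E where "E = (\<integral>x. \<bar>(f x + g x) / 2\<bar> powr q \<partial>M)"
      have D0: "0 \<le> D" by (simp add: D_def)
      have avg: "(\<integral>x. (\<bar>f x\<bar> powr q + \<bar>g x\<bar> powr q) / 2 \<partial>M) \<le> 1" using I le by simp
      have E1: "E \<le> 1"
      proof -
        have "E \<le> (\<integral>x. (\<bar>f x\<bar> powr q + \<bar>g x\<bar> powr q) / 2 \<partial>M)"
          unfolding E_def using I q by (intro integral_mono powr_midpoint_convex) auto
        with avg show ?thesis by simp
      qed
      have "E \<le> 1 - \<kappa> * D powr (2 / q)"
      proof (cases "D = 0")
        case False
        then have Dp: "0 < D" using D0 by simp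
        \<comment> \<open>the points where \<open>f\<close> and \<open>g\<close> are \<open>\<theta>\<close>-close then carry at most half of \<open>D\<close>\<close>
        define \<theta> where "\<theta> = (D / 4) powr (1 / q)"
        have \<theta>: "0 < \<theta>" "\<theta> powr q = D / 4" using Dp q by (auto simp: \<theta>_def powr_powr)
        have "D \<le> (\<integral>x. K * \<theta> powr (q - 2) *
             ((\<bar>f x\<bar> powr q + \<bar>g x\<bar> powr q) / 2 - \<bar>(f x + g x) / 2\<bar> powr q)
           + \<theta> powr q * (\<bar>f x\<bar> powr q + \<bar>g x\<bar> powr q) \<partial>M)"
          unfolding D_def
        proof (rule integral_mono)
          fix x
          show "\<bar>f x - g x\<bar> powr q \<le> K * \<theta> powr (q - 2) *
             ((\<bar>f x\<bar> powr q + \<bar>g x\<bar> powr q) / 2 - \<bar>(f x + g x) / 2\<bar> powr q)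
           + \<theta> powr q * (\<bar>f x\<bar> powr q + \<bar>g x\<bar> powr q)"
            unfolding K_def by (rule powr_diff_le_gap) (use q \<open>\<not> 2 \<le> q\<close> \<theta> in auto)
        qed (use I in auto)
        also have "\<dots> = K * \<theta> powr (q - 2) *
             ((\<integral>x. (\<bar>f x\<bar> powr q + \<bar>g x\<bar> powr q) / 2 \<partial>M) - E)
           + \<theta> powr q * ((\<integral>x. \<bar>f x\<bar> powr q \<partial>M) + (\<integral>x. \<bar>g x\<bar> powr q \<partial>M))"
          unfolding E_def using I by simp
        also have "\<dots> \<le> K * \<theta> powr (q - 2) * (1 - E) + \<theta> powr q * (1 + 1)"
          using K avg le by (intro add_mono mult_left_mono) auto
        finally have "D / 2 \<le> K * \<theta> powr (q - 2) * (1 - E)"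
          unfolding \<theta>(2) by simp
        then have "\<theta> powr (2 - q) * (D / 2) \<le> \<theta> powr (2 - q) * (K * \<theta> powr (q - 2) * (1 - E))"
          by (intro mult_left_mono) auto
        also have "\<dots> = (\<theta> powr (2 - q) * \<theta> powr (q - 2)) * (K * (1 - E))" by (simp only: ac_simps)
        also have "\<theta> powr (2 - q) * \<theta> powr (q - 2) = 1" using \<theta> by (simp flip: powr_add)
        finally have main: "\<theta> powr (2 - q) * (D / 2) \<le> K * (1 - E)" by simp
        have "\<theta> powr (2 - q) = (1 / 4) powr ((2 - q) / q) * D powr ((2 - q) / q)"
          unfolding \<theta>_def using Dp by (simp add: powr_powr powr_divide)
        moreover have "D powr ((2 - q) / q) * D = D powr (2 / q)"
        proof -
          have "(2 - q) / q + 1 = 2 / q" using q by (simp add: field_simps)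
          then show ?thesis using Dp powr_add[of D "(2 - q) / q" 1] by simp
        qed
        ultimately have "K * (\<kappa> * D powr (2 / q)) = \<theta> powr (2 - q) * (D / 2)"
          using K by (simp add: \<kappa>_def)
        with main have "K * (\<kappa> * D powr (2 / q)) \<le> K * (1 - E)" by simp
        then show ?thesis using K by simp
      qed (use E1 in simp)
      then show "(\<integral>x. \<bar>(f x + g x) / 2\<bar> powr q \<partial>M)
         \<le> 1 - \<kappa> * (\<integral>x. \<bar>f x - g x\<bar> powr q \<partial>M) powr (max 2 q / q)"
        using False by (simp add: E_def D_def max_def)
    qed
  qed
qed

definition Lq_class :: "real \<Rightarrow> 'm measure \<Rightarrow> ('m \<Rightarrow> real) \<Rightarrow> ('m \<Rightarrow> real) set" where
  "Lq_class q M f = ae_rel q M `` {f}"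

lemma equiv_ae_rel: "equiv (Lq_functions q M) (ae_rel q M)"
proof (rule equivI)
  show "ae_rel q M \<subseteq> Lq_functions q M \<times> Lq_functions q M"
    by (auto simp: ae_rel_def)
  show "refl_on (Lq_functions q M) (ae_rel q M)"
    by (auto simp: refl_on_def ae_rel_def)
  show "sym (ae_rel q M)"
    by (auto simp: sym_def ae_rel_def)
  show "trans (ae_rel q M)"
    by (force simp: trans_def ae_rel_def)
qed

lemma Lq_class_eq:
  "f \<in> Lq_functions q M \<Longrightarrow> g \<in> Lq_class q M f \<Longrightarrow> Lq_class q M g = Lq_class q M f"
  unfolding Lq_class_def by (rule equiv_class_eq[OF equiv_ae_rel, symmetric]) (simp add: Image_singleton_iff)

lemma carr_Lq_space: "carr (Lq_space q M) = Lq_class q M ` Lq_functions q M"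
  by (auto simp: Lq_space_def quotient_def Lq_class_def)

lemma Lq_class_self: "f \<in> Lq_functions q M \<Longrightarrow> f \<in> Lq_class q M f"
  by (auto simp: Lq_class_def ae_rel_def)

lemma UN_const_on:
  assumes "x \<in> A" "\<And>y. y \<in> A \<Longrightarrow> F y = F x"
  shows "(\<Union>y\<in>A. F y) = F x"
  using assms by blast

lemma the_elem_image_const:
  assumes "x \<in> A" "\<And>y. y \<in> A \<Longrightarrow> F y = F x"
  shows "the_elem (F ` A) = F x"
proof -
  have "F ` A = {F x}" using assms by blast
  then show ?thesis by simp
qed

lemma nplus_Lq_class:
  assumes q: "0 \<le> q" and f: "f \<in> Lq_functions q M" and g: "g \<in> Lq_functions q M"
  shows "nplus (Lq_space q M) (Lq_class q M f) (Lq_class q M g) = Lq_class q M (\<lambda>x. f x + g x)"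
proof -
  have "Lq_class q M (\<lambda>x. f' x + g' x) = Lq_class q M (\<lambda>x. f x + g x)"
    if "f' \<in> Lq_class q M f" "g' \<in> Lq_class q M g" for f' g'
  proof (rule Lq_class_eq)
    have *: "f' \<in> Lq_functions q M" "g' \<in> Lq_functions q M" "AE x in M. f x = f' x" "AE x in M. g x = g' x"
      using that by (auto simp: Lq_class_def ae_rel_def)
    then have "AE x in M. f x + g x = f' x + g' x" by auto
    then show "(\<lambda>x. f' x + g' x) \<in> Lq_class q M (\<lambda>x. f x + g x)"
      using * f g q by (auto simp: Lq_class_def ae_rel_def intro: Lq_functions_add)
  qed (intro Lq_functions_add q f g)
  then have inner: "(\<Union>g'\<in>Lq_class q M g. Lq_class q M (\<lambda>x. f' x + g' x))
      = Lq_class q M (\<lambda>x. f x + g x)" if "f' \<in> Lq_class q M f" for f'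
    using UN_const_on[OF Lq_class_self[OF g], of "\<lambda>g'. Lq_class q M (\<lambda>x. f' x + g' x)"] that
      Lq_class_self[OF g] by simp
  have "(\<Union>f'\<in>Lq_class q M f. \<Union>g'\<in>Lq_class q M g. Lq_class q M (\<lambda>x. f' x + g' x))
      = Lq_class q M (\<lambda>x. f x + g x)"
    using UN_const_on[OF Lq_class_self[OF f],
        of "\<lambda>f'. \<Union>g'\<in>Lq_class q M g. Lq_class q M (\<lambda>x. f' x + g' x)"]
      inner Lq_class_self[OF f] by simp
  then show ?thesis by (simp add: Lq_space_def flip: Lq_class_def)
qed

lemma scale_Lq_class:
  assumes f: "f \<in> Lq_functions q M"
  shows "scale (Lq_space q M) c (Lq_class q M f) = Lq_class q M (\<lambda>x. c * f x)"
proof -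
  have "Lq_class q M (\<lambda>x. c * f' x) = Lq_class q M (\<lambda>x. c * f x)" if "f' \<in> Lq_class q M f" for f'
  proof (rule Lq_class_eq)
    have *: "f' \<in> Lq_functions q M" "AE x in M. f x = f' x"
      using that by (auto simp: Lq_class_def ae_rel_def)
    then have "AE x in M. c * f x = c * f' x" by auto
    then show "(\<lambda>x. c * f' x) \<in> Lq_class q M (\<lambda>x. c * f x)"
      using * f by (auto simp: Lq_class_def ae_rel_def intro: Lq_functions_cmult)
  qed (intro Lq_functions_cmult f)
  then have "(\<Union>f'\<in>Lq_class q M f. Lq_class q M (\<lambda>x. c * f' x)) = Lq_class q M (\<lambda>x. c * f x)"
    by (rule UN_const_on[OF Lq_class_self[OF f]])
  then show ?thesis by (simp add: Lq_space_def flip: Lq_class_def)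
qed

lemma nrm_Lq_class:
  assumes f: "f \<in> Lq_functions q M"
  shows "nrm (Lq_space q M) (Lq_class q M f) = (\<integral>x. \<bar>f x\<bar> powr q \<partial>M) powr (1 / q)"
proof -
  have "(\<integral>x. \<bar>f' x\<bar> powr q \<partial>M) = (\<integral>x. \<bar>f x\<bar> powr q \<partial>M)" if "f' \<in> Lq_class q M f" for f'
  proof (rule integral_cong_AE)
    have *: "f' \<in> Lq_functions q M" "AE x in M. f x = f' x"
      using that by (auto simp: Lq_class_def ae_rel_def)
    then show "(\<lambda>x. \<bar>f' x\<bar> powr q) \<in> borel_measurable M" "(\<lambda>x. \<bar>f x\<bar> powr q) \<in> borel_measurable M"
      using f by (auto simp: Lq_functions_def)
    show "AE x in M. \<bar>f' x\<bar> powr q = \<bar>f x\<bar> powr q" using *(2) by auto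
  qed
  then have "the_elem ((\<lambda>f. (\<integral>x. \<bar>f x\<bar> powr q \<partial>M) powr (1 / q)) ` Lq_class q M f)
      = (\<integral>x. \<bar>f x\<bar> powr q \<partial>M) powr (1 / q)"
    by (intro the_elem_image_const[OF Lq_class_self[OF f]]) (simp only:)
  then show ?thesis by (simp add: Lq_space_def)
qed

lemma nrm_Lq_nonneg: "P \<in> carr (Lq_space q M) \<Longrightarrow> 0 \<le> nrm (Lq_space q M) P"
  by (auto simp: carr_Lq_space nrm_Lq_class)

lemma nrm_Lq_scale:
  assumes "0 < q" "P \<in> carr (Lq_space q M)"
  shows "nrm (Lq_space q M) (scale (Lq_space q M) c P) = \<bar>c\<bar> * nrm (Lq_space q M) P"
proof -
  obtain f where f: "f \<in> Lq_functions q M" "P = Lq_class q M f"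
    using assms by (auto simp: carr_Lq_space)
  have "0 \<le> (\<integral>x. \<bar>f x\<bar> powr q \<partial>M)" by simp
  then have "(\<integral>x. \<bar>c * f x\<bar> powr q \<partial>M) powr (1 / q) = \<bar>c\<bar> * (\<integral>x. \<bar>f x\<bar> powr q \<partial>M) powr (1 / q)"
    using assms by (simp add: abs_mult powr_mult powr_powr)
  then show ?thesis
    using f by (simp add: scale_Lq_class nrm_Lq_class Lq_functions_cmult)
qed

text \<open>
  The estimate for integrals passes to norms by \<open>E\<^sup>1\<^sup>/\<^sup>q \<le> 1 - (1 - E) / q\<close>, the weighted inequality of
  the arithmetic and geometric means for \<open>E\<close> and 1.
\<close>

lemma Lq_space_uniformly_convex:
  fixes q :: real
  assumes q: "1 < q"
  obtains \<kappa> where "0 < \<kappa>"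
    "\<And>(M :: 'm measure) P Q. P \<in> carr (Lq_space q M) \<Longrightarrow> Q \<in> carr (Lq_space q M) \<Longrightarrow>
       nrm (Lq_space q M) P \<le> 1 \<Longrightarrow> nrm (Lq_space q M) Q \<le> 1 \<Longrightarrow>
       nrm (Lq_space q M) (nplus (Lq_space q M) P Q)
         \<le> 2 - \<kappa> * nrm (Lq_space q M) (nminus (Lq_space q M) P Q) powr (max 2 q)"
proof (rule Lq_functions_uniformly_convex[OF q, where 'm = 'm])
  fix \<kappa>
  assume \<kappa>: "0 < \<kappa>"
    "\<And>(M :: 'm measure) f g. f \<in> Lq_functions q M \<Longrightarrow> g \<in> Lq_functions q M \<Longrightarrow>
       (\<integral>x. \<bar>f x\<bar> powr q \<partial>M) \<le> 1 \<Longrightarrow> (\<integral>x. \<bar>g x\<bar> powr q \<partial>M) \<le> 1 \<Longrightarrow>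
       (\<integral>x. \<bar>(f x + g x) / 2\<bar> powr q \<partial>M)
         \<le> 1 - \<kappa> * (\<integral>x. \<bar>f x - g x\<bar> powr q \<partial>M) powr (max 2 q / q)"
  show thesis
  proof (rule that[of "2 * \<kappa> / q"])
    show "0 < 2 * \<kappa> / q" using \<kappa> q by simp
    fix M :: "'m measure" and P Q
    assume PQ: "P \<in> carr (Lq_space q M)" "Q \<in> carr (Lq_space q M)"
      and le: "nrm (Lq_space q M) P \<le> 1" "nrm (Lq_space q M) Q \<le> 1"
    obtain f g where f: "f \<in> Lq_functions q M" "P = Lq_class q M f"
      and g: "g \<in> Lq_functions q M" "Q = Lq_class q M g"
      using PQ by (auto simp: carr_Lq_space)
    have le1: "t \<le> 1" if "t powr (1 / q) \<le> 1" "0 \<le> t" for t :: real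
    proof -
      have "(t powr (1 / q)) powr q \<le> 1 powr q" using that q by (intro powr_mono2) auto
      then show ?thesis using that q by (simp add: powr_powr)
    qed
    have fg: "(\<integral>x. \<bar>f x\<bar> powr q \<partial>M) \<le> 1" "(\<integral>x. \<bar>g x\<bar> powr q \<partial>M) \<le> 1"
      using le by (auto simp: f g nrm_Lq_class intro!: le1)
    define E where "E = (\<integral>x. \<bar>(f x + g x) / 2\<bar> powr q \<partial>M)"
    define D where "D = (\<integral>x. \<bar>f x - g x\<bar> powr q \<partial>M)"
    have sum: "(\<lambda>x. f x + g x) \<in> Lq_functions q M"
      using q f g by (intro Lq_functions_add) auto
    have diff: "(\<lambda>x. f x + (-1) * g x) \<in> Lq_functions q M"
      using q f g Lq_functions_cmult[of g q M "-1"] by (intro Lq_functions_add) auto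
    have nsum: "nrm (Lq_space q M) (nplus (Lq_space q M) P Q) = 2 * E powr (1 / q)"
    proof -
      have "E = (1 / 2) powr q * (\<integral>x. \<bar>f x + g x\<bar> powr q \<partial>M)"
        by (simp add: E_def powr_divide)
      then have "E powr (1 / q) = 1 / 2 * (\<integral>x. \<bar>f x + g x\<bar> powr q \<partial>M) powr (1 / q)"
        using q by (simp add: powr_mult powr_powr)
      then show ?thesis using q f g sum by (simp add: nplus_Lq_class nrm_Lq_class)
    qed
    have ndiff: "nrm (Lq_space q M) (nminus (Lq_space q M) P Q) = D powr (1 / q)"
    proof -
      have "nminus (Lq_space q M) P Q = Lq_class q M (\<lambda>x. f x + (-1) * g x)"
        unfolding nminus_def f(2) g(2) scale_Lq_class[OF g(1)]
        by (intro nplus_Lq_class Lq_functions_cmult f g) (use q in simp)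
      then show ?thesis by (simp only: nrm_Lq_class[OF diff]) (simp add: D_def)
    qed
    have "E \<le> 1 - \<kappa> * D powr (max 2 q / q)"
      unfolding E_def D_def by (rule \<kappa>(2)[OF f(1) g(1) fg])
    moreover have "E powr (1 / q) \<le> 1 - (1 - E) / q"
    proof -
      have "0 \<le> E" by (simp add: E_def)
      show ?thesis
      proof (cases "E = 0")
        case False
        then have "E powr (1 / q) * 1 powr (1 - 1 / q) \<le> 1 / q * E + (1 - 1 / q) * 1"
          using q \<open>0 \<le> E\<close> by (intro Youngs_inequality_0) auto
        then show ?thesis by (simp add: diff_divide_distrib)
      qed (use q in simp)
    qed
    moreover have "\<kappa> * D powr (max 2 q / q) / q \<le> (1 - E) / q" if "E \<le> 1 - \<kappa> * D powr (max 2 q / q)"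
      using q that by (intro divide_right_mono) auto
    ultimately have "E powr (1 / q) \<le> 1 - \<kappa> * D powr (max 2 q / q) / q" by linarith
    moreover have "D powr (max 2 q / q) = (D powr (1 / q)) powr (max 2 q)"
      by (simp add: powr_powr)
    ultimately show "nrm (Lq_space q M) (nplus (Lq_space q M) P Q)
         \<le> 2 - 2 * \<kappa> / q * nrm (Lq_space q M) (nminus (Lq_space q M) P Q) powr (max 2 q)"
      unfolding nsum ndiff by simp
  qed
qed

section \<open>Spaces of functions and the Hahn-Banach theorem\<close>

text \<open>
  The common structure of the spaces from which duals and projective tensor products are formed:
  both constructions produce norms with the triangle inequality out of homogeneity alone.
\<close>

locale homogeneous_space =
  fixes X :: "'a nspace"
  assumes carr_nonempty: "carr X \<noteq> {}"
    and plus_in: "u \<in> carr X \<Longrightarrow> v \<in> carr X \<Longrightarrow> nplus X u v \<in> carr X"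
    and scale_in: "u \<in> carr X \<Longrightarrow> scale X c u \<in> carr X"
    and nrm_nonneg: "u \<in> carr X \<Longrightarrow> 0 \<le> nrm X u"
    and nrm_scale: "u \<in> carr X \<Longrightarrow> nrm X (scale X c u) = \<bar>c\<bar> * nrm X u"
begin

lemma minus_in: "u \<in> carr X \<Longrightarrow> v \<in> carr X \<Longrightarrow> nminus X u v \<in> carr X"
  by (simp add: nminus_def plus_in scale_in)

end

locale function_space = homogeneous_space X for X :: "('c \<Rightarrow> real) nspace" +
  assumes plus_eq: "nplus X u v = (\<lambda>x. u x + v x)"
    and scale_eq: "scale X c u = (\<lambda>x. c * u x)"
begin

lemma add_in: "u \<in> carr X \<Longrightarrow> v \<in> carr X \<Longrightarrow> (\<lambda>x. u x + v x) \<in> carr X"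
  using plus_in by (simp add: plus_eq)

lemma cmult_in: "u \<in> carr X \<Longrightarrow> (\<lambda>x. c * u x) \<in> carr X"
  using scale_in by (simp add: scale_eq)

lemma zero_in: "(\<lambda>x. 0) \<in> carr X"
  using carr_nonempty cmult_in[of _ 0] by auto

lemma diff_in: "u \<in> carr X \<Longrightarrow> v \<in> carr X \<Longrightarrow> (\<lambda>x. u x - v x) \<in> carr X"
  using add_in[of u "\<lambda>x. -1 * v x"] cmult_in[of v "-1"] by simp

lemma nminus_eq: "nminus X u v = (\<lambda>x. u x - v x)"
  by (simp add: nminus_def plus_eq scale_eq)

lemma nrm_cmult: "u \<in> carr X \<Longrightarrow> nrm X (\<lambda>x. c * u x) = \<bar>c\<bar> * nrm X u"
  using nrm_scale by (simp add: scale_eq)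

lemma nrm_zero: "nrm X (\<lambda>x. 0) = 0"
  using nrm_cmult[OF zero_in, of 0] by simp

lemma nrm_minus: "u \<in> carr X \<Longrightarrow> nrm X (\<lambda>x. - u x) = nrm X u"
  using nrm_cmult[of u "-1"] by simp

lemma linear_form_add:
  "linear_form X f \<Longrightarrow> u \<in> carr X \<Longrightarrow> v \<in> carr X \<Longrightarrow> f (\<lambda>x. u x + v x) = f u + f v"
  by (auto simp: linear_form_def plus_eq)

lemma linear_form_cmult: "linear_form X f \<Longrightarrow> u \<in> carr X \<Longrightarrow> f (\<lambda>x. c * u x) = c * f u"
  by (auto simp: linear_form_def scale_eq)

lemma linear_form_zero: "linear_form X f \<Longrightarrow> f (\<lambda>x. 0) = 0"
  using linear_form_cmult[OF _ zero_in, of f 0] by simp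

lemma linear_form_minus: "linear_form X f \<Longrightarrow> u \<in> carr X \<Longrightarrow> f (\<lambda>x. - u x) = - f u"
  using linear_form_cmult[of f u "-1"] by simp

lemma linear_form_diff:
  "linear_form X f \<Longrightarrow> u \<in> carr X \<Longrightarrow> v \<in> carr X \<Longrightarrow> f (\<lambda>x. u x - v x) = f u - f v"
  using linear_form_add[of f u "\<lambda>x. -1 * v x"] linear_form_cmult[of f v "-1"] cmult_in[of v "-1"]
  by simp

definition sublinear :: "(('c \<Rightarrow> real) \<Rightarrow> real) \<Rightarrow> bool" where
  "sublinear p \<longleftrightarrow>
     (\<forall>u\<in>carr X. \<forall>v\<in>carr X. p (\<lambda>x. u x + v x) \<le> p u + p v) \<and>
     (\<forall>c>0. \<forall>u\<in>carr X. p (\<lambda>x. c * u x) \<le> c * p u)"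

lemma sublinear_add:
  "sublinear p \<Longrightarrow> u \<in> carr X \<Longrightarrow> v \<in> carr X \<Longrightarrow> p (\<lambda>x. u x + v x) \<le> p u + p v"
  by (auto simp: sublinear_def)

lemma sublinear_cmult:
  assumes "sublinear p" "0 < c" "u \<in> carr X"
  shows "p (\<lambda>x. c * u x) = c * p u"
proof (rule antisym)
  show "p (\<lambda>x. c * u x) \<le> c * p u" using assms by (auto simp: sublinear_def)
  have "p (\<lambda>x. 1 / c * (c * u x)) \<le> 1 / c * p (\<lambda>x. c * u x)"
    using assms cmult_in[OF assms(3), of c] unfolding sublinear_def
    by (metis divide_pos_pos zero_less_one)
  then show "c * p u \<le> p (\<lambda>x. c * u x)" using assms by (simp add: field_simps)
qed

lemma sublinear_zero:
  assumes "sublinear p"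
  shows "p (\<lambda>x. 0) = 0"
  using sublinear_cmult[OF assms _ zero_in, of 2] by simp

lemma sublinear_lower:
  assumes "sublinear p" "u \<in> carr X"
  shows "- p (\<lambda>x. - u x) \<le> p u"
proof -
  have "(\<lambda>x. - u x) \<in> carr X" using cmult_in[OF assms(2), of "-1"] by simp
  then have "p (\<lambda>x. u x + - u x) \<le> p u + p (\<lambda>x. - u x)" by (rule sublinear_add[OF assms])
  then show ?thesis using sublinear_zero[OF assms(1)] by simp
qed

text \<open>
  For sublinear \<open>p\<close> this is the largest sublinear functional below \<open>p\<close> whose value at \<open>-y\<close> is at
  most \<open>- p y\<close>, hence one that is linear along \<open>y\<close>.
\<close>

definition straighten :: "(('c \<Rightarrow> real) \<Rightarrow> real) \<Rightarrow> ('c \<Rightarrow> real) \<Rightarrow> ('c \<Rightarrow> real) \<Rightarrow> real" where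
  "straighten p y u = (if u \<in> carr X then INF t\<in>{0..}. p (\<lambda>x. u x + t * y x) - t * p y else 0)"

lemma
  assumes p: "sublinear p" and y: "y \<in> carr X"
  shows sublinear_straighten: "sublinear (straighten p y)"
    and straighten_le: "u \<in> carr X \<Longrightarrow> 0 \<le> t \<Longrightarrow> straighten p y u \<le> p (\<lambda>x. u x + t * y x) - t * p y"
proof -
  have lower: "- p (\<lambda>x. - u x) \<le> p (\<lambda>x. u x + t * y x) - t * p y" if "u \<in> carr X" "0 \<le> t" for u t
  proof -
    have "p (\<lambda>x. (u x + t * y x) + - u x) \<le> p (\<lambda>x. u x + t * y x) + p (\<lambda>x. - u x)"
      using that y cmult_in[OF that(1), of "-1"] by (intro sublinear_add[OF p] add_in cmult_in) auto
    moreover have "p (\<lambda>x. t * y x) = t * p y"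
      using that sublinear_cmult[OF p _ y] sublinear_zero[OF p] by (cases "t = 0") auto
    ultimately show ?thesis by simp
  qed
  have bdd: "bdd_below ((\<lambda>t. p (\<lambda>x. u x + t * y x) - t * p y) ` {0..})" if "u \<in> carr X" for u
    using lower[OF that] by (intro bdd_belowI[of _ "- p (\<lambda>x. - u x)"]) auto
  show le: "straighten p y u \<le> p (\<lambda>x. u x + t * y x) - t * p y" if "u \<in> carr X" "0 \<le> t" for u t
    using that unfolding straighten_def by (auto intro!: cINF_lower bdd)
  have ge: "m \<le> straighten p y u"
    if "u \<in> carr X" "\<And>t. 0 \<le> t \<Longrightarrow> m \<le> p (\<lambda>x. u x + t * y x) - t * p y" for u m
    using that unfolding straighten_def by (auto intro!: cINF_greatest)
  show "sublinear (straighten p y)"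
    unfolding sublinear_def
  proof (intro conjI ballI allI impI)
    fix u v assume u: "u \<in> carr X" and v: "v \<in> carr X"
    have "straighten p y (\<lambda>x. u x + v x) - (p (\<lambda>x. u x + t * y x) - t * p y) \<le> straighten p y v"
      if "0 \<le> t" for t
    proof (rule ge[OF v])
      fix s :: real assume "0 \<le> s"
      have "p (\<lambda>x. (u x + t * y x) + (v x + s * y x)) \<le> p (\<lambda>x. u x + t * y x) + p (\<lambda>x. v x + s * y x)"
        using u v y by (intro sublinear_add[OF p] add_in cmult_in)
      moreover have "(\<lambda>x. (u x + t * y x) + (v x + s * y x)) = (\<lambda>x. (u x + v x) + (t + s) * y x)"
        by (simp add: algebra_simps)
      moreover have "straighten p y (\<lambda>x. u x + v x) \<le> p (\<lambda>x. (u x + v x) + (t + s) * y x) - (t + s) * p y"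
        using u v \<open>0 \<le> s\<close> that by (intro le add_in) auto
      ultimately show "straighten p y (\<lambda>x. u x + v x) - (p (\<lambda>x. u x + t * y x) - t * p y)
          \<le> p (\<lambda>x. v x + s * y x) - s * p y"
        by (simp add: algebra_simps)
    qed
    then have "straighten p y (\<lambda>x. u x + v x) - straighten p y v \<le> straighten p y u"
      by (intro ge[OF u]) (force simp: algebra_simps)
    then show "straighten p y (\<lambda>x. u x + v x) \<le> straighten p y u + straighten p y v" by simp
  next
    fix c :: real and u assume c: "0 < c" and u: "u \<in> carr X"
    have "straighten p y (\<lambda>x. c * u x) / c \<le> straighten p y u"
    proof (rule ge[OF u])
      fix t :: real assume t: "0 \<le> t"
      have "straighten p y (\<lambda>x. c * u x) \<le> p (\<lambda>x. c * u x + (c * t) * y x) - (c * t) * p y"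
        using c t u by (intro le cmult_in) auto
      also have "(\<lambda>x. c * u x + (c * t) * y x) = (\<lambda>x. c * (u x + t * y x))"
        by (simp add: algebra_simps)
      also have "p \<dots> = c * p (\<lambda>x. u x + t * y x)"
        using u y by (intro sublinear_cmult[OF p c] add_in cmult_in)
      finally show "straighten p y (\<lambda>x. c * u x) / c \<le> p (\<lambda>x. u x + t * y x) - t * p y"
        using c by (simp add: field_simps)
    qed
    then show "straighten p y (\<lambda>x. c * u x) \<le> c * straighten p y u"
      using c by (simp add: field_simps)
  qed
qed

text \<open>
  Zorn's lemma applies because the infimum of a chain of sublinear functionals is again sublinear;
  it is finite since \<open>- p (-u) \<le> m u\<close> for every sublinear \<open>m \<le> p\<close>.
\<close>

lemma ex_minimal_sublinear:
  assumes p: "sublinear p"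
  obtains m where "sublinear m" "\<forall>u\<in>carr X. m u \<le> p u"
    "\<forall>m'. sublinear m' \<longrightarrow> (\<forall>u\<in>carr X. m' u \<le> m u) \<longrightarrow> (\<forall>u\<in>carr X. m' u = m u)"
proof -
  \<comment> \<open>normalising off the carrier makes the pointwise order antisymmetric\<close>
  define cut where "cut = (\<lambda>(f :: ('c \<Rightarrow> real) \<Rightarrow> real) u. if u \<in> carr X then f u else 0)"
  have sub_cut: "sublinear (cut f) \<longleftrightarrow> sublinear f" for f
    by (auto simp: sublinear_def cut_def add_in cmult_in)
  define A where "A = {f. sublinear f \<and> (\<forall>u\<in>carr X. f u \<le> p u) \<and> (\<forall>u. u \<notin> carr X \<longrightarrow> f u = 0)}"
  define P where "P = (\<lambda>f g :: ('c \<Rightarrow> real) \<Rightarrow> real. g \<le> f)"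
  have "\<exists>m\<in>A. \<forall>f\<in>A. P m f \<longrightarrow> f = m"
  proof (rule predicate_Zorn)
    show "partial_order_on A (relation_of P A)"
      unfolding P_def by (auto simp: partial_order_on_def preorder_on_def refl_on_def trans_def
          antisym_def relation_of_def)
    fix C assume C: "C \<in> Chains (relation_of P A)"
    have CA: "f \<in> A" if "f \<in> C" for f
      using C that by (auto simp: Chains_def relation_of_def)
    have chain: "f \<le> g \<or> g \<le> f" if "f \<in> C" "g \<in> C" for f g
      using C that by (auto simp: Chains_def relation_of_def P_def)
    show "\<exists>l\<in>A. \<forall>f\<in>C. P f l"
    proof (cases "C = {}")
      case True
      have "cut p \<in> A" using p by (auto simp: A_def sub_cut) (auto simp: cut_def)
      then show ?thesis using True by blast
    next
      case False
      define l where "l = cut (\<lambda>u. INF f\<in>C. f u)"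
      have bdd: "bdd_below ((\<lambda>f. f u) ` C)" if "u \<in> carr X" for u
      proof (rule bdd_belowI[of _ "- p (\<lambda>x. - u x)"], clarify)
        fix f assume "f \<in> C"
        then have f: "f \<in> A" by (rule CA)
        have "(\<lambda>x. - u x) \<in> carr X" using cmult_in[OF that, of "-1"] by simp
        then have "f (\<lambda>x. - u x) \<le> p (\<lambda>x. - u x)" using f by (auto simp: A_def)
        moreover have "- f (\<lambda>x. - u x) \<le> f u"
          using f that by (intro sublinear_lower) (auto simp: A_def)
        ultimately show "- p (\<lambda>x. - u x) \<le> f u" by simp
      qed
      have l_le: "l u \<le> f u" if "u \<in> carr X" "f \<in> C" for u f
        using that by (auto simp: l_def cut_def intro!: cINF_lower bdd)
      have l_ge: "m \<le> l u" if "u \<in> carr X" "\<And>f. f \<in> C \<Longrightarrow> m \<le> f u" for u m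
        using that False by (auto simp: l_def cut_def intro!: cINF_greatest)
      have "sublinear l"
        unfolding sublinear_def
      proof (intro conjI ballI allI impI)
        fix u v assume u: "u \<in> carr X" and v: "v \<in> carr X"
        have le: "l (\<lambda>x. u x + v x) \<le> f u + g v" if fg: "f \<in> C" "g \<in> C" for f g
        proof -
          obtain h where h: "h \<in> C" "h \<le> f" "h \<le> g"
            using chain[OF fg] fg by blast
          have "l (\<lambda>x. u x + v x) \<le> h (\<lambda>x. u x + v x)" using h u v by (intro l_le add_in)
          also have "\<dots> \<le> h u + h v"
            using CA[OF h(1)] u v by (intro sublinear_add) (auto simp: A_def)
          also have "\<dots> \<le> f u + g v" using h by (intro add_mono) (auto simp: le_fun_def)
          finally show ?thesis .
        qed
        have "l (\<lambda>x. u x + v x) - l v \<le> l u"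
        proof (rule l_ge[OF u])
          fix f assume f: "f \<in> C"
          have "l (\<lambda>x. u x + v x) - f u \<le> l v"
          proof (rule l_ge[OF v])
            fix g assume "g \<in> C"
            from le[OF f this] show "l (\<lambda>x. u x + v x) - f u \<le> g v" by simp
          qed
          then show "l (\<lambda>x. u x + v x) - l v \<le> f u" by simp
        qed
        then show "l (\<lambda>x. u x + v x) \<le> l u + l v" by simp
      next
        fix c :: real and u assume c: "0 < c" and u: "u \<in> carr X"
        have "l (\<lambda>x. c * u x) / c \<le> l u"
        proof (rule l_ge[OF u])
          fix f assume f: "f \<in> C"
          have "l (\<lambda>x. c * u x) \<le> f (\<lambda>x. c * u x)" using f u by (intro l_le cmult_in)
          also have "\<dots> = c * f u" using CA[OF f] c u by (intro sublinear_cmult) (auto simp: A_def)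
          finally show "l (\<lambda>x. c * u x) / c \<le> f u" using c by (simp add: field_simps)
        qed
        then show "l (\<lambda>x. c * u x) \<le> c * l u" using c by (simp add: field_simps)
      qed
      moreover have "l u \<le> p u" if "u \<in> carr X" for u
      proof -
        obtain f where "f \<in> C" using False by blast
        then show ?thesis using l_le[OF that, of f] CA[of f] that by (force simp: A_def)
      qed
      ultimately have "l \<in> A" by (auto simp: A_def l_def cut_def)
      moreover have "l \<le> f" if "f \<in> C" for f
      proof (rule le_funI)
        fix u show "l u \<le> f u"
          using l_le[OF _ that] CA[OF that] by (cases "u \<in> carr X") (auto simp: A_def l_def cut_def)
      qed
      ultimately show ?thesis by (auto simp: P_def)
    qed
  qed
  then obtain m where m: "m \<in> A" "\<And>f. f \<in> A \<Longrightarrow> f \<le> m \<Longrightarrow> f = m"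
    by (auto simp: P_def)
  show ?thesis
  proof (rule that[of m])
    show "sublinear m" "\<forall>u\<in>carr X. m u \<le> p u"
      using m(1) by (simp_all add: A_def)
    show "\<forall>m'. sublinear m' \<longrightarrow> (\<forall>u\<in>carr X. m' u \<le> m u) \<longrightarrow> (\<forall>u\<in>carr X. m' u = m u)"
    proof (intro allI impI ballI)
      fix m' u assume m': "sublinear m'" "\<forall>u\<in>carr X. m' u \<le> m u" and u: "u \<in> carr X"
      have "cut m' \<in> A"
      proof -
        have "m' v \<le> p v" if "v \<in> carr X" for v
          using bspec[OF m'(2) that] m(1) that by (force simp: A_def)
        then show ?thesis using m'(1) by (simp add: A_def sub_cut) (simp add: cut_def)
      qed
      moreover have "cut m' \<le> m"
        using m m' by (auto simp: A_def cut_def le_fun_def)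
      ultimately have "cut m' = m" by (rule m(2))
      then show "m' u = m u" using u by (auto simp: cut_def dest: fun_cong[of _ _ u])
    qed
  qed
qed

text \<open>
  A minimal sublinear functional equals its own straightening in every direction and is therefore
  linear. Starting from the straightening of \<open>p\<close> along \<open>u0\<close> forces the value \<open>p u0\<close> at \<open>u0\<close>.
\<close>

theorem Hahn_Banach_sublinear:
  assumes p: "sublinear p" and u0: "u0 \<in> carr X"
  obtains \<phi> where "linear_form X \<phi>" "\<forall>u\<in>carr X. \<phi> u \<le> p u" "\<phi> u0 = p u0"
proof -
  note neg_in = cmult_in[where c = "-1", simplified]
  have s: "sublinear (straighten p u0)" by (rule sublinear_straighten[OF p u0])
  obtain m where m: "sublinear m" "\<forall>u\<in>carr X. m u \<le> straighten p u0 u"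
    and min: "\<forall>m'. sublinear m' \<longrightarrow> (\<forall>u\<in>carr X. m' u \<le> m u) \<longrightarrow> (\<forall>u\<in>carr X. m' u = m u)"
    by (rule ex_minimal_sublinear[OF s]) (rule that)
  have odd: "m (\<lambda>x. - y x) = - m y" if y: "y \<in> carr X" for y
  proof -
    have "\<forall>u\<in>carr X. straighten m y u \<le> m u"
      using straighten_le[OF m(1) y, of _ 0] by simp
    then have "straighten m y (\<lambda>x. - y x) = m (\<lambda>x. - y x)"
      using min sublinear_straighten[OF m(1) y] neg_in[OF y] by blast
    moreover have "straighten m y (\<lambda>x. - y x) \<le> - m y"
      using straighten_le[OF m(1) y neg_in[OF y], of 1] sublinear_zero[OF m(1)] by simp
    moreover have "- m (\<lambda>x. - y x) \<le> m y" by (rule sublinear_lower[OF m(1) y])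
    ultimately show ?thesis by simp
  qed
  have "linear_form X m"
    unfolding linear_form_def plus_eq scale_eq
  proof (intro conjI ballI allI)
    fix u v assume u: "u \<in> carr X" and v: "v \<in> carr X"
    have "m (\<lambda>x. - u x + - v x) \<le> m (\<lambda>x. - u x) + m (\<lambda>x. - v x)"
      using u v by (intro sublinear_add m neg_in)
    moreover have "m (\<lambda>x. - u x + - v x) = - m (\<lambda>x. u x + v x)"
      using odd[OF add_in[OF u v]] by simp
    ultimately show "m (\<lambda>x. u x + v x) = m u + m v"
      using sublinear_add[OF m(1) u v] odd[OF u] odd[OF v] by simp
  next
    fix c :: real and u assume u: "u \<in> carr X"
    consider "c = 0" | "0 < c" | "c < 0" by linarith
    then show "m (\<lambda>x. c * u x) = c * m u"
    proof cases
      case 3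
      have "m (\<lambda>x. - (- c * u x)) = - m (\<lambda>x. - c * u x)" using u by (intro odd cmult_in)
      then show ?thesis using 3 sublinear_cmult[OF m(1) _ u, of "- c"] by simp
    qed (use sublinear_zero[OF m(1)] sublinear_cmult[OF m(1) _ u] in auto)
  qed
  moreover have "m u \<le> p u" if "u \<in> carr X" for u
    using bspec[OF m(2) that] straighten_le[OF p u0 that, of 0] by simp
  moreover have "p u0 \<le> m u0"
  proof -
    have "m (\<lambda>x. - u0 x) \<le> straighten p u0 (\<lambda>x. - u0 x)" using m(2) neg_in[OF u0] by blast
    also have "\<dots> \<le> - p u0"
      using straighten_le[OF p u0 neg_in[OF u0], of 1] sublinear_zero[OF p] by simp
    finally show ?thesis using odd[OF u0] by simp
  qed
  ultimately show ?thesis using u0 by (intro that[of m] antisym) simp_all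
qed

end

locale seminormed_function_space = function_space X for X :: "('c \<Rightarrow> real) nspace" +
  assumes nrm_triangle:
    "u \<in> carr X \<Longrightarrow> v \<in> carr X \<Longrightarrow> nrm X (\<lambda>x. u x + v x) \<le> nrm X u + nrm X v"
begin

lemma nrm_diff_ge:
  assumes "u \<in> carr X" "v \<in> carr X"
  shows "\<bar>nrm X u - nrm X v\<bar> \<le> nrm X (\<lambda>x. u x - v x)"
proof -
  have "nrm X u \<le> nrm X v + nrm X (\<lambda>x. u x - v x)" if "u \<in> carr X" "v \<in> carr X" for u v
    using nrm_triangle[OF that(2) diff_in[OF that]] by simp
  from this[OF assms] this[OF assms(2,1)] show ?thesis
    using nrm_minus[OF diff_in[OF assms]] by simp
qed

corollary Hahn_Banach_norm:
  assumes "u0 \<in> carr X"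
  obtains \<phi> where "linear_form X \<phi>" "\<forall>u\<in>carr X. \<bar>\<phi> u\<bar> \<le> nrm X u" "\<phi> u0 = nrm X u0"
proof -
  have "sublinear (nrm X)"
    by (simp add: sublinear_def nrm_triangle nrm_cmult)
  from this assms obtain \<phi> where
    \<phi>: "linear_form X \<phi>" "\<forall>u\<in>carr X. \<phi> u \<le> nrm X u" "\<phi> u0 = nrm X u0"
    by (rule Hahn_Banach_sublinear) (rule that)
  show ?thesis
  proof (rule that[OF \<phi>(1) _ \<phi>(3)], rule ballI)
    fix u assume u: "u \<in> carr X"
    have "(\<lambda>x. - u x) \<in> carr X" using cmult_in[OF u, of "-1"] by simp
    then have "\<phi> (\<lambda>x. - u x) \<le> nrm X u" using \<phi>(2) nrm_minus[OF u] by fastforce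
    moreover have "\<phi> u \<le> nrm X u" using \<phi>(2) u by blast
    ultimately show "\<bar>\<phi> u\<bar> \<le> nrm X u"
      using linear_form_minus[OF \<phi>(1) u] by simp
  qed
qed

text \<open>
  On a space whose elements are determined by their values at finitely many points, pointwise
  convergence of linear forms is uniform on the unit ball. The induction removes one point \<open>b\<close>: with
  \<open>v b = 1\<close>, every \<open>u\<close> is the sum of \<open>u - u b * v\<close>, which vanishes at \<open>b\<close>, and a multiple of \<open>v\<close>. Both
  parts are controlled by the norm of \<open>u\<close> because evaluation at \<open>b\<close> is bounded.
\<close>

lemma pointwise_imp_uniform_on:
  assumes "finite B"
    and V: "V \<subseteq> carr X" "(\<lambda>x. 0) \<in> V" "\<And>u v. u \<in> V \<Longrightarrow> v \<in> V \<Longrightarrow> (\<lambda>x. u x + v x) \<in> V"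
      "\<And>c u. u \<in> V \<Longrightarrow> (\<lambda>x. c * u x) \<in> V"
    and bound: "\<And>b u. b \<in> B \<Longrightarrow> u \<in> V \<Longrightarrow> \<bar>u b\<bar> \<le> k b * nrm X u"
    and sep: "\<And>u. u \<in> V \<Longrightarrow> \<forall>b\<in>B. u b = 0 \<Longrightarrow> u = (\<lambda>x. 0)"
    and lin: "\<forall>\<^sub>F s in F. linear_form X (\<gamma> s)"
    and ptw: "\<And>u. u \<in> V \<Longrightarrow> ((\<lambda>s. \<gamma> s u) \<longlongrightarrow> 0) F"
    and e: "0 < e"
  shows "\<forall>\<^sub>F s in F. \<forall>u\<in>V. \<bar>\<gamma> s u\<bar> \<le> e * nrm X u"
  using assms(1) V bound sep ptw e
proof (induction B arbitrary: V e rule: finite_induct)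
  case empty
  from lin show ?case
  proof eventually_elim
    case (elim s)
    have "u = (\<lambda>x. 0)" if "u \<in> V" for u using empty.prems(6)[OF that] by simp
    then show ?case using linear_form_zero[OF elim] nrm_zero by force
  qed
next
  case (insert b B)
  note V = insert.prems(1-4) and bound = insert.prems(5) and sep = insert.prems(6)
    and ptw = insert.prems(7) and e = insert.prems(8)
  show ?case
  proof (cases "\<forall>u\<in>V. u b = 0")
    case True
    then have sep': "\<And>u. u \<in> V \<Longrightarrow> \<forall>b\<in>B. u b = 0 \<Longrightarrow> u = (\<lambda>x. 0)"
      using sep by blast
    show ?thesis by (rule insert.IH[OF V bound sep' ptw e]) auto
  next
    case False
    then obtain w where w: "w \<in> V" "w b \<noteq> 0" by blast
    define v where "v = (\<lambda>x. 1 / w b * w x)"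
    have v: "v \<in> V" "v b = 1" using V(4)[OF w(1), of "1 / w b"] w by (auto simp: v_def)
    define V0 where "V0 = {u \<in> V. u b = 0}"
    define R where "R = 1 + \<bar>k b\<bar> * nrm X v"
    have vX: "v \<in> carr X" using v V by blast
    have R: "0 < R" using nrm_nonneg[OF vX] by (auto simp: R_def intro!: add_pos_nonneg)
    have near: "\<forall>\<^sub>F s in F. \<forall>u\<in>V0. \<bar>\<gamma> s u\<bar> \<le> e / (2 * R) * nrm X u"
    proof (rule insert.IH)
      show "\<And>u. u \<in> V0 \<Longrightarrow> \<forall>b\<in>B. u b = 0 \<Longrightarrow> u = (\<lambda>x. 0)"
        using sep by (auto simp: V0_def)
    qed (use V bound ptw e R in \<open>auto simp: V0_def\<close>)
    have small: "\<forall>\<^sub>F s in F. \<bar>\<gamma> s v\<bar> < e / (2 * (1 + \<bar>k b\<bar>))"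
    proof -
      have "0 < e / (2 * (1 + \<bar>k b\<bar>))" using e by simp
      from tendstoD[OF ptw[OF v(1)] this] show ?thesis by simp
    qed
    from lin near small show ?thesis
    proof eventually_elim
      case (elim s)
      show ?case
      proof
        fix u assume u: "u \<in> V"
        then have uX: "u \<in> carr X" using V by blast
        define u0 where "u0 = (\<lambda>x. u x + - u b * v x)"
        have u0: "u0 \<in> V0" using V(3)[OF u V(4)[OF v(1), of "- u b"]] v by (simp add: V0_def u0_def)
        have u0X: "u0 \<in> carr X" using u0 V by (auto simp: V0_def)
        have ub: "\<bar>u b\<bar> \<le> \<bar>k b\<bar> * nrm X u"
          using bound[of b u] u mult_right_mono[OF abs_ge_self[of "k b"] nrm_nonneg[OF uX]] by simp
        have "nrm X u0 \<le> nrm X u + \<bar>- u b\<bar> * nrm X v"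
          unfolding u0_def nrm_cmult[OF vX, symmetric] by (intro nrm_triangle uX cmult_in vX)
        also have "\<dots> \<le> nrm X u + (\<bar>k b\<bar> * nrm X u) * nrm X v"
          using ub nrm_nonneg[OF vX] by (auto intro!: mult_right_mono)
        finally have nu0: "nrm X u0 \<le> R * nrm X u" by (simp add: R_def algebra_simps)
        have "u = (\<lambda>x. u0 x + u b * v x)" by (simp add: u0_def)
        then have "\<gamma> s u = \<gamma> s u0 + u b * \<gamma> s v"
          using linear_form_add[OF elim(1) u0X cmult_in[OF vX, of "u b"]]
            linear_form_cmult[OF elim(1) vX, of "u b"] by simp
        then have "\<bar>\<gamma> s u\<bar> \<le> \<bar>\<gamma> s u0\<bar> + \<bar>u b\<bar> * \<bar>\<gamma> s v\<bar>"
          by (simp add: abs_mult[symmetric] abs_triangle_ineq)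
        also have "\<bar>\<gamma> s u0\<bar> \<le> e / (2 * R) * (R * nrm X u)"
        proof -
          have "\<bar>\<gamma> s u0\<bar> \<le> e / (2 * R) * nrm X u0" using elim(2) u0 by blast
          also have "\<dots> \<le> e / (2 * R) * (R * nrm X u)"
            using nu0 e R by (intro mult_left_mono) auto
          finally show ?thesis .
        qed
        also have "\<bar>u b\<bar> * \<bar>\<gamma> s v\<bar> \<le> (\<bar>k b\<bar> * nrm X u) * (e / (2 * (1 + \<bar>k b\<bar>)))"
          using ub elim(3) nrm_nonneg[OF uX] by (intro mult_mono) auto
        also have "\<dots> = (\<bar>k b\<bar> / (1 + \<bar>k b\<bar>)) * (e / 2 * nrm X u)" by (simp add: algebra_simps)
        also have "\<dots> \<le> 1 * (e / 2 * nrm X u)"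
          using e nrm_nonneg[OF uX] by (intro mult_right_mono) auto
        finally show "\<bar>\<gamma> s u\<bar> \<le> e * nrm X u" using R by simp
      qed
    qed
  qed
qed

end

section \<open>Smoothness of the dual norm\<close>

context homogeneous_space
begin

lemma unit_ball_nonempty:
  obtains x0 where "x0 \<in> {x \<in> carr X. nrm X x \<le> 1}"
proof -
  obtain x where x: "x \<in> carr X" using carr_nonempty by blast
  have "scale X 0 x \<in> {x \<in> carr X. nrm X x \<le> 1}" using scale_in[OF x] nrm_scale[OF x] by simp
  then show ?thesis by (rule that)
qed

lemma carr_dual_iff:
  "f \<in> carr (dual_space X) \<longleftrightarrow>
     linear_form X f \<and> (\<forall>x. x \<notin> carr X \<longrightarrow> f x = 0) \<and> (\<exists>C. \<forall>x\<in>carr X. \<bar>f x\<bar> \<le> C * nrm X x)"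
  by (simp add: dual_space_def)

lemma nrm_dual: "nrm (dual_space X) f = (SUP x\<in>{x \<in> carr X. nrm X x \<le> 1}. \<bar>f x\<bar>)"
  by (simp add: dual_space_def)

lemma bdd_above_dual:
  assumes "f \<in> carr (dual_space X)"
  shows "bdd_above ((\<lambda>x. \<bar>f x\<bar>) ` {x \<in> carr X. nrm X x \<le> 1})"
proof -
  obtain C where C: "\<bar>f x\<bar> \<le> C * nrm X x" if "x \<in> carr X" for x
    using assms by (auto simp: carr_dual_iff)
  have "\<bar>f x\<bar> \<le> \<bar>C\<bar>" if "x \<in> carr X" "nrm X x \<le> 1" for x
  proof -
    have "C * nrm X x \<le> \<bar>C\<bar> * 1" using that nrm_nonneg by (intro mult_mono) auto
    with C[OF that(1)] show ?thesis by simp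
  qed
  then show ?thesis by (intro bdd_aboveI[of _ "\<bar>C\<bar>"]) auto
qed

lemma dual_le_ball:
  assumes "f \<in> carr (dual_space X)" "x \<in> carr X" "nrm X x \<le> 1"
  shows "\<bar>f x\<bar> \<le> nrm (dual_space X) f"
  unfolding nrm_dual using assms by (intro cSUP_upper bdd_above_dual) auto

lemma nrm_dual_le:
  assumes "\<And>x. x \<in> carr X \<Longrightarrow> nrm X x \<le> 1 \<Longrightarrow> \<bar>f x\<bar> \<le> K"
  shows "nrm (dual_space X) f \<le> K"
  unfolding nrm_dual
proof (rule cSUP_least)
  show "{x \<in> carr X. nrm X x \<le> 1} \<noteq> {}" by (rule unit_ball_nonempty) blast
qed (use assms in auto)

lemma nrm_dual_nonneg:
  assumes "f \<in> carr (dual_space X)"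
  shows "0 \<le> nrm (dual_space X) f"
proof -
  obtain x where "x \<in> {x \<in> carr X. nrm X x \<le> 1}" by (rule unit_ball_nonempty)
  then show ?thesis using dual_le_ball[OF assms, of x] by auto
qed

lemma dual_le:
  assumes f: "f \<in> carr (dual_space X)" and x: "x \<in> carr X"
  shows "\<bar>f x\<bar> \<le> nrm (dual_space X) f * nrm X x"
proof (cases "nrm X x = 0")
  case True
  then show ?thesis using f x by (force simp: carr_dual_iff)
next
  case False
  then have pos: "0 < nrm X x" using nrm_nonneg[OF x] by simp
  have "\<bar>f (scale X (1 / nrm X x) x)\<bar> \<le> nrm (dual_space X) f"
    using pos by (intro dual_le_ball[OF f] scale_in x) (simp add: nrm_scale[OF x])
  moreover have "f (scale X (1 / nrm X x) x) = 1 / nrm X x * f x"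
    using f x by (simp add: carr_dual_iff linear_form_def)
  ultimately show ?thesis using pos by (simp add: abs_mult field_simps)
qed

lemma nplus_dual: "nplus (dual_space X) f g = (\<lambda>x. f x + g x)"
  and scale_dual: "scale (dual_space X) c f = (\<lambda>x. c * f x)"
  by (simp_all add: dual_space_def)

lemma dual_add_in:
  assumes f: "f \<in> carr (dual_space X)" and g: "g \<in> carr (dual_space X)"
  shows "(\<lambda>x. f x + g x) \<in> carr (dual_space X)"
  unfolding carr_dual_iff
proof (intro conjI exI ballI)
  show "linear_form X (\<lambda>x. f x + g x)"
    using f g by (simp add: carr_dual_iff linear_form_def algebra_simps)
  show "\<forall>x. x \<notin> carr X \<longrightarrow> f x + g x = 0" using f g by (simp add: carr_dual_iff)
  show "\<bar>f x + g x\<bar> \<le> (nrm (dual_space X) f + nrm (dual_space X) g) * nrm X x" if "x \<in> carr X" for x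
    using dual_le[OF f that] dual_le[OF g that] by (simp add: distrib_right)
qed

lemma dual_cmult_in:
  assumes f: "f \<in> carr (dual_space X)"
  shows "(\<lambda>x. c * f x) \<in> carr (dual_space X)"
  unfolding carr_dual_iff
proof (intro conjI exI ballI)
  show "linear_form X (\<lambda>x. c * f x)"
    using f by (simp add: carr_dual_iff linear_form_def algebra_simps)
  show "\<forall>x. x \<notin> carr X \<longrightarrow> c * f x = 0" using f by (simp add: carr_dual_iff)
  show "\<bar>c * f x\<bar> \<le> (\<bar>c\<bar> * nrm (dual_space X) f) * nrm X x" if "x \<in> carr X" for x
    using mult_left_mono[OF dual_le[OF f that], of "\<bar>c\<bar>"] by (simp add: abs_mult mult.assoc)
qed

lemma dual_nrm_cmult_le:
  assumes f: "f \<in> carr (dual_space X)"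
  shows "nrm (dual_space X) (\<lambda>x. c * f x) \<le> \<bar>c\<bar> * nrm (dual_space X) f"
  using dual_le_ball[OF f] by (intro nrm_dual_le) (simp add: abs_mult mult_left_mono)

lemma seminormed_function_space_dual: "seminormed_function_space (dual_space X)"
proof
  have "(\<lambda>x. 0) \<in> carr (dual_space X)"
    by (auto simp: carr_dual_iff linear_form_def intro!: exI[of _ 0])
  then show "carr (dual_space X) \<noteq> {}" by blast
next
  fix c f assume f: "f \<in> carr (dual_space X)"
  have "\<bar>c\<bar> * nrm (dual_space X) f \<le> nrm (dual_space X) (\<lambda>x. c * f x)"
  proof (cases "c = 0")
    case True
    then show ?thesis using nrm_dual_nonneg[OF dual_cmult_in[OF f, of c]] by simp
  next
    case False
    then show ?thesis
      using dual_nrm_cmult_le[OF dual_cmult_in[OF f, of c], of "1 / c"] by (simp add: field_simps)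
  qed
  then show "nrm (dual_space X) (scale (dual_space X) c f) = \<bar>c\<bar> * nrm (dual_space X) f"
    using dual_nrm_cmult_le[OF f, of c] by (simp add: scale_dual)
next
  fix f g assume f: "f \<in> carr (dual_space X)" and g: "g \<in> carr (dual_space X)"
  show "nrm (dual_space X) (\<lambda>x. f x + g x) \<le> nrm (dual_space X) f + nrm (dual_space X) g"
  proof (rule nrm_dual_le)
    fix x assume "x \<in> carr X" "nrm X x \<le> 1"
    then show "\<bar>f x + g x\<bar> \<le> nrm (dual_space X) f + nrm (dual_space X) g"
      using dual_le_ball[OF f, of x] dual_le_ball[OF g, of x] by simp
  qed
qed (simp_all add: nplus_dual scale_dual dual_add_in dual_cmult_in nrm_dual_nonneg)

text \<open>
  Evaluating \<open>f + c g\<close> at \<open>P\<close> and \<open>f - c g\<close> at \<open>Q\<close> gives \<open>f (P + Q) + c g (P - Q)\<close>, at most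
  \<open>2 - \<kappa> d\<^sup>r + c d\<close> with \<open>d = \<parallel>P - Q\<parallel>\<close>. The constant is the bound for \<open>c d - \<kappa> d\<^sup>r\<close> obtained by comparing
  \<open>d\<close> with \<open>(c / \<kappa>)\<^sup>1\<^sup>/\<^sup>(\<^sup>r\<^sup>-\<^sup>1\<^sup>)\<close>.
\<close>

lemma uniformly_convex_imp_dual_smooth:
  assumes \<kappa>: "0 < \<kappa>" and r: "1 < r"
    and uc: "\<And>P Q. P \<in> carr X \<Longrightarrow> Q \<in> carr X \<Longrightarrow> nrm X P \<le> 1 \<Longrightarrow> nrm X Q \<le> 1 \<Longrightarrow>
       nrm X (nplus X P Q) \<le> 2 - \<kappa> * nrm X (nminus X P Q) powr r"
    and f: "f \<in> carr (dual_space X)" "nrm (dual_space X) f \<le> 1"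
    and g: "g \<in> carr (dual_space X)" "nrm (dual_space X) g \<le> 1"
    and c: "0 \<le> c"
  shows "nrm (dual_space X) (\<lambda>x. f x + c * g x) + nrm (dual_space X) (\<lambda>x. f x - c * g x)
           \<le> 2 + \<kappa> powr (- 1 / (r - 1)) * c powr (r / (r - 1))" (is "_ \<le> 2 + ?E")
proof -
  have young: "c * d \<le> \<kappa> * d powr r + ?E" if d: "0 \<le> d" for d
  proof (cases "d \<le> (c / \<kappa>) powr (1 / (r - 1))")
    case True
    have "c * d \<le> c * (c / \<kappa>) powr (1 / (r - 1))" using True c by (intro mult_left_mono)
    also have "\<dots> = ?E"
    proof (cases "c = 0")
      case False
      then have cp: "0 < c" using c by simp
      have "r / (r - 1) = 1 + 1 / (r - 1)" using r by (simp add: field_simps)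
      then have "c powr (r / (r - 1)) = c * c powr (1 / (r - 1))"
        using cp by (simp add: powr_add)
      moreover have "\<kappa> powr (- 1 / (r - 1)) = 1 / \<kappa> powr (1 / (r - 1))"
        using powr_minus_divide[of \<kappa> "1 / (r - 1)"] by simp
      ultimately show ?thesis using cp \<kappa> by (simp add: powr_divide)
    qed simp
    also have "\<dots> \<le> \<kappa> * d powr r + ?E" using \<kappa> by simp
    finally show ?thesis .
  next
    case False
    moreover have "0 \<le> (c / \<kappa>) powr (1 / (r - 1))" by simp
    ultimately have dp: "0 < d" by linarith
    have "((c / \<kappa>) powr (1 / (r - 1))) powr (r - 1) \<le> d powr (r - 1)"
      using False r by (intro powr_mono2) auto
    then have "c / \<kappa> \<le> d powr (r - 1)" using r c \<kappa> by (simp add: powr_powr)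
    then have "c * d \<le> \<kappa> * d powr (r - 1) * d" using \<kappa> dp by (simp add: field_simps)
    also have "\<dots> = \<kappa> * d powr r" using dp powr_add[of d "r - 1" 1] by simp
    also have "\<dots> \<le> \<kappa> * d powr r + ?E" by simp
    finally show ?thesis .
  qed
  have lf: "linear_form X f" and lg: "linear_form X g" using f g by (auto simp: carr_dual_iff)
  have key: "f P + c * g P + (f Q - c * g Q) \<le> 2 + ?E"
    if P: "P \<in> carr X" "nrm X P \<le> 1" and Q: "Q \<in> carr X" "nrm X Q \<le> 1" for P Q
  proof -
    have m: "nminus X P Q \<in> carr X" by (rule minus_in[OF P(1) Q(1)])
    have "f P + c * g P + (f Q - c * g Q) = f (nplus X P Q) + c * g (nminus X P Q)"
      using lf lg P Q by (simp add: linear_form_def nminus_def scale_in algebra_simps)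
    also have "\<dots> \<le> nrm X (nplus X P Q) + c * nrm X (nminus X P Q)"
    proof (intro add_mono mult_left_mono c)
      show "f (nplus X P Q) \<le> nrm X (nplus X P Q)"
        using dual_le[OF f(1) plus_in[OF P(1) Q(1)]] f(2)
          mult_right_mono[OF f(2) nrm_nonneg[OF plus_in[OF P(1) Q(1)]]] by simp
      show "g (nminus X P Q) \<le> nrm X (nminus X P Q)"
        using dual_le[OF g(1) m] g(2) mult_right_mono[OF g(2) nrm_nonneg[OF m]] by simp
    qed
    also have "\<dots> \<le> 2 + ?E"
      using uc[OF P(1) Q(1) P(2) Q(2)] young[OF nrm_nonneg[OF m]] by simp
    finally show ?thesis .
  qed
  have sgn: "\<exists>x'. x' \<in> carr X \<and> nrm X x' \<le> 1 \<and> \<bar>f x + a * g x\<bar> = f x' + a * g x'"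
    if x: "x \<in> carr X" "nrm X x \<le> 1" for x a
  proof (cases "0 \<le> f x + a * g x")
    case False
    have "f (scale X (-1) x) = - f x" "g (scale X (-1) x) = - g x"
      using lf lg x by (simp_all add: linear_form_def)
    then show ?thesis using False x scale_in[OF x(1), of "-1"] nrm_scale[OF x(1), of "-1"]
      by (intro exI[of _ "scale X (-1) x"]) simp
  qed (use x in auto)
  have abs_key: "\<bar>f P + c * g P\<bar> + \<bar>f Q + - c * g Q\<bar> \<le> 2 + ?E"
    if P: "P \<in> carr X" "nrm X P \<le> 1" and Q: "Q \<in> carr X" "nrm X Q \<le> 1" for P Q
    using sgn[OF P, of c] sgn[OF Q, of "- c"] key by force
  have "nrm (dual_space X) (\<lambda>x. f x + c * g x) \<le> 2 + ?E - nrm (dual_space X) (\<lambda>x. f x - c * g x)"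
  proof (rule nrm_dual_le)
    fix P assume P: "P \<in> carr X" "nrm X P \<le> 1"
    have "nrm (dual_space X) (\<lambda>x. f x - c * g x) \<le> 2 + ?E - \<bar>f P + c * g P\<bar>"
      using abs_key[OF P] by (intro nrm_dual_le) fastforce
    then show "\<bar>f P + c * g P\<bar> \<le> 2 + ?E - nrm (dual_space X) (\<lambda>x. f x - c * g x)" by simp
  qed
  then show ?thesis by simp
qed

text \<open>
  A functional that vanishes on a finite spanning set is zero, so the values at that set determine
  it.
\<close>

lemma finite_dimensional_dual_pointwise_imp_uniform:
  assumes fd: "finite_dimensional X"
    and zero: "x0 \<in> carr X" "nzero X = scale X 0 x0"
    and lin: "\<forall>\<^sub>F s in F. linear_form (dual_space X) (\<gamma> s)"
    and ptw: "\<And>f. f \<in> carr (dual_space X) \<Longrightarrow> ((\<lambda>s. \<gamma> s f) \<longlongrightarrow> 0) F"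
    and e: "0 < e"
  shows "\<forall>\<^sub>F s in F. \<forall>f\<in>carr (dual_space X). \<bar>\<gamma> s f\<bar> \<le> e * nrm (dual_space X) f"
proof -
  interpret D: seminormed_function_space "dual_space X" by (rule seminormed_function_space_dual)
  obtain B where B: "finite B" "B \<subseteq> carr X" "linear_span X B = carr X"
    using fd by (auto simp: finite_dimensional_def)
  show ?thesis
  proof (rule D.pointwise_imp_uniform_on[OF B(1) subset_refl D.zero_in D.add_in D.cmult_in _ _ lin ptw e])
    show "\<bar>u b\<bar> \<le> nrm X b * nrm (dual_space X) u" if "b \<in> B" "u \<in> carr (dual_space X)" for b u
      using dual_le[of u b] that B by (auto simp: mult.commute)
    fix f assume f: "f \<in> carr (dual_space X)" and 0: "\<forall>b\<in>B. f b = 0"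
    let ?K = "{x \<in> carr X. f x = 0}"
    have lf: "linear_form X f" using f by (simp add: carr_dual_iff)
    have z: "nzero X \<in> carr X" "f (nzero X) = 0"
      using scale_in[OF zero(1), of 0] lf zero by (simp_all add: linear_form_def)
    show "f = (\<lambda>x. 0)"
    proof
      fix x show "f x = 0"
      proof (cases "x \<in> carr X")
        case True
        have "linear_subspace X ?K"
          using lf z plus_in scale_in by (simp add: linear_subspace_def linear_form_def subset_eq)
        then have "linear_span X B \<subseteq> ?K"
          using B(2) 0 unfolding linear_span_def by blast
        then show ?thesis using B(3) True by blast
      qed (use f in \<open>simp add: carr_dual_iff\<close>)
    qed
  qed
qed

end

section \<open>Bilinear forms and the projective norm\<close>

lemma compact_box_functions:
  fixes c :: "'a \<Rightarrow> 'b \<Rightarrow> real"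
  shows "compact {\<beta>. \<forall>x z. \<bar>\<beta> x z\<bar> \<le> c x z}"
proof -
  have prod: "compact {f. \<forall>x. f x \<in> S x}" if "\<And>x. compact (S x)" for S :: "'c \<Rightarrow> 'd::topological_space set"
  proof -
    have "compactin (product_topology (\<lambda>_. euclidean) UNIV) (PiE UNIV S)"
      using that by (subst compactin_PiE) auto
    then show ?thesis by (simp add: euclidean_product_topology PiE_UNIV_domain Pi_def)
  qed
  have "compact {\<beta>. \<forall>x. \<beta> x \<in> {f. \<forall>z. f z \<in> {- c x z..c x z}}}"
    by (intro prod) auto
  moreover have "{\<beta>. \<forall>x. \<beta> x \<in> {f. \<forall>z. f z \<in> {- c x z..c x z}}} = {\<beta>. \<forall>x z. \<bar>\<beta> x z\<bar> \<le> c x z}"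
    by (auto simp: abs_le_iff minus_le_iff)
  ultimately show ?thesis by simp
qed

lemma continuous_on_apply2: "continuous_on UNIV (\<lambda>\<beta> :: 'a \<Rightarrow> 'b \<Rightarrow> real. \<beta> x z)"
  by (rule continuous_on_product_then_coordinatewise[where f = "\<lambda>\<beta>. \<beta> x" and i = z])
    (rule continuous_on_product_coordinates)

lemma closed_bilinear_forms: "closed (bilinear_forms X Z)"
proof -
  have "closed {\<beta>. (\<forall>z. z \<in> carr Z \<longrightarrow> linear_form X (\<lambda>x. \<beta> x z)) \<and> (\<forall>x. x \<in> carr X \<longrightarrow> linear_form Z (\<beta> x))}"
    unfolding linear_form_def Ball_def
    by (intro closed_Collect_conj closed_Collect_all closed_Collect_imp open_Collect_const
        closed_Collect_eq continuous_intros continuous_on_apply2)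
  then show ?thesis by (simp add: bilinear_forms_def Ball_def)
qed

lemma bilinear_forms_simps:
  assumes "\<beta> \<in> bilinear_forms X Z"
  shows "x \<in> carr X \<Longrightarrow> y \<in> carr X \<Longrightarrow> z \<in> carr Z \<Longrightarrow> \<beta> (nplus X x y) z = \<beta> x z + \<beta> y z"
    and "x \<in> carr X \<Longrightarrow> z \<in> carr Z \<Longrightarrow> \<beta> (scale X c x) z = c * \<beta> x z"
    and "x \<in> carr X \<Longrightarrow> z \<in> carr Z \<Longrightarrow> w \<in> carr Z \<Longrightarrow> \<beta> x (nplus Z z w) = \<beta> x z + \<beta> x w"
    and "x \<in> carr X \<Longrightarrow> z \<in> carr Z \<Longrightarrow> \<beta> x (scale Z c z) = c * \<beta> x z"
  using assms unfolding bilinear_forms_def linear_form_def by blast+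

locale tensor_pair = X: homogeneous_space X + Z: homogeneous_space Z
  for X :: "'a nspace" and Z :: "'b nspace"
begin

abbreviation T where "T \<equiv> alg_tensor_pi X Z"

abbreviation reps :: "('a \<times> 'b) list set" where
  "reps \<equiv> {r. set r \<subseteq> carr X \<times> carr Z}"

definition cost :: "('a \<times> 'b) list \<Rightarrow> real" where
  "cost r = (\<Sum>(x, z)\<leftarrow>r. nrm X x * nrm Z z)"

text \<open>
  The unit ball of bounded bilinear forms. Forms are required to vanish off the carriers: this
  makes the ball a closed subset of a compact product of intervals.
\<close>

definition bilinear_ball :: "('a \<Rightarrow> 'b \<Rightarrow> real) set" where
  "bilinear_ball = bilinear_forms X Z \<inter>
     {\<beta>. \<forall>x z. \<bar>\<beta> x z\<bar> \<le> (if x \<in> carr X \<and> z \<in> carr Z then nrm X x * nrm Z z else 0)}"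

lemma bilinear_ball_bilinear: "\<beta> \<in> bilinear_ball \<Longrightarrow> \<beta> \<in> bilinear_forms X Z"
  by (simp add: bilinear_ball_def)

lemma bilinear_ball_le:
  assumes "\<beta> \<in> bilinear_ball" "x \<in> carr X" "z \<in> carr Z"
  shows "\<bar>\<beta> x z\<bar> \<le> nrm X x * nrm Z z"
proof -
  have "\<bar>\<beta> x z\<bar> \<le> (if x \<in> carr X \<and> z \<in> carr Z then nrm X x * nrm Z z else 0)"
    using assms(1) unfolding bilinear_ball_def by blast
  with assms show ?thesis by simp
qed

lemma compact_bilinear_ball: "compact bilinear_ball"
  unfolding bilinear_ball_def
  by (intro closed_Int_compact closed_bilinear_forms compact_box_functions)

lemma tensor_sum_apply:
  "\<beta> \<in> bilinear_forms X Z \<Longrightarrow> tensor_sum X Z r \<beta> = (\<Sum>(x, z)\<leftarrow>r. \<beta> x z)"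
  by (simp add: tensor_sum_def elem_tensor_def)

lemma tensor_sum_append: "tensor_sum X Z (r @ r') = (\<lambda>\<beta>. tensor_sum X Z r \<beta> + tensor_sum X Z r' \<beta>)"
  by (simp add: tensor_sum_def)

lemma tensor_sum_scale:
  assumes "r \<in> reps"
  shows "tensor_sum X Z (map (\<lambda>(x, z). (scale X c x, z)) r) = (\<lambda>\<beta>. c * tensor_sum X Z r \<beta>)"
proof
  fix \<beta>
  show "tensor_sum X Z (map (\<lambda>(x, z). (scale X c x, z)) r) \<beta> = c * tensor_sum X Z r \<beta>"
    using assms
  proof (induction r)
    case (Cons a r)
    obtain x z where a: "a = (x, z)" "x \<in> carr X" "z \<in> carr Z" using Cons.prems by force
    have "elem_tensor X Z (scale X c x) z \<beta> = c * elem_tensor X Z x z \<beta>"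
      using a by (simp add: elem_tensor_def bilinear_forms_simps)
    with Cons show ?case by (simp add: tensor_sum_def a algebra_simps)
  qed (simp add: tensor_sum_def)
qed

lemma cost_nonneg: "r \<in> reps \<Longrightarrow> 0 \<le> cost r"
  unfolding cost_def by (rule sum_list_nonneg) (auto simp: X.nrm_nonneg Z.nrm_nonneg)

lemma cost_append: "cost (r @ r') = cost r + cost r'"
  by (simp add: cost_def)

lemma cost_scale:
  assumes "r \<in> reps"
  shows "cost (map (\<lambda>(x, z). (scale X c x, z)) r) = \<bar>c\<bar> * cost r"
  using assms
proof (induction r)
  case (Cons a r)
  obtain x z where a: "a = (x, z)" "x \<in> carr X" "z \<in> carr Z" using Cons.prems by force
  with Cons show ?case by (simp add: cost_def X.nrm_scale algebra_simps)
qed (simp add: cost_def)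

lemma carr_T: "carr T = tensor_sum X Z ` reps"
  by (auto simp: alg_tensor_pi_def)

lemma nrm_T: "nrm T u = Inf {cost r | r. r \<in> reps \<and> u = tensor_sum X Z r}"
  by (simp add: alg_tensor_pi_def cost_def)

lemma bdd_below_costs: "bdd_below {cost r | r. r \<in> reps \<and> u = tensor_sum X Z r}"
  using cost_nonneg by (intro bdd_belowI[of _ 0]) auto

lemma nrm_T_le: "r \<in> reps \<Longrightarrow> nrm T (tensor_sum X Z r) \<le> cost r"
  unfolding nrm_T by (intro cInf_lower bdd_below_costs) auto

lemma nrm_T_approx:
  assumes "u \<in> carr T" "0 < e"
  obtains r where "r \<in> reps" "u = tensor_sum X Z r" "cost r < nrm T u + e"
proof -
  have "{cost r | r. r \<in> reps \<and> u = tensor_sum X Z r} \<noteq> {}"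
    using assms by (auto simp: carr_T)
  from cInf_lessD[OF this, of "nrm T u + e"] show ?thesis
    using assms that by (auto simp: nrm_T)
qed

lemma nrm_T_nonneg:
  assumes "u \<in> carr T" shows "0 \<le> nrm T u"
  unfolding nrm_T using assms cost_nonneg by (intro cInf_greatest) (auto simp: carr_T)

lemma nplus_T: "nplus T u v = (\<lambda>\<beta>. u \<beta> + v \<beta>)"
  and scale_T: "scale T c u = (\<lambda>\<beta>. c * u \<beta>)"
  by (simp_all add: alg_tensor_pi_def)

lemma add_in_T:
  assumes "u \<in> carr T" "v \<in> carr T" shows "(\<lambda>\<beta>. u \<beta> + v \<beta>) \<in> carr T"
proof -
  obtain r r' where "r \<in> reps" "u = tensor_sum X Z r" "r' \<in> reps" "v = tensor_sum X Z r'"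
    using assms by (auto simp: carr_T)
  then have "(\<lambda>\<beta>. u \<beta> + v \<beta>) = tensor_sum X Z (r @ r')" "r @ r' \<in> reps"
    by (simp_all add: tensor_sum_append)
  then show ?thesis by (simp add: carr_T)
qed

lemma scale_reps: "r \<in> reps \<Longrightarrow> map (\<lambda>(x, z). (scale X c x, z)) r \<in> reps"
  by (auto simp: X.scale_in)

lemma cmult_in_T:
  assumes "u \<in> carr T" shows "(\<lambda>\<beta>. c * u \<beta>) \<in> carr T"
proof -
  obtain r where r: "r \<in> reps" "u = tensor_sum X Z r"
    using assms by (auto simp: carr_T)
  then have "(\<lambda>\<beta>. c * u \<beta>) = tensor_sum X Z (map (\<lambda>(x, z). (scale X c x, z)) r)"
    by (simp only: tensor_sum_scale)
  then show ?thesis unfolding carr_T using scale_reps[OF r(1)] by blast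
qed

lemma nrm_T_cmult_le:
  assumes "u \<in> carr T" shows "nrm T (\<lambda>\<beta>. c * u \<beta>) \<le> \<bar>c\<bar> * nrm T u"
proof (rule field_le_epsilon)
  fix e :: real assume e: "0 < e"
  have "0 < e / (1 + \<bar>c\<bar>)" using e by simp
  then obtain r where r: "r \<in> reps" "u = tensor_sum X Z r" "cost r < nrm T u + e / (1 + \<bar>c\<bar>)"
    by (rule nrm_T_approx[OF assms])
  have "nrm T (\<lambda>\<beta>. c * u \<beta>) \<le> cost (map (\<lambda>(x, z). (scale X c x, z)) r)"
    unfolding r(2) tensor_sum_scale[OF r(1), symmetric] by (rule nrm_T_le[OF scale_reps[OF r(1)]])
  also have "\<dots> = \<bar>c\<bar> * cost r" by (rule cost_scale[OF r(1)])
  also have "\<dots> \<le> \<bar>c\<bar> * (nrm T u + e / (1 + \<bar>c\<bar>))" using r(3) by (intro mult_left_mono) auto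
  also have "\<dots> = \<bar>c\<bar> * nrm T u + \<bar>c\<bar> / (1 + \<bar>c\<bar>) * e" by (simp add: algebra_simps)
  also have "\<bar>c\<bar> / (1 + \<bar>c\<bar>) * e \<le> 1 * e" using e by (intro mult_right_mono) auto
  finally show "nrm T (\<lambda>\<beta>. c * u \<beta>) \<le> \<bar>c\<bar> * nrm T u + e" by simp
qed

lemma seminormed_function_space_T: "seminormed_function_space T"
proof
  have "tensor_sum X Z [] \<in> carr T" unfolding carr_T by (rule imageI) simp
  then show "carr T \<noteq> {}" by blast
next
  fix c u assume u: "u \<in> carr T"
  have "\<bar>c\<bar> * nrm T u \<le> nrm T (\<lambda>\<beta>. c * u \<beta>)"
  proof (cases "c = 0")
    case True
    then show ?thesis using nrm_T_nonneg[OF cmult_in_T[OF u, of c]] by simp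
  next
    case False
    then show ?thesis
      using nrm_T_cmult_le[OF cmult_in_T[OF u, of c], of "1 / c"] by (simp add: field_simps)
  qed
  then show "nrm T (scale T c u) = \<bar>c\<bar> * nrm T u"
    using nrm_T_cmult_le[OF u, of c] by (simp add: scale_T)
next
  fix u v assume u: "u \<in> carr T" and v: "v \<in> carr T"
  show "nrm T (\<lambda>\<beta>. u \<beta> + v \<beta>) \<le> nrm T u + nrm T v"
  proof (rule field_le_epsilon)
    fix e :: real assume "0 < e"
    then have e: "0 < e / 2" by simp
    obtain r where r: "r \<in> reps" "u = tensor_sum X Z r" "cost r < nrm T u + e / 2"
      by (rule nrm_T_approx[OF u e])
    obtain r' where r': "r' \<in> reps" "v = tensor_sum X Z r'" "cost r' < nrm T v + e / 2"
      by (rule nrm_T_approx[OF v e])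
    have "nrm T (\<lambda>\<beta>. u \<beta> + v \<beta>) \<le> cost (r @ r')"
      unfolding r(2) r'(2) tensor_sum_append[symmetric] using r(1) r'(1) by (intro nrm_T_le) simp
    then show "nrm T (\<lambda>\<beta>. u \<beta> + v \<beta>) \<le> nrm T u + nrm T v + e"
      using r(3) r'(3) by (simp add: cost_append)
  qed
qed (simp_all add: nplus_T scale_T add_in_T cmult_in_T nrm_T_nonneg)

sublocale T: seminormed_function_space T by (rule seminormed_function_space_T)

lemma linear_form_eval: "linear_form T (\<lambda>u. u \<beta>)"
  by (simp add: linear_form_def nplus_T scale_T)

text \<open>
  Tensors are functionals on bilinear forms, so \<open>u \<beta>\<close> is the value at \<open>u\<close> of the linear functional
  induced by \<open>\<beta>\<close>, and this estimate bounds the dual norm of a difference of two such functionals.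
\<close>

lemma eval_diff_le:
  assumes \<beta>: "\<beta> \<in> bilinear_forms X Z" "\<beta>' \<in> bilinear_forms X Z" and k: "0 \<le> k"
    and le: "\<And>x z. x \<in> carr X \<Longrightarrow> z \<in> carr Z \<Longrightarrow> \<bar>\<beta> x z - \<beta>' x z\<bar> \<le> k * (nrm X x * nrm Z z)"
    and u: "u \<in> carr T"
  shows "\<bar>u \<beta> - u \<beta>'\<bar> \<le> k * nrm T u"
proof (rule field_le_epsilon)
  fix e :: real assume e: "0 < e"
  have "0 < e / (1 + k)" using e k by simp
  then obtain r where r: "r \<in> reps" "u = tensor_sum X Z r" "cost r < nrm T u + e / (1 + k)"
    by (rule nrm_T_approx[OF u])
  have "\<bar>(\<Sum>(x, z)\<leftarrow>r. \<beta> x z) - (\<Sum>(x, z)\<leftarrow>r. \<beta>' x z)\<bar> \<le> k * cost r"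
    using r(1)
  proof (induction r)
    case (Cons a r)
    obtain x z where a: "a = (x, z)" "x \<in> carr X" "z \<in> carr Z" using Cons.prems by force
    have "\<bar>\<beta> x z - \<beta>' x z\<bar> \<le> k * (nrm X x * nrm Z z)" using le a by simp
    moreover have "\<bar>(\<Sum>(x, z)\<leftarrow>r. \<beta> x z) - (\<Sum>(x, z)\<leftarrow>r. \<beta>' x z)\<bar> \<le> k * cost r"
      using Cons by simp
    ultimately show ?case by (simp add: a cost_def algebra_simps)
  qed (simp add: cost_def)
  then have "\<bar>u \<beta> - u \<beta>'\<bar> \<le> k * cost r" by (simp only: r(2) tensor_sum_apply \<beta>)
  also have "\<dots> \<le> k * (nrm T u + e / (1 + k))" using r(3) k by (intro mult_left_mono) auto
  also have "\<dots> = k * nrm T u + k / (1 + k) * e" by (simp add: algebra_simps)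
  also have "k / (1 + k) * e \<le> 1 * e" using e k by (intro mult_right_mono) auto
  finally show "\<bar>u \<beta> - u \<beta>'\<bar> \<le> k * nrm T u + e" by simp
qed

lemma eval_le:
  assumes "\<beta> \<in> bilinear_ball" and u: "u \<in> carr T"
  shows "\<bar>u \<beta>\<bar> \<le> nrm T u"
proof -
  have z: "(\<lambda>x z. 0) \<in> bilinear_forms X Z" by (simp add: bilinear_forms_def linear_form_def)
  obtain r where "u = tensor_sum X Z r" using u by (auto simp: carr_T)
  moreover have "(\<Sum>(x, z)\<leftarrow>r. 0 :: real) = 0" for r :: "('a \<times> 'b) list" by (induction r) auto
  ultimately have "u (\<lambda>x z. 0) = 0" using tensor_sum_apply[OF z] by simp
  moreover have "\<bar>u \<beta> - u (\<lambda>x z. 0)\<bar> \<le> 1 * nrm T u"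
    using assms bilinear_ball_le[OF assms(1)]
    by (intro eval_diff_le z bilinear_ball_bilinear) auto
  ultimately show ?thesis by simp
qed

text \<open>
  A norming functional \<open>\<phi>\<close> from the Hahn-Banach theorem yields the form that sends \<open>(x, z)\<close> to the
  value of \<open>\<phi>\<close> at the elementary tensor of \<open>x\<close> and \<open>z\<close>.
\<close>

lemma ex_norming_form:
  assumes u: "u \<in> carr T"
  obtains \<beta> where "\<beta> \<in> bilinear_ball" "u \<beta> = nrm T u"
proof -
  obtain \<phi> where \<phi>: "linear_form T \<phi>" "\<forall>v\<in>carr T. \<bar>\<phi> v\<bar> \<le> nrm T v" "\<phi> u = nrm T u"
    by (rule T.Hahn_Banach_norm[OF u])
  let ?e = "elem_tensor X Z"
  define \<beta> where "\<beta> = (\<lambda>x z. if x \<in> carr X \<and> z \<in> carr Z then \<phi> (?e x z) else 0)"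
  have el: "?e x z = tensor_sum X Z [(x, z)]" for x z by (simp add: tensor_sum_def)
  have e_in: "?e x z \<in> carr T" if "x \<in> carr X" "z \<in> carr Z" for x z
    unfolding el carr_T using that by (intro imageI) simp
  have "\<beta> \<in> bilinear_forms X Z"
  proof -
    have "linear_form X (\<lambda>x. \<beta> x z)" if z: "z \<in> carr Z" for z
      unfolding linear_form_def
    proof (intro conjI ballI allI)
      fix x y assume xy: "x \<in> carr X" "y \<in> carr X"
      have "?e (nplus X x y) z = (\<lambda>\<gamma>. ?e x z \<gamma> + ?e y z \<gamma>)"
        using xy z by (intro ext) (simp add: elem_tensor_def bilinear_forms_simps)
      then show "\<beta> (nplus X x y) z = \<beta> x z + \<beta> y z"
        using xy z T.linear_form_add[OF \<phi>(1) e_in e_in] by (simp add: \<beta>_def X.plus_in)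
    next
      fix c x assume x: "x \<in> carr X"
      have "?e (scale X c x) z = (\<lambda>\<gamma>. c * ?e x z \<gamma>)"
        using x z by (intro ext) (simp add: elem_tensor_def bilinear_forms_simps)
      then show "\<beta> (scale X c x) z = c * \<beta> x z"
        using x z T.linear_form_cmult[OF \<phi>(1) e_in] by (simp add: \<beta>_def X.scale_in)
    qed
    moreover have "linear_form Z (\<beta> x)" if x: "x \<in> carr X" for x
      unfolding linear_form_def
    proof (intro conjI ballI allI)
      fix z w assume zw: "z \<in> carr Z" "w \<in> carr Z"
      have "?e x (nplus Z z w) = (\<lambda>\<gamma>. ?e x z \<gamma> + ?e x w \<gamma>)"
        using x zw by (intro ext) (simp add: elem_tensor_def bilinear_forms_simps)
      then show "\<beta> x (nplus Z z w) = \<beta> x z + \<beta> x w"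
        using x zw T.linear_form_add[OF \<phi>(1) e_in e_in] by (simp add: \<beta>_def Z.plus_in)
    next
      fix c z assume z: "z \<in> carr Z"
      have "?e x (scale Z c z) = (\<lambda>\<gamma>. c * ?e x z \<gamma>)"
        using x z by (intro ext) (simp add: elem_tensor_def bilinear_forms_simps)
      then show "\<beta> x (scale Z c z) = c * \<beta> x z"
        using x z T.linear_form_cmult[OF \<phi>(1) e_in] by (simp add: \<beta>_def Z.scale_in)
    qed
    ultimately show ?thesis by (simp add: bilinear_forms_def)
  qed
  moreover have "\<bar>\<phi> (?e x z)\<bar> \<le> nrm X x * nrm Z z" if "x \<in> carr X" "z \<in> carr Z" for x z
  proof -
    have "\<bar>\<phi> (?e x z)\<bar> \<le> nrm T (?e x z)" using \<phi>(2) e_in[OF that] by blast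
    also have "\<dots> \<le> nrm X x * nrm Z z"
      using nrm_T_le[of "[(x, z)]"] that unfolding el by (simp add: cost_def)
    finally show ?thesis .
  qed
  ultimately have ball: "\<beta> \<in> bilinear_ball" by (simp add: bilinear_ball_def) (simp add: \<beta>_def)
  have \<phi>_sum: "\<phi> (tensor_sum X Z r) = (\<Sum>(x, z)\<leftarrow>r. \<beta> x z)" if "r \<in> reps" for r
    using that
  proof (induction r)
    case Nil
    have "tensor_sum X Z [] = (\<lambda>\<gamma>. 0)" by (simp add: tensor_sum_def)
    then show ?case using T.linear_form_zero[OF \<phi>(1)] by simp
  next
    case (Cons a r)
    obtain x z where a: "a = (x, z)" "x \<in> carr X" "z \<in> carr Z" using Cons.prems by force
    have r: "tensor_sum X Z r \<in> carr T" using Cons.prems by (auto simp: carr_T)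
    have "tensor_sum X Z (a # r) = (\<lambda>\<gamma>. ?e x z \<gamma> + tensor_sum X Z r \<gamma>)"
      by (simp add: tensor_sum_def a)
    then show ?case
      using T.linear_form_add[OF \<phi>(1) e_in[OF a(2,3)] r] Cons a by (simp add: \<beta>_def)
  qed
  obtain r where r: "r \<in> reps" "u = tensor_sum X Z r" using u by (auto simp: carr_T)
  have "u \<beta> = nrm T u"
    using \<phi>_sum[OF r(1)] tensor_sum_apply[OF bilinear_ball_bilinear[OF ball], of r] \<phi>(3) r(2) by simp
  with ball show ?thesis by (rule that)
qed

text \<open>
  The value at a tensor depends on only finitely many values of the form, hence continuously for
  pointwise convergence.
\<close>

lemma tendsto_eval:
  assumes \<tau>: "\<tau> \<in> bilinear_ball" and F: "F \<le> nhds \<tau>" "\<forall>\<^sub>F \<beta> in F. \<beta> \<in> bilinear_ball" and u: "u \<in> carr T"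
  shows "((\<lambda>\<beta>. u \<beta>) \<longlongrightarrow> u \<tau>) F"
proof -
  obtain r where r: "u = tensor_sum X Z r" using u by (auto simp: carr_T)
  have co: "((\<lambda>\<beta>. \<beta> x z) \<longlongrightarrow> \<tau> x z) F" for x z
  proof -
    have "((\<lambda>\<beta>. \<beta> x z) \<longlongrightarrow> \<tau> x z) (at \<tau>)"
      using continuous_on_apply2[of x z] unfolding continuous_on_def by blast
    then have "((\<lambda>\<beta>. \<beta> x z) \<longlongrightarrow> \<tau> x z) (nhds \<tau>)"
      by (auto simp: tendsto_def eventually_nhds_conv_at)
    then show ?thesis by (rule tendsto_mono[OF F(1)])
  qed
  have "((\<lambda>\<beta>. \<Sum>(x, z)\<leftarrow>r. \<beta> x z) \<longlongrightarrow> (\<Sum>(x, z)\<leftarrow>r. \<tau> x z)) F"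
    by (induction r) (auto intro!: tendsto_add co simp: case_prod_beta)
  moreover have "\<forall>\<^sub>F \<beta> in F. (\<Sum>(x, z)\<leftarrow>r. \<beta> x z) = u \<beta>"
    using F(2) by eventually_elim (simp add: r tensor_sum_apply bilinear_ball_bilinear)
  ultimately show ?thesis
    using tendsto_cong[of "\<lambda>\<beta>. \<Sum>(x, z)\<leftarrow>r. \<beta> x z" "\<lambda>\<beta>. u \<beta>"]
    by (simp add: r tensor_sum_apply bilinear_ball_bilinear \<tau>)
qed

end

section \<open>Strong subdifferentiability and completions\<close>

text \<open>
  The limit of the difference quotients is \<open>l h\<close>, the supremum of \<open>\<psi> h\<close> over the norming functionals
  \<open>\<psi>\<close> with \<open>\<psi> u = 1\<close>. Every quotient is at least \<open>l h\<close>. Conversely, a functional \<open>\<phi>\<close> that almost norms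
  \<open>u + t h\<close> satisfies \<open>\<phi> u \<ge> 1 - O(t)\<close>, so it is close to some such \<open>\<psi>\<close>, and the quotient is at most
  \<open>\<phi> h\<close> up to a small error, uniformly in \<open>h\<close>.
\<close>

lemma SSD_at_criterion:
  fixes K :: "('a \<Rightarrow> real) set"
  assumes X: "homogeneous_space X" and u: "u \<in> unit_sphere X"
    and lin: "\<And>\<phi>. \<phi> \<in> K \<Longrightarrow> linear_form X \<phi>"
    and le: "\<And>\<phi> v. \<phi> \<in> K \<Longrightarrow> v \<in> carr X \<Longrightarrow> \<bar>\<phi> v\<bar> \<le> nrm X v"
    and norming: "\<And>v e. v \<in> carr X \<Longrightarrow> 0 < e \<Longrightarrow> \<exists>\<phi>\<in>K. nrm X v - e \<le> \<phi> v"
    and slices: "\<And>e. 0 < e \<Longrightarrow>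
       \<exists>d>0. \<forall>\<phi>\<in>K. \<phi> u > 1 - d \<longrightarrow> (\<exists>\<psi>\<in>K. \<psi> u = 1 \<and> (\<forall>h\<in>unit_sphere X. \<bar>\<phi> h - \<psi> h\<bar> \<le> e))"
  shows "SSD_at X u"
proof -
  interpret homogeneous_space X by (rule X)
  define J where "J = {\<psi> \<in> K. \<psi> u = 1}"
  define l where "l = (\<lambda>h. SUP \<psi>\<in>J. \<psi> h)"
  have uX: "u \<in> carr X" "nrm X u = 1" using u by (auto simp: unit_sphere_def)
  have hX: "h \<in> carr X" "nrm X h = 1" if "h \<in> unit_sphere X" for h
    using that by (auto simp: unit_sphere_def)
  have v_in: "nplus X u (scale X t h) \<in> carr X" if "h \<in> unit_sphere X" for t h
    by (intro plus_in scale_in uX hX that)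
  have ev: "\<phi> (nplus X u (scale X t h)) = \<phi> u + t * \<phi> h" if "\<phi> \<in> K" "h \<in> unit_sphere X" for \<phi> t h
    using lin[OF that(1)] uX hX[OF that(2)] scale_in[OF hX(1)[OF that(2)], of t]
    by (simp add: linear_form_def)
  have J_ne: "J \<noteq> {}"
  proof -
    obtain d where d: "0 < d" "\<forall>\<phi>\<in>K. \<phi> u > 1 - d \<longrightarrow> (\<exists>\<psi>\<in>K. \<psi> u = 1 \<and> (\<forall>h\<in>unit_sphere X. \<bar>\<phi> h - \<psi> h\<bar> \<le> 1))"
      using slices[of 1] by auto
    obtain \<phi> where "\<phi> \<in> K" "nrm X u - d / 2 \<le> \<phi> u" using norming[OF uX(1), of "d / 2"] d(1) by auto
    then have "\<phi> \<in> K" "\<phi> u > 1 - d" using uX d(1) by auto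
    then show ?thesis using d(2) by (force simp: J_def)
  qed
  have J_le: "\<psi> h \<le> 1" if "\<psi> \<in> J" "h \<in> unit_sphere X" for \<psi> h
    using le[of \<psi> h] that hX[OF that(2)] by (auto simp: J_def)
  have l_upper: "\<psi> h \<le> l h" if "\<psi> \<in> J" "h \<in> unit_sphere X" for \<psi> h
    unfolding l_def using that J_le by (intro cSUP_upper bdd_aboveI[of _ 1]) auto
  have slope_lower: "l h \<le> (nrm X (nplus X u (scale X t h)) - 1) / t"
    if h: "h \<in> unit_sphere X" and t: "0 < t" for h t
    unfolding l_def
  proof (rule cSUP_least[OF J_ne])
    fix \<psi> assume \<psi>: "\<psi> \<in> J"
    have "1 + t * \<psi> h \<le> nrm X (nplus X u (scale X t h))"
      using \<psi> ev[of \<psi> h t] le[OF _ v_in[OF h, of t], of \<psi>] h by (auto simp: J_def)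
    then show "\<psi> h \<le> (nrm X (nplus X u (scale X t h)) - 1) / t" using t by (simp add: field_simps)
  qed
  have "uniform_limit (unit_sphere X) (\<lambda>t h. (nrm X (nplus X u (scale X t h)) - 1) / t) l (at_right 0)"
    unfolding uniform_limit_iff
  proof (intro allI impI)
    fix e :: real assume e: "0 < e"
    obtain d where d: "0 < d" "\<forall>\<phi>\<in>K. \<phi> u > 1 - d \<longrightarrow>
        (\<exists>\<psi>\<in>K. \<psi> u = 1 \<and> (\<forall>h\<in>unit_sphere X. \<bar>\<phi> h - \<psi> h\<bar> \<le> e / 4))"
      using slices[of "e / 4"] e by auto
    have "0 < d / (2 + e)" using d e by simp
    from eventually_at_right_less[of "0 :: real"] eventually_at_right_real[OF this]
    show "\<forall>\<^sub>F t in at_right 0. \<forall>h\<in>unit_sphere X.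
        dist ((nrm X (nplus X u (scale X t h)) - 1) / t) (l h) < e"
    proof eventually_elim
      case (elim t)
      then have t: "0 < t" "t * (2 + e) < d" using e by (auto simp: field_simps)
      show ?case
      proof
        fix h assume h: "h \<in> unit_sphere X"
        let ?v = "nplus X u (scale X t h)"
        obtain \<phi> where \<phi>: "\<phi> \<in> K" "nrm X ?v - t * (e / 4) \<le> \<phi> ?v"
          using norming[OF v_in[OF h, of t], of "t * (e / 4)"] t e by auto
        obtain \<psi>0 where \<psi>0: "\<psi>0 \<in> J" using J_ne by blast
        have "- 1 \<le> \<psi>0 h" "\<phi> h \<le> 1"
          using le[of \<psi>0 h] le[of \<phi> h] \<psi>0 \<phi>(1) hX[OF h] by (auto simp: J_def)
        then have "t * (- 1) \<le> t * \<psi>0 h" "t * \<phi> h \<le> t * 1" 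
          using t mult_left_mono[of "- 1" "\<psi>0 h" t] mult_left_mono[of "\<phi> h" 1 t] by simp_all
        moreover have "1 + t * \<psi>0 h \<le> nrm X ?v"
          using \<psi>0 ev[of \<psi>0 h t] le[OF _ v_in[OF h, of t], of \<psi>0] h by (auto simp: J_def)
        moreover have "t * (e / 4) \<le> t * e" using t e by simp
        ultimately have "1 - d < \<phi> u"
          using \<phi>(2) t(2) ev[OF \<phi>(1) h, of t] by (simp add: algebra_simps)
        then obtain \<psi> where \<psi>: "\<psi> \<in> K" "\<psi> u = 1" "\<bar>\<phi> h - \<psi> h\<bar> \<le> e / 4"
          using d(2) \<phi>(1) h by blast
        have "\<phi> u \<le> 1" using le[OF \<phi>(1) uX(1)] uX by simp
        then have "nrm X ?v - 1 \<le> t * (\<phi> h + e / 4)"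
          using \<phi>(2) ev[OF \<phi>(1) h, of t] by (simp add: algebra_simps)
        also have "\<phi> h + e / 4 \<le> l h + e / 2"
          using \<psi>(1,2) abs_le_D1[OF \<psi>(3)] l_upper[of \<psi> h] h by (simp add: J_def)
        finally have "nrm X ?v - 1 \<le> t * (l h + e / 2)" using t by simp
        then have "(nrm X ?v - 1) / t \<le> l h + e / 2" using t by (simp add: field_simps)
        then show "dist ((nrm X ?v - 1) / t) (l h) < e"
          using slope_lower[OF h t(1)] e by (simp add: dist_real_def)
      qed
    qed
  qed
  then show ?thesis by (auto simp: SSD_at_def)
qed

context seminormed_function_space
begin

definition completion_class :: "(nat \<Rightarrow> 'c \<Rightarrow> real) \<Rightarrow> (nat \<Rightarrow> 'c \<Rightarrow> real) set" where
  "completion_class s = null_rel X `` {s}"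

lemma cauchy_in: "s \<in> cauchy_seqs X \<Longrightarrow> s n \<in> carr X"
  by (simp add: cauchy_seqs_def)

lemma cauchy_seqs_add:
  assumes s: "s \<in> cauchy_seqs X" and t: "t \<in> cauchy_seqs X"
  shows "(\<lambda>n x. s n x + t n x) \<in> cauchy_seqs X"
proof -
  have "\<exists>N. \<forall>m\<ge>N. \<forall>n\<ge>N. nrm X (\<lambda>x. (s m x + t m x) - (s n x + t n x)) < e" if e: "0 < e" for e
  proof -
    obtain N1 where N1: "\<forall>m\<ge>N1. \<forall>n\<ge>N1. nrm X (\<lambda>x. s m x - s n x) < e / 2"
      using s half_gt_zero[OF e] unfolding cauchy_seqs_def nminus_eq by blast
    obtain N2 where N2: "\<forall>m\<ge>N2. \<forall>n\<ge>N2. nrm X (\<lambda>x. t m x - t n x) < e / 2"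
      using t half_gt_zero[OF e] unfolding cauchy_seqs_def nminus_eq by blast
    have "nrm X (\<lambda>x. (s m x + t m x) - (s n x + t n x)) < e" if "m \<ge> max N1 N2" "n \<ge> max N1 N2" for m n
    proof -
      have "nrm X (\<lambda>x. (s m x - s n x) + (t m x - t n x))
          \<le> nrm X (\<lambda>x. s m x - s n x) + nrm X (\<lambda>x. t m x - t n x)"
        by (intro nrm_triangle diff_in cauchy_in s t)
      also have "\<dots> < e / 2 + e / 2" using N1 N2 that by (intro add_strict_mono) auto
      finally show ?thesis by (simp add: algebra_simps)
    qed
    then show ?thesis by blast
  qed
  then show ?thesis
    using s t by (simp add: cauchy_seqs_def nminus_eq add_in)
qed

lemma cauchy_seqs_cmult:
  assumes s: "s \<in> cauchy_seqs X"
  shows "(\<lambda>n x. c * s n x) \<in> cauchy_seqs X"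
proof -
  have "\<exists>N. \<forall>m\<ge>N. \<forall>n\<ge>N. nrm X (\<lambda>x. c * s m x - c * s n x) < e" if e: "0 < e" for e
  proof -
    have "0 < e / (1 + \<bar>c\<bar>)" using e by simp
    then obtain N where N: "\<forall>m\<ge>N. \<forall>n\<ge>N. nrm X (\<lambda>x. s m x - s n x) < e / (1 + \<bar>c\<bar>)"
      using s unfolding cauchy_seqs_def nminus_eq by blast
    have "nrm X (\<lambda>x. c * s m x - c * s n x) < e" if mn: "m \<ge> N" "n \<ge> N" for m n
    proof -
      have "nrm X (\<lambda>x. c * (s m x - s n x)) = \<bar>c\<bar> * nrm X (\<lambda>x. s m x - s n x)"
        by (intro nrm_cmult diff_in cauchy_in s)
      also have "\<dots> \<le> \<bar>c\<bar> * (e / (1 + \<bar>c\<bar>))" 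
        by (rule mult_left_mono[OF less_imp_le[OF N[rule_format, OF mn]]]) simp
      also have "\<dots> < e" using e by (simp add: field_simps)
      finally show ?thesis by (simp add: algebra_simps)
    qed
    then show ?thesis by blast
  qed
  then show ?thesis
    using s by (simp add: cauchy_seqs_def nminus_eq cmult_in)
qed

lemma null_rel_iff:
  "(s, t) \<in> null_rel X \<longleftrightarrow> s \<in> cauchy_seqs X \<and> t \<in> cauchy_seqs X \<and>
     (\<lambda>n. nrm X (\<lambda>x. s n x - t n x)) \<longlonglongrightarrow> 0"
  by (simp add: null_rel_def nminus_eq)

lemma equiv_null_rel: "equiv (cauchy_seqs X) (null_rel X)"
proof (rule equivI)
  show "null_rel X \<subseteq> cauchy_seqs X \<times> cauchy_seqs X" by (auto simp: null_rel_iff)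
  show "refl_on (cauchy_seqs X) (null_rel X)" by (auto simp: refl_on_def null_rel_iff nrm_zero)
  show "sym (null_rel X)"
  proof (rule symI)
    fix s t assume st: "(s, t) \<in> null_rel X"
    then have "nrm X (\<lambda>x. t n x - s n x) = nrm X (\<lambda>x. s n x - t n x)" for n
      using nrm_minus[OF diff_in[OF cauchy_in[of s n] cauchy_in[of t n]]] by (simp add: null_rel_iff)
    then show "(t, s) \<in> null_rel X" using st by (simp add: null_rel_iff)
  qed
  show "trans (null_rel X)"
  proof (rule transI)
    fix s t w assume st: "(s, t) \<in> null_rel X" and tw: "(t, w) \<in> null_rel X"
    then have c: "s \<in> cauchy_seqs X" "t \<in> cauchy_seqs X" "w \<in> cauchy_seqs X" by (auto simp: null_rel_iff)
    have "nrm X (\<lambda>x. s n x - w n x) \<le> nrm X (\<lambda>x. s n x - t n x) + nrm X (\<lambda>x. t n x - w n x)" for n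
      using nrm_triangle[OF diff_in[OF cauchy_in[OF c(1)] cauchy_in[OF c(2)]]
          diff_in[OF cauchy_in[OF c(2)] cauchy_in[OF c(3)]], of n n n n] by simp
    moreover have "(\<lambda>n. nrm X (\<lambda>x. s n x - t n x) + nrm X (\<lambda>x. t n x - w n x)) \<longlonglongrightarrow> 0 + 0"
      using st tw by (intro tendsto_add) (auto simp: null_rel_iff)
    moreover have "0 \<le> nrm X (\<lambda>x. s n x - w n x)" for n
      by (rule nrm_nonneg[OF diff_in[OF cauchy_in[OF c(1)] cauchy_in[OF c(3)]]])
    ultimately have "(\<lambda>n. nrm X (\<lambda>x. s n x - w n x)) \<longlonglongrightarrow> 0"
      by - (rule Lim_null_comparison[of _ "\<lambda>n. nrm X (\<lambda>x. s n x - t n x) + nrm X (\<lambda>x. t n x - w n x)"],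
          simp_all)
    then show "(s, w) \<in> null_rel X" using c by (simp add: null_rel_iff)
  qed
qed

lemma cls_eq: "(s, t) \<in> null_rel X \<Longrightarrow> completion_class s = completion_class t"
  unfolding completion_class_def by (rule equiv_class_eq[OF equiv_null_rel])

lemma cls_self: "s \<in> cauchy_seqs X \<Longrightarrow> s \<in> completion_class s"
  using equiv_class_self[OF equiv_null_rel] by (simp add: completion_class_def)

lemma in_cls_iff: "t \<in> completion_class s \<longleftrightarrow> (s, t) \<in> null_rel X"
  by (simp add: completion_class_def)

lemma carr_completion: "carr (completion X) = completion_class ` cauchy_seqs X"
  by (auto simp: completion_def quotient_def completion_class_def)

lemma bounded_form_tendsto_eq:
  assumes lin: "linear_form X \<phi>" and le: "\<forall>u\<in>carr X. \<bar>\<phi> u\<bar> \<le> nrm X u"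
    and st: "(s, t) \<in> null_rel X"
  shows "(\<lambda>n. \<phi> (s n) - \<phi> (t n)) \<longlonglongrightarrow> 0"
proof (rule Lim_null_comparison)
  have c: "s n \<in> carr X" "t n \<in> carr X" for n using st by (auto simp: null_rel_iff cauchy_in)
  have "\<bar>\<phi> (s n) - \<phi> (t n)\<bar> \<le> nrm X (\<lambda>x. s n x - t n x)" for n
    using le diff_in[OF c] linear_form_diff[OF lin c] by metis
  then show "\<forall>\<^sub>F n in sequentially. norm (\<phi> (s n) - \<phi> (t n)) \<le> nrm X (\<lambda>x. s n x - t n x)"
    by simp
  show "(\<lambda>n. nrm X (\<lambda>x. s n x - t n x)) \<longlonglongrightarrow> 0" using st by (simp add: null_rel_iff)
qed

lemma lipschitz_cauchy_tendsto:
  assumes s: "s \<in> cauchy_seqs X"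
    and lip: "\<And>u v. u \<in> carr X \<Longrightarrow> v \<in> carr X \<Longrightarrow> \<bar>\<phi> u - \<phi> v\<bar> \<le> nrm X (\<lambda>x. u x - v x)"
  shows "(\<lambda>n. \<phi> (s n)) \<longlonglongrightarrow> lim (\<lambda>n. \<phi> (s n))"
proof -
  have "Cauchy (\<lambda>n. \<phi> (s n))"
  proof (rule metric_CauchyI)
    fix e :: real assume "0 < e"
    then obtain N where N: "\<forall>m\<ge>N. \<forall>n\<ge>N. nrm X (\<lambda>x. s m x - s n x) < e"
      using s unfolding cauchy_seqs_def nminus_eq by blast
    have "dist (\<phi> (s m)) (\<phi> (s n)) < e" if "m \<ge> N" "n \<ge> N" for m n
      using le_less_trans[OF lip[OF cauchy_in[OF s] cauchy_in[OF s]] N[rule_format, OF that]]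
      by (simp add: dist_real_def)
    then show "\<exists>N. \<forall>m\<ge>N. \<forall>n\<ge>N. dist (\<phi> (s m)) (\<phi> (s n)) < e" by blast
  qed
  then show ?thesis by (simp add: Cauchy_convergent_iff convergent_LIMSEQ_iff)
qed

lemma nrm_cauchy_tendsto: "s \<in> cauchy_seqs X \<Longrightarrow> (\<lambda>n. nrm X (s n)) \<longlonglongrightarrow> lim (\<lambda>n. nrm X (s n))"
  by (rule lipschitz_cauchy_tendsto) (auto intro: nrm_diff_ge)

lemma form_cauchy_tendsto:
  assumes "linear_form X \<phi>" "\<forall>u\<in>carr X. \<bar>\<phi> u\<bar> \<le> nrm X u" "s \<in> cauchy_seqs X"
  shows "(\<lambda>n. \<phi> (s n)) \<longlonglongrightarrow> lim (\<lambda>n. \<phi> (s n))"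
proof (rule lipschitz_cauchy_tendsto[OF assms(3)])
  fix u v assume uv: "u \<in> carr X" "v \<in> carr X"
  show "\<bar>\<phi> u - \<phi> v\<bar> \<le> nrm X (\<lambda>x. u x - v x)"
    using assms(2) diff_in[OF uv] linear_form_diff[OF assms(1) uv] by metis
qed

lemma nplus_cls:
  assumes s: "s \<in> cauchy_seqs X" and t: "t \<in> cauchy_seqs X"
  shows "nplus (completion X) (completion_class s) (completion_class t) = completion_class (\<lambda>n x. s n x + t n x)"
proof -
  have eq: "completion_class (\<lambda>n x. s' n x + t' n x) = completion_class (\<lambda>n x. s n x + t n x)"
    if s': "s' \<in> completion_class s" and t': "t' \<in> completion_class t" for s' t'
  proof (rule cls_eq[symmetric])
    have r: "(s, s') \<in> null_rel X" "(t, t') \<in> null_rel X" using s' t' by (auto simp: in_cls_iff)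
    then have c: "s' \<in> cauchy_seqs X" "t' \<in> cauchy_seqs X" by (auto simp: null_rel_iff)
    have "(\<lambda>n. nrm X (\<lambda>x. s n x - s' n x) + nrm X (\<lambda>x. t n x - t' n x)) \<longlonglongrightarrow> 0 + 0"
      using r by (intro tendsto_add) (auto simp: null_rel_iff)
    moreover have "norm (nrm X (\<lambda>x. (s n x + t n x) - (s' n x + t' n x)))
        \<le> nrm X (\<lambda>x. s n x - s' n x) + nrm X (\<lambda>x. t n x - t' n x)" for n
    proof -
      have d: "(\<lambda>x. s n x - s' n x) \<in> carr X" "(\<lambda>x. t n x - t' n x) \<in> carr X"
        by (intro diff_in cauchy_in s t c)+
      have "(\<lambda>x. (s n x + t n x) - (s' n x + t' n x)) = (\<lambda>x. (s n x - s' n x) + (t n x - t' n x))"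
        by (simp add: algebra_simps)
      then show ?thesis using nrm_triangle[OF d] nrm_nonneg[OF add_in[OF d]] by simp
    qed
    ultimately have "(\<lambda>n. nrm X (\<lambda>x. (s n x + t n x) - (s' n x + t' n x))) \<longlonglongrightarrow> 0"
      by - (rule Lim_null_comparison[of _ "\<lambda>n. nrm X (\<lambda>x. s n x - s' n x) + nrm X (\<lambda>x. t n x - t' n x)"], simp_all)
    then show "(\<lambda>n x. s n x + t n x, \<lambda>n x. s' n x + t' n x) \<in> null_rel X"
      by (simp add: null_rel_iff cauchy_seqs_add s t c)
  qed
  have "(\<Union>s'\<in>completion_class s. \<Union>t'\<in>completion_class t. completion_class (\<lambda>n x. s' n x + t' n x))
      = (\<Union>s'\<in>completion_class s. completion_class (\<lambda>n x. s' n x + t n x))"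
  proof (rule SUP_cong[OF refl])
    fix s' assume s': "s' \<in> completion_class s"
    show "(\<Union>t'\<in>completion_class t. completion_class (\<lambda>n x. s' n x + t' n x)) = completion_class (\<lambda>n x. s' n x + t n x)"
      using eq[OF s'] eq[OF s' cls_self[OF t]] by (intro UN_const_on[OF cls_self[OF t]]) simp
  qed
  also have "\<dots> = completion_class (\<lambda>n x. s n x + t n x)"
    using eq[OF _ cls_self[OF t]] by (intro UN_const_on[OF cls_self[OF s]]) simp
  finally show ?thesis by (simp add: completion_def plus_eq flip: completion_class_def)
qed

lemma scale_cls:
  assumes s: "s \<in> cauchy_seqs X"
  shows "scale (completion X) c (completion_class s) = completion_class (\<lambda>n x. c * s n x)"
proof -
  have eq: "completion_class (\<lambda>n x. c * s' n x) = completion_class (\<lambda>n x. c * s n x)" if s': "s' \<in> completion_class s" for s'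
  proof (rule cls_eq[symmetric])
    have r: "(s, s') \<in> null_rel X" using s' by (simp add: in_cls_iff)
    then have c: "s' \<in> cauchy_seqs X" by (simp add: null_rel_iff)
    have "nrm X (\<lambda>x. c * s n x - c * s' n x) = \<bar>c\<bar> * nrm X (\<lambda>x. s n x - s' n x)" for n
      using nrm_cmult[OF diff_in[OF cauchy_in[OF s, of n] cauchy_in[OF c, of n]], of c]
      by (simp add: right_diff_distrib)
    moreover have "(\<lambda>n. \<bar>c\<bar> * nrm X (\<lambda>x. s n x - s' n x)) \<longlonglongrightarrow> \<bar>c\<bar> * 0"
      using r by (intro tendsto_mult_left) (simp add: null_rel_iff)
    ultimately show "(\<lambda>n x. c * s n x, \<lambda>n x. c * s' n x) \<in> null_rel X"
      using s c by (simp add: null_rel_iff cauchy_seqs_cmult)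
  qed
  have "(\<Union>s'\<in>completion_class s. completion_class (\<lambda>n x. c * s' n x)) = completion_class (\<lambda>n x. c * s n x)"
    using UN_const_on[OF cls_self[OF s], of "\<lambda>s'. completion_class (\<lambda>n x. c * s' n x)"] eq by simp
  then show ?thesis by (simp add: completion_def scale_eq flip: completion_class_def)
qed

lemma nrm_cls:
  assumes s: "s \<in> cauchy_seqs X"
  shows "nrm (completion X) (completion_class s) = lim (\<lambda>n. nrm X (s n))"
proof -
  have "lim (\<lambda>n. nrm X (s' n)) = lim (\<lambda>n. nrm X (s n))" if s': "s' \<in> completion_class s" for s'
  proof -
    have r: "(s, s') \<in> null_rel X" using s' by (simp add: in_cls_iff)
    then have c: "s' \<in> cauchy_seqs X" by (simp add: null_rel_iff)
    have "(\<lambda>n. nrm X (s n) - nrm X (s' n)) \<longlonglongrightarrow> 0"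
      by (rule Lim_null_comparison[of _ "\<lambda>n. nrm X (\<lambda>x. s n x - s' n x)"])
        (use r nrm_diff_ge[OF cauchy_in[OF s] cauchy_in[OF c]] in \<open>auto simp: null_rel_iff\<close>)
    moreover have "(\<lambda>n. nrm X (s n) - nrm X (s' n)) \<longlonglongrightarrow> lim (\<lambda>n. nrm X (s n)) - lim (\<lambda>n. nrm X (s' n))"
      by (intro tendsto_diff nrm_cauchy_tendsto s c)
    ultimately show ?thesis using LIMSEQ_unique by fastforce
  qed
  then have "the_elem ((\<lambda>s. lim (\<lambda>n. nrm X (s n))) ` completion_class s) = lim (\<lambda>n. nrm X (s n))"
    by (rule the_elem_image_const[OF cls_self[OF s]])
  then show ?thesis by (simp add: completion_def)
qed

lemma homogeneous_space_completion: "homogeneous_space (completion X)"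
proof
  have "(\<lambda>n x. 0) \<in> cauchy_seqs X"
    by (simp add: cauchy_seqs_def nminus_eq zero_in nrm_zero)
  then show "carr (completion X) \<noteq> {}" by (auto simp: carr_completion)
next
  fix P assume "P \<in> carr (completion X)"
  then obtain s where s: "s \<in> cauchy_seqs X" "P = completion_class s" by (auto simp: carr_completion)
  show "scale (completion X) c P \<in> carr (completion X)" for c
    using s by (simp add: scale_cls carr_completion cauchy_seqs_cmult)
  show "0 \<le> nrm (completion X) P"
    unfolding s(2) nrm_cls[OF s(1)]
    using nrm_nonneg[OF cauchy_in[OF s(1)]]
    by (intro LIMSEQ_le_const[OF nrm_cauchy_tendsto[OF s(1)]]) auto
  show "nrm (completion X) (scale (completion X) c P) = \<bar>c\<bar> * nrm (completion X) P" for c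
  proof -
    have "(\<lambda>n. \<bar>c\<bar> * nrm X (s n)) \<longlonglongrightarrow> \<bar>c\<bar> * lim (\<lambda>n. nrm X (s n))"
      by (intro tendsto_mult_left nrm_cauchy_tendsto s)
    moreover have "nrm X (\<lambda>x. c * s n x) = \<bar>c\<bar> * nrm X (s n)" for n
      by (rule nrm_cmult[OF cauchy_in[OF s(1)]])
    ultimately have "lim (\<lambda>n. nrm X (\<lambda>x. c * s n x)) = \<bar>c\<bar> * lim (\<lambda>n. nrm X (s n))"
      by (simp add: limI)
    then show ?thesis using s by (simp add: scale_cls nrm_cls cauchy_seqs_cmult)
  qed
next
  fix P Q assume "P \<in> carr (completion X)" "Q \<in> carr (completion X)"
  then obtain s t where "s \<in> cauchy_seqs X" "P = completion_class s" "t \<in> cauchy_seqs X" "Q = completion_class t"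
    by (auto simp: carr_completion)
  then show "nplus (completion X) P Q \<in> carr (completion X)"
    by (simp add: nplus_cls carr_completion cauchy_seqs_add)
qed

text \<open>
  The continuous extension of a bounded linear form to the completion; by \<open>ext_form_cls\<close> the chosen
  representative does not matter.
\<close>

definition ext_form :: "(('c \<Rightarrow> real) \<Rightarrow> real) \<Rightarrow> (nat \<Rightarrow> 'c \<Rightarrow> real) set \<Rightarrow> real" where
  "ext_form \<phi> P = lim (\<lambda>n. \<phi> ((SOME s. s \<in> P) n))"

lemma ext_form_cls:
  assumes \<phi>: "linear_form X \<phi>" "\<forall>u\<in>carr X. \<bar>\<phi> u\<bar> \<le> nrm X u" and s: "s \<in> cauchy_seqs X"
  shows "ext_form \<phi> (completion_class s) = lim (\<lambda>n. \<phi> (s n))"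
proof -
  let ?s = "SOME t. t \<in> completion_class s"
  have "?s \<in> completion_class s" by (rule someI[of "\<lambda>t. t \<in> completion_class s"]) (rule cls_self[OF s])
  then have r: "(s, ?s) \<in> null_rel X" by (simp add: in_cls_iff)
  then have c: "?s \<in> cauchy_seqs X" by (simp add: null_rel_iff)
  have "(\<lambda>n. \<phi> (s n) - \<phi> (?s n)) \<longlonglongrightarrow> lim (\<lambda>n. \<phi> (s n)) - lim (\<lambda>n. \<phi> (?s n))"
    by (intro tendsto_diff form_cauchy_tendsto \<phi> s c)
  with bounded_form_tendsto_eq[OF \<phi> r] have "lim (\<lambda>n. \<phi> (s n)) - lim (\<lambda>n. \<phi> (?s n)) = 0"
    using LIMSEQ_unique by blast
  then show ?thesis by (simp add: ext_form_def)
qed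

text \<open>
  The criterion applied to the continuous extensions of the functionals in \<open>K\<close>. A family that norms
  the dense subspace exactly norms the completion approximately.
\<close>

theorem SSD_completion:
  fixes K :: "(('c \<Rightarrow> real) \<Rightarrow> real) set"
  assumes lin: "\<And>\<phi>. \<phi> \<in> K \<Longrightarrow> linear_form X \<phi>"
    and le: "\<And>\<phi>. \<phi> \<in> K \<Longrightarrow> \<forall>u\<in>carr X. \<bar>\<phi> u\<bar> \<le> nrm X u"
    and norming: "\<And>u. u \<in> carr X \<Longrightarrow> \<exists>\<phi>\<in>K. \<phi> u = nrm X u"
    and slices: "\<And>s e. s \<in> cauchy_seqs X \<Longrightarrow> (\<lambda>n. nrm X (s n)) \<longlonglongrightarrow> 1 \<Longrightarrow> 0 < e \<Longrightarrow>
       \<exists>d>0. \<forall>\<phi>\<in>K. lim (\<lambda>n. \<phi> (s n)) > 1 - d \<longrightarrow>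
         (\<exists>\<psi>\<in>K. lim (\<lambda>n. \<psi> (s n)) = 1 \<and> (\<forall>u\<in>carr X. \<bar>\<phi> u - \<psi> u\<bar> \<le> e * nrm X u))"
  shows "SSD (completion X)"
  unfolding SSD_def
proof
  fix P assume P: "P \<in> unit_sphere (completion X)"
  then obtain s where s: "s \<in> cauchy_seqs X" "P = completion_class s"
    by (auto simp: unit_sphere_def carr_completion)
  have "lim (\<lambda>n. nrm X (s n)) = 1" using P s by (simp add: unit_sphere_def nrm_cls)
  then have s1: "(\<lambda>n. nrm X (s n)) \<longlonglongrightarrow> 1" using nrm_cauchy_tendsto[OF s(1)] by simp
  note ext = ext_form_cls[OF lin le] and tends = form_cauchy_tendsto[OF lin le]
  have ext_le: "\<bar>ext_form \<phi> Q\<bar> \<le> nrm (completion X) Q" if \<phi>: "\<phi> \<in> K" and Q: "Q \<in> carr (completion X)" for \<phi> Q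
  proof -
    obtain t where t: "t \<in> cauchy_seqs X" "Q = completion_class t" using Q by (auto simp: carr_completion)
    have "\<bar>lim (\<lambda>n. \<phi> (t n))\<bar> \<le> lim (\<lambda>n. nrm X (t n))"
      using le[OF \<phi>] cauchy_in[OF t(1)]
      by (intro LIMSEQ_le[OF tendsto_rabs[OF tends[OF \<phi> \<phi> t(1)]] nrm_cauchy_tendsto[OF t(1)]]) auto
    then show ?thesis using t by (simp add: ext[OF \<phi> \<phi>] nrm_cls)
  qed
  show "SSD_at (completion X) P"
  proof (rule SSD_at_criterion[OF homogeneous_space_completion P, of "ext_form ` K"])
    fix \<Phi> assume "\<Phi> \<in> ext_form ` K"
    then obtain \<phi> where \<phi>: "\<phi> \<in> K" "\<Phi> = ext_form \<phi>" by blast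
    show "\<bar>\<Phi> Q\<bar> \<le> nrm (completion X) Q" if "Q \<in> carr (completion X)" for Q
      using ext_le[OF \<phi>(1) that] by (simp add: \<phi>(2))
    show "linear_form (completion X) \<Phi>"
      unfolding linear_form_def \<phi>(2)
    proof (intro conjI ballI allI)
      fix Q R assume "Q \<in> carr (completion X)" "R \<in> carr (completion X)"
      then obtain t w where tw: "t \<in> cauchy_seqs X" "Q = completion_class t" "w \<in> cauchy_seqs X" "R = completion_class w"
        by (auto simp: carr_completion)
      have "(\<lambda>n. \<phi> (t n) + \<phi> (w n)) \<longlonglongrightarrow> lim (\<lambda>n. \<phi> (t n)) + lim (\<lambda>n. \<phi> (w n))"
        by (intro tendsto_add tends \<phi> tw)
      then have "lim (\<lambda>n. \<phi> (\<lambda>x. t n x + w n x)) = lim (\<lambda>n. \<phi> (t n)) + lim (\<lambda>n. \<phi> (w n))"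
        using linear_form_add[OF lin[OF \<phi>(1)] cauchy_in[OF tw(1)] cauchy_in[OF tw(3)]] by (simp add: limI)
      then show "ext_form \<phi> (nplus (completion X) Q R) = ext_form \<phi> Q + ext_form \<phi> R"
        using tw by (simp add: nplus_cls ext[OF \<phi>(1) \<phi>(1)] cauchy_seqs_add)
    next
      fix c Q assume "Q \<in> carr (completion X)"
      then obtain t where t: "t \<in> cauchy_seqs X" "Q = completion_class t" by (auto simp: carr_completion)
      have "(\<lambda>n. c * \<phi> (t n)) \<longlonglongrightarrow> c * lim (\<lambda>n. \<phi> (t n))"
        by (intro tendsto_mult_left tends \<phi> t)
      then have "lim (\<lambda>n. \<phi> (\<lambda>x. c * t n x)) = c * lim (\<lambda>n. \<phi> (t n))"
        using linear_form_cmult[OF lin[OF \<phi>(1)] cauchy_in[OF t(1)]] by (simp add: limI)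
      then show "ext_form \<phi> (scale (completion X) c Q) = c * ext_form \<phi> Q"
        using t by (simp add: scale_cls ext[OF \<phi>(1) \<phi>(1)] cauchy_seqs_cmult)
    qed
  next
    fix Q and e :: real assume "Q \<in> carr (completion X)" and e: "0 < e"
    then obtain t where t: "t \<in> cauchy_seqs X" "Q = completion_class t" by (auto simp: carr_completion)
    obtain N where N: "\<forall>m\<ge>N. \<forall>n\<ge>N. nrm X (\<lambda>x. t m x - t n x) < e / 2"
      using t(1) half_gt_zero[OF e] unfolding cauchy_seqs_def nminus_eq by blast
    obtain \<phi> where \<phi>: "\<phi> \<in> K" "\<phi> (t N) = nrm X (t N)" using norming[OF cauchy_in[OF t(1)]] by blast
    have "nrm X (t n) - e \<le> \<phi> (t n)" if "n \<ge> N" for n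
    proof -
      note c = cauchy_in[OF t(1), of n] cauchy_in[OF t(1), of N]
      have d: "nrm X (\<lambda>x. t n x - t N x) < e / 2" using N that by simp
      have "\<bar>\<phi> (\<lambda>x. t n x - t N x)\<bar> \<le> nrm X (\<lambda>x. t n x - t N x)" using le[OF \<phi>(1)] diff_in[OF c] by blast
      then have "\<bar>\<phi> (t n) - \<phi> (t N)\<bar> < e / 2" using linear_form_diff[OF lin[OF \<phi>(1)] c] d by simp
      moreover have "\<bar>nrm X (t n) - nrm X (t N)\<bar> < e / 2" using nrm_diff_ge[OF c] d by simp
      ultimately show ?thesis using \<phi>(2) by linarith
    qed
    then have "lim (\<lambda>n. nrm X (t n)) - e \<le> lim (\<lambda>n. \<phi> (t n))"
      by (intro LIMSEQ_le[OF tendsto_diff[OF nrm_cauchy_tendsto[OF t(1)] tendsto_const] tends[OF \<phi>(1) \<phi>(1) t(1)]])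
        blast
    then show "\<exists>\<Phi>\<in>ext_form ` K. nrm (completion X) Q - e \<le> \<Phi> Q"
      using \<phi>(1) t by (auto simp: nrm_cls ext)
  next
    fix e :: real assume e: "0 < e"
    obtain d where d: "d > 0" "\<forall>\<phi>\<in>K. lim (\<lambda>n. \<phi> (s n)) > 1 - d \<longrightarrow>
         (\<exists>\<psi>\<in>K. lim (\<lambda>n. \<psi> (s n)) = 1 \<and> (\<forall>u\<in>carr X. \<bar>\<phi> u - \<psi> u\<bar> \<le> e * nrm X u))"
      using slices[OF s(1) s1 e] by blast
    have "\<exists>\<Psi>\<in>ext_form ` K. \<Psi> P = 1 \<and> (\<forall>H\<in>unit_sphere (completion X). \<bar>\<Phi> H - \<Psi> H\<bar> \<le> e)"
      if "\<Phi> \<in> ext_form ` K" "\<Phi> P > 1 - d" for \<Phi>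
    proof -
      obtain \<phi> where \<phi>: "\<phi> \<in> K" "\<Phi> = ext_form \<phi>" using \<open>\<Phi> \<in> ext_form ` K\<close> by blast
      have "lim (\<lambda>n. \<phi> (s n)) > 1 - d" using that s \<phi> by (simp add: ext)
      then obtain \<psi> where \<psi>: "\<psi> \<in> K" "lim (\<lambda>n. \<psi> (s n)) = 1" "\<forall>u\<in>carr X. \<bar>\<phi> u - \<psi> u\<bar> \<le> e * nrm X u"
        using d(2) \<phi>(1) by blast
      have "\<bar>\<Phi> H - ext_form \<psi> H\<bar> \<le> e" if H: "H \<in> unit_sphere (completion X)" for H
      proof -
        obtain t where t: "t \<in> cauchy_seqs X" "H = completion_class t"
          using H by (auto simp: unit_sphere_def carr_completion)
        have "(\<lambda>n. \<bar>\<phi> (t n) - \<psi> (t n)\<bar>) \<longlonglongrightarrow> \<bar>lim (\<lambda>n. \<phi> (t n)) - lim (\<lambda>n. \<psi> (t n))\<bar>"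
          by (intro tendsto_rabs tendsto_diff tends \<phi> \<psi> t)
        moreover have "(\<lambda>n. e * nrm X (t n)) \<longlonglongrightarrow> e * lim (\<lambda>n. nrm X (t n))"
          by (intro tendsto_mult_left nrm_cauchy_tendsto t)
        ultimately have "\<bar>lim (\<lambda>n. \<phi> (t n)) - lim (\<lambda>n. \<psi> (t n))\<bar> \<le> e * lim (\<lambda>n. nrm X (t n))"
          by (rule LIMSEQ_le) (use \<psi>(3) cauchy_in[OF t(1)] in blast)
        moreover have "lim (\<lambda>n. nrm X (t n)) = 1" using H t by (simp add: unit_sphere_def nrm_cls)
        ultimately show ?thesis using t \<phi> \<psi> by (simp add: ext)
      qed
      moreover have "ext_form \<psi> P = 1" using s \<psi> by (simp add: ext)
      ultimately show ?thesis using \<psi>(1) by blast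
    qed
    then show "\<exists>d>0. \<forall>\<Phi>\<in>ext_form ` K. \<Phi> P > 1 - d \<longrightarrow>
        (\<exists>\<Psi>\<in>ext_form ` K. \<Psi> P = 1 \<and> (\<forall>H\<in>unit_sphere (completion X). \<bar>\<Phi> H - \<Psi> H\<bar> \<le> e))"
      using d(1) by blast
  qed
qed

end

section \<open>Bilinear forms on \<open>\<ell>\<^sub>p\<close>: tails are small\<close>

definition restr :: "'i set \<Rightarrow> ('i \<Rightarrow> real) \<Rightarrow> 'i \<Rightarrow> real" where
  "restr F x = (\<lambda>i. if i \<in> F then x i else 0)"

lemma powr_le_powr_iff:
  fixes a b p :: real
  assumes "0 < p" "0 \<le> a" "0 \<le> b"
  shows "a powr p \<le> b powr p \<longleftrightarrow> a \<le> b"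
  using assms powr_mono2[of p a b] powr_less_mono2[of p b a] by fastforce

locale lp =
  fixes p :: real and I :: "'i set"
  assumes p: "1 < p"
begin

abbreviation E where "E \<equiv> lp_space p I"

lemma carr_E: "x \<in> carr E \<longleftrightarrow> (\<forall>i. i \<notin> I \<longrightarrow> x i = 0) \<and> (\<lambda>i. \<bar>x i\<bar> powr p) summable_on I"
  by (simp add: lp_space_def)

lemma nplus_E: "nplus E x y = (\<lambda>i. x i + y i)"
  and scale_E: "scale E c x = (\<lambda>i. c * x i)"
  by (simp_all add: lp_space_def)

lemma infsum_nonneg_powr: "0 \<le> (\<Sum>\<^sub>\<infinity>i\<in>I. \<bar>x i\<bar> powr p)"
  by (intro infsum_nonneg) simp

lemma nrm_E_powr: "nrm E x powr p = (\<Sum>\<^sub>\<infinity>i\<in>I. \<bar>x i\<bar> powr p)"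
  using p infsum_nonneg_powr[of x] by (simp add: lp_space_def powr_powr)

lemma nrm_E_nonneg: "0 \<le> nrm E x"
  by (simp add: lp_space_def)

lemma nrm_E_le_iff: "0 \<le> a \<Longrightarrow> nrm E x \<le> a \<longleftrightarrow> (\<Sum>\<^sub>\<infinity>i\<in>I. \<bar>x i\<bar> powr p) \<le> a powr p"
  using p by (simp add: nrm_E_powr[symmetric] nrm_E_nonneg powr_le_powr_iff)

lemma function_space_lp: "function_space E"
proof
  have "(\<lambda>i. 0) \<in> carr E" by (simp add: carr_E)
  then show "carr E \<noteq> {}" by blast
next
  fix x y assume x: "x \<in> carr E" and y: "y \<in> carr E"
  have "(\<lambda>i. 2 powr p * (\<bar>x i\<bar> powr p + \<bar>y i\<bar> powr p)) summable_on I"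
    using x y by (intro summable_on_cmult_right summable_on_add) (auto simp: carr_E)
  then have "(\<lambda>i. \<bar>x i + y i\<bar> powr p) summable_on I"
    by (rule summable_on_comparison_test) (use p abs_add_powr_le in auto)
  then show "nplus E x y \<in> carr E" using x y by (simp add: carr_E nplus_E)
next
  fix x c assume x: "x \<in> carr E"
  have eq: "(\<lambda>i. \<bar>c * x i\<bar> powr p) = (\<lambda>i. \<bar>c\<bar> powr p * \<bar>x i\<bar> powr p)"
    by (simp add: abs_mult powr_mult)
  show "scale E c x \<in> carr E"
    using x summable_on_cmult_right[of "\<lambda>i. \<bar>x i\<bar> powr p" I "\<bar>c\<bar> powr p"]
    by (simp add: carr_E scale_E eq)
  have "(\<Sum>\<^sub>\<infinity>i\<in>I. \<bar>c\<bar> powr p * \<bar>x i\<bar> powr p) = \<bar>c\<bar> powr p * (\<Sum>\<^sub>\<infinity>i\<in>I. \<bar>x i\<bar> powr p)"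
    by (rule infsum_cmult_right')
  then have "(\<Sum>\<^sub>\<infinity>i\<in>I. \<bar>c * x i\<bar> powr p) powr (1 / p) = \<bar>c\<bar> * (\<Sum>\<^sub>\<infinity>i\<in>I. \<bar>x i\<bar> powr p) powr (1 / p)"
    using p infsum_nonneg_powr[of x] by (simp add: eq powr_mult powr_powr)
  then show "nrm E (scale E c x) = \<bar>c\<bar> * nrm E x" by (simp add: lp_space_def)
qed (simp_all add: nrm_E_nonneg nplus_E scale_E)

sublocale E: function_space E by (rule function_space_lp)

lemma restr_in: "x \<in> carr E \<Longrightarrow> restr F x \<in> carr E"
  by (auto simp: carr_E restr_def intro: summable_on_comparison_test)

lemma nrm_restr_le:
  assumes "x \<in> carr E" shows "nrm E (restr F x) \<le> nrm E x"
proof -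
  have "(\<Sum>\<^sub>\<infinity>i\<in>I. \<bar>restr F x i\<bar> powr p) \<le> (\<Sum>\<^sub>\<infinity>i\<in>I. \<bar>x i\<bar> powr p)"
    using assms restr_in[OF assms, of F] by (intro infsum_mono) (auto simp: carr_E restr_def)
  then show ?thesis by (simp add: nrm_E_le_iff nrm_E_nonneg nrm_E_powr)
qed

lemma abs_coord_le:
  assumes "x \<in> carr E" shows "\<bar>x i\<bar> \<le> nrm E x"
proof (cases "i \<in> I")
  case True
  have "(\<Sum>\<^sub>\<infinity>j\<in>{i}. \<bar>x j\<bar> powr p) \<le> (\<Sum>\<^sub>\<infinity>j\<in>I. \<bar>x j\<bar> powr p)"
    using assms True by (intro infsum_mono_neutral) (auto simp: carr_E)
  then have "\<bar>x i\<bar> powr p \<le> nrm E x powr p" by (simp add: nrm_E_powr)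
  then show ?thesis using p nrm_E_nonneg[of x] by (simp add: powr_le_powr_iff)
next
  case False
  then show ?thesis using assms nrm_E_nonneg[of x] by (simp add: carr_E)
qed

lemma nrm_disjoint_add:
  assumes x: "x \<in> carr E" and y: "y \<in> carr E" and xy: "\<And>i. x i = 0 \<or> y i = 0"
  shows "nrm E (\<lambda>i. x i + y i) powr p = nrm E x powr p + nrm E y powr p"
proof -
  have "\<bar>x i + y i\<bar> powr p = \<bar>x i\<bar> powr p + \<bar>y i\<bar> powr p" for i
    using xy[of i] by auto
  then show ?thesis
    using x y by (simp add: nrm_E_powr carr_E infsum_add)
qed

lemma unit_in:
  assumes "i \<in> I"
  shows "(\<lambda>j. if j = i then 1 else 0) \<in> carr E"
proof -
  have "(\<lambda>j. \<bar>if j = i then 1 else 0\<bar> powr p) summable_on I"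
    by (rule finite_nonzero_values_imp_summable_on) (rule finite_subset[of _ "{i}"], auto)
  then show ?thesis using assms by (simp add: carr_E)
qed

text \<open>
  The form of this statement, for all \<open>F\<close> above \<open>F0\<close>, allows one finite set to serve finitely many
  vectors at once.
\<close>

lemma restr_tail_small:
  assumes x: "x \<in> carr E" and e: "0 < e"
  obtains F0 where "finite F0" "F0 \<subseteq> I" "\<forall>F. F0 \<subseteq> F \<longrightarrow> nrm E (restr (- F) x) \<le> e"
proof -
  let ?f = "\<lambda>i. \<bar>x i\<bar> powr p"
  have sum: "?f summable_on I" using x by (simp add: carr_E)
  have "0 < e powr p" using e by simp
  then obtain F0 where F0: "finite F0" "F0 \<subseteq> I" "dist (sum ?f F0) (infsum ?f I) \<le> e powr p"
    using infsum_finite_approximation[OF sum] by blast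
  have "nrm E (restr (- F) x) \<le> e" if F: "F0 \<subseteq> F" for F
  proof -
    have "(\<Sum>\<^sub>\<infinity>i\<in>I. \<bar>restr (- F) x i\<bar> powr p) \<le> infsum ?f (I - F0)"
      using sum F restr_in[OF x, of "- F"]
      by (intro infsum_mono_neutral) (auto simp: restr_def carr_E intro: summable_on_subset_banach)
    also have "\<dots> = infsum ?f I - sum ?f F0"
      using F0 sum by (subst infsum_Diff) (auto intro: summable_on_subset_banach)
    also have "\<dots> \<le> e powr p" using F0(3) by (simp add: dist_real_def)
    finally show ?thesis using e by (simp add: nrm_E_le_iff)
  qed
  with F0 show ?thesis by (intro that) auto
qed

lemma restr_split: "x = (\<lambda>i. restr F x i + restr (- F) x i)"
  by (auto simp: restr_def)

lemma linear_form_restr_finite: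
  assumes lin: "linear_form E f" and F: "finite F" "F \<subseteq> I" and x: "x \<in> carr E"
  shows "f (restr F x) = (\<Sum>i\<in>F. x i * f (\<lambda>j. if j = i then 1 else 0))"
  using F
proof (induction F)
  case empty
  have "restr {} x = (\<lambda>i. 0)" by (simp add: restr_def)
  then show ?case using E.linear_form_zero[OF lin] by simp
next
  case (insert i F)
  have i: "i \<in> I" using insert by simp
  have "restr (insert i F) x = (\<lambda>j. x i * (if j = i then 1 else 0) + restr F x j)"
    using insert by (auto simp: restr_def)
  then show ?case
    using insert E.linear_form_add[OF lin E.cmult_in[OF unit_in[OF i], of "x i"] restr_in[OF x]]
      E.linear_form_cmult[OF lin unit_in[OF i], of "x i"] by simp
qed

end

text \<open>
  The hypotheses on \<open>Z\<close> express smoothness of power type \<open>s\<close>. The condition \<open>1/p + 1/s < 1\<close> says that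
  \<open>p\<close> exceeds the exponent conjugate to \<open>s\<close>.
\<close>

locale lp_smooth = lp p I + Z: function_space Z
  for p :: real and I :: "'i set" and Z :: "('c \<Rightarrow> real) nspace" +
  fixes C s :: real
  assumes C: "0 \<le> C" and s: "0 < s" and ps: "1 / p + 1 / s < 1"
    and smooth: "\<And>f g c. f \<in> carr Z \<Longrightarrow> g \<in> carr Z \<Longrightarrow> nrm Z f \<le> 1 \<Longrightarrow> nrm Z g \<le> 1 \<Longrightarrow> 0 \<le> c \<Longrightarrow>
        nrm Z (\<lambda>x. f x + c * g x) + nrm Z (\<lambda>x. f x - c * g x) \<le> 2 + C * c powr s"
begin

sublocale tensor_pair E Z ..

lemma bilinear_E_simps:
  assumes "\<beta> \<in> bilinear_forms E Z"
  shows "x \<in> carr E \<Longrightarrow> y \<in> carr E \<Longrightarrow> z \<in> carr Z \<Longrightarrow> \<beta> (\<lambda>i. x i + y i) z = \<beta> x z + \<beta> y z"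
    and "x \<in> carr E \<Longrightarrow> z \<in> carr Z \<Longrightarrow> \<beta> (\<lambda>i. c * x i) z = c * \<beta> x z"
    and "x \<in> carr E \<Longrightarrow> z \<in> carr Z \<Longrightarrow> w \<in> carr Z \<Longrightarrow> \<beta> x (\<lambda>i. z i + w i) = \<beta> x z + \<beta> x w"
    and "x \<in> carr E \<Longrightarrow> z \<in> carr Z \<Longrightarrow> \<beta> x (\<lambda>i. c * z i) = c * \<beta> x z"
  using bilinear_forms_simps[OF assms] by (simp_all add: E.plus_eq E.scale_eq Z.plus_eq Z.scale_eq)

text \<open>
  The two values \<open>\<beta>(x + b y, f + c g)\<close> and \<open>\<beta>(x - b y, f - c g)\<close> add up to
  \<open>2 \<beta>(x, f) + 2 b c \<beta>(y, g)\<close>; disjointness of the supports bounds the first arguments by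
  \<open>(1 + b\<^sup>p)\<^sup>1\<^sup>/\<^sup>p\<close> and smoothness bounds the second ones.
\<close>

lemma tail_bound_ball:
  assumes \<beta>: "\<beta> \<in> bilinear_ball" and \<tau>: "0 < \<tau>" "\<tau> \<le> 1"
    and x: "x \<in> carr E" "nrm E x \<le> 1" and y: "y \<in> carr E" "nrm E y \<le> 1"
    and disj: "\<And>i. x i = 0 \<or> y i = 0"
    and f: "f \<in> carr Z" "nrm Z f \<le> 1" and g: "g \<in> carr Z" "nrm Z g \<le> 1"
    and near: "\<beta> x f > 1 - \<tau>"
  shows "\<beta> y g \<le> (C + 2) * \<tau> powr (1 - (1 / p + 1 / s))"
proof -
  \<comment> \<open>both \<open>b\<^sup>p\<close> and \<open>c\<^sup>s\<close> equal \<open>\<tau>\<close>, so that all the losses are of order \<open>\<tau>\<close>\<close>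
  define b c where "b = \<tau> powr (1 / p)" and "c = \<tau> powr (1 / s)"
  have bc: "0 < b" "0 < c" "b powr p = \<tau>" "c powr s = \<tau>"
    using \<tau> p s by (simp_all add: b_def c_def powr_powr)
  have nb: "nrm E (\<lambda>i. x i + \<sigma> * b * y i) \<le> 1 + \<tau>" if \<sigma>: "\<bar>\<sigma>\<bar> = 1" for \<sigma>
  proof -
    have "nrm E (\<lambda>i. x i + \<sigma> * b * y i) powr p = nrm E x powr p + nrm E (\<lambda>i. \<sigma> * b * y i) powr p"
      using disj by (intro nrm_disjoint_add x E.cmult_in y) auto
    also have "nrm E (\<lambda>i. \<sigma> * b * y i) = b * nrm E y"
      using E.nrm_cmult[OF y(1), of "\<sigma> * b"] \<sigma> bc by (simp add: abs_mult)
    also have "(b * nrm E y) powr p = \<tau> * nrm E y powr p"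
      using bc nrm_E_nonneg[of y] by (simp add: powr_mult)
    also have "nrm E x powr p + \<tau> * nrm E y powr p \<le> 1 powr p + \<tau> * 1 powr p"
      using x y \<tau> p nrm_E_nonneg by (intro add_mono powr_mono2 mult_left_mono) auto
    also have "\<dots> \<le> (1 + \<tau>) powr p" using \<tau> p powr_mono[of 1 p "1 + \<tau>"] by simp
    finally show ?thesis using p \<tau> nrm_E_nonneg by (simp add: powr_le_powr_iff)
  qed
  note bil = bilinear_E_simps[OF bilinear_ball_bilinear[OF \<beta>]]
  note ins = E.add_in E.cmult_in Z.add_in Z.cmult_in x(1) y(1) f(1) g(1)
  have pair: "\<beta> (\<lambda>i. x i + \<sigma> * b * y i) (\<lambda>t. f t + \<sigma> * c * g t) \<le> (1 + \<tau>) * nrm Z (\<lambda>t. f t + \<sigma> * c * g t)"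
    if \<sigma>: "\<bar>\<sigma>\<bar> = 1" for \<sigma>
  proof -
    have "\<bar>\<beta> (\<lambda>i. x i + \<sigma> * b * y i) (\<lambda>t. f t + \<sigma> * c * g t)\<bar>
        \<le> nrm E (\<lambda>i. x i + \<sigma> * b * y i) * nrm Z (\<lambda>t. f t + \<sigma> * c * g t)"
      by (intro bilinear_ball_le[OF \<beta>] ins)
    also have "\<dots> \<le> (1 + \<tau>) * nrm Z (\<lambda>t. f t + \<sigma> * c * g t)"
      using nb[OF \<sigma>] by (intro mult_right_mono Z.nrm_nonneg ins)
    finally show ?thesis by simp
  qed
  have expand: "\<beta> (\<lambda>i. x i + \<sigma> * b * y i) (\<lambda>t. f t + \<sigma> * c * g t)
      = \<beta> x f + \<sigma> * c * \<beta> x g + \<sigma> * b * \<beta> y f + \<sigma> * \<sigma> * (b * c) * \<beta> y g" for \<sigma>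
    by (simp add: bil ins algebra_simps)
  have "2 * \<beta> x f + 2 * (b * c) * \<beta> y g
      = \<beta> (\<lambda>i. x i + 1 * b * y i) (\<lambda>t. f t + 1 * c * g t)
      + \<beta> (\<lambda>i. x i + (- 1) * b * y i) (\<lambda>t. f t + (- 1) * c * g t)"
    unfolding expand by simp
  also have "\<dots> \<le> (1 + \<tau>) * nrm Z (\<lambda>t. f t + 1 * c * g t) + (1 + \<tau>) * nrm Z (\<lambda>t. f t + (- 1) * c * g t)"
    by (intro add_mono pair) auto
  also have "\<dots> = (1 + \<tau>) * (nrm Z (\<lambda>t. f t + c * g t) + nrm Z (\<lambda>t. f t - c * g t))"
    by (simp add: algebra_simps)
  also have "\<dots> \<le> (1 + \<tau>) * (2 + C * \<tau>)"
    using smooth[OF f(1) g(1) f(2) g(2), of c] bc \<tau> by (intro mult_left_mono) auto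
  also have "\<dots> = 2 + 2 * \<tau> + C * \<tau> + C * \<tau> * \<tau>" by (simp add: algebra_simps)
  also have "C * \<tau> * \<tau> \<le> C * \<tau> * 1" using C \<tau> by (intro mult_left_mono) auto
  finally have "(b * c) * \<beta> y g \<le> (C + 2) * \<tau>" using near by (simp add: algebra_simps)
  moreover have "b * c = \<tau> powr (1 / p + 1 / s)" by (simp add: b_def c_def powr_add)
  moreover have "\<tau> = \<tau> powr (1 - (1 / p + 1 / s)) * \<tau> powr (1 / p + 1 / s)"
    using \<tau> by (simp flip: powr_add)
  ultimately have "\<tau> powr (1 / p + 1 / s) * \<beta> y g
      \<le> \<tau> powr (1 / p + 1 / s) * ((C + 2) * \<tau> powr (1 - (1 / p + 1 / s)))"
    by (metis mult.assoc mult.commute)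
  then show ?thesis using \<tau> by simp
qed

lemma tail_bound:
  assumes \<eta>: "0 < \<eta>"
  obtains \<delta> where "0 < \<delta>" "\<delta> \<le> 1"
    "\<forall>\<beta>\<in>bilinear_ball. \<forall>F. \<forall>x\<in>carr E. \<forall>f\<in>carr Z. nrm E x \<le> 1 \<longrightarrow> nrm Z f \<le> 1 \<longrightarrow> restr F x = x \<longrightarrow>
       \<beta> x f > 1 - \<delta> \<longrightarrow> (\<forall>y\<in>carr E. \<forall>g\<in>carr Z. \<bar>\<beta> (restr (- F) y) g\<bar> \<le> \<eta> * (nrm E y * nrm Z g))"
proof -
  define \<theta> where "\<theta> = 1 - (1 / p + 1 / s)"
  have \<theta>: "0 < \<theta>" using ps by (simp add: \<theta>_def)
  \<comment> \<open>makes the bound \<open>(C + 2) \<delta>\<^sup>\<theta>\<close> of \<open>tail_bound_ball\<close> at most \<open>\<eta>\<close>\<close>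
  define \<delta> where "\<delta> = min 1 ((\<eta> / (C + 2)) powr (1 / \<theta>))"
  have \<delta>: "0 < \<delta>" "\<delta> \<le> 1" using \<eta> C by (auto simp: \<delta>_def)
  have "\<delta> powr \<theta> \<le> ((\<eta> / (C + 2)) powr (1 / \<theta>)) powr \<theta>"
    using \<delta> \<theta> by (intro powr_mono2) (auto simp: \<delta>_def)
  also have "\<dots> = \<eta> / (C + 2)" using \<theta> \<eta> C by (simp add: powr_powr)
  finally have \<delta>\<eta>: "(C + 2) * \<delta> powr \<theta> \<le> \<eta>" using C by (simp add: field_simps)
  have "\<bar>\<beta> (restr (- F) y) g\<bar> \<le> \<eta> * (nrm E y * nrm Z g)"
    if \<beta>: "\<beta> \<in> bilinear_ball" and x: "x \<in> carr E" "nrm E x \<le> 1" and f: "f \<in> carr Z" "nrm Z f \<le> 1"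
      and F: "restr F x = x" and near: "\<beta> x f > 1 - \<delta>" and y: "y \<in> carr E" and g: "g \<in> carr Z"
    for \<beta> F x f y g
  proof -
    let ?y = "restr (- F) y"
    note bil = bilinear_E_simps[OF bilinear_ball_bilinear[OF \<beta>]]
    have y': "?y \<in> carr E" by (rule restr_in[OF y])
    have xF: "x i = 0" if "i \<notin> F" for i using fun_cong[OF F, of i] that by (simp add: restr_def)
    have "\<bar>\<beta> ?y g\<bar> \<le> \<eta> * (nrm E ?y * nrm Z g)"
    proof (cases "nrm E ?y = 0 \<or> nrm Z g = 0")
      case True
      then show ?thesis using bilinear_ball_le[OF \<beta> y' g] by auto
    next
      case False
      then have pos: "0 < nrm E ?y" "0 < nrm Z g" using nrm_E_nonneg[of ?y] Z.nrm_nonneg[OF g] by auto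
      have unit: "\<sigma> * (\<beta> ?y g / (nrm E ?y * nrm Z g)) \<le> \<eta>" if \<sigma>: "\<bar>\<sigma>\<bar> = 1" for \<sigma> :: real
      proof -
        let ?u = "\<lambda>i. (\<sigma> / nrm E ?y) * ?y i" and ?h = "\<lambda>t. (1 / nrm Z g) * g t"
        have "\<beta> ?u ?h \<le> (C + 2) * \<delta> powr (1 - (1 / p + 1 / s))"
        proof (rule tail_bound_ball[OF \<beta> \<delta> x _ _ _ f _ _ near])
          show "?u \<in> carr E" "?h \<in> carr Z" by (intro E.cmult_in y' Z.cmult_in g)+
          show "nrm E ?u \<le> 1" using pos \<sigma> by (simp only: E.nrm_cmult[OF y']) simp
          show "nrm Z ?h \<le> 1" using pos by (simp only: Z.nrm_cmult[OF g]) simp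
          show "x i = 0 \<or> ?u i = 0" for i using xF[of i] by (auto simp: restr_def)
        qed
        also have "\<dots> \<le> \<eta>" using \<delta>\<eta> by (simp add: \<theta>_def)
        also have "\<beta> ?u ?h = \<sigma> / nrm E ?y * (1 / nrm Z g * \<beta> ?y g)"
          by (simp only: bil(2,4) y' g Z.cmult_in)
        finally show ?thesis by simp
      qed
      have "\<bar>\<beta> ?y g / (nrm E ?y * nrm Z g)\<bar> \<le> \<eta>" using unit[of 1] unit[of "- 1"] by (simp add: abs_le_iff)
      then show ?thesis using pos by (simp add: field_simps abs_mult)
    qed
    also have "\<dots> \<le> \<eta> * (nrm E y * nrm Z g)"
      using \<eta> nrm_restr_le[OF y] Z.nrm_nonneg[OF g] by (intro mult_left_mono mult_right_mono) auto
    finally show ?thesis .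
  qed
  then show ?thesis using that[OF \<delta>] by blast
qed

end

section \<open>Slices of the ball of bilinear forms\<close>

context tensor_pair
begin

lemma eval_lim_uniform:
  assumes w: "w \<in> cauchy_seqs T" and e: "0 < e"
  obtains N where "\<forall>n\<ge>N. \<forall>\<beta>\<in>bilinear_ball. \<bar>lim (\<lambda>n. w n \<beta>) - w n \<beta>\<bar> \<le> e"
proof -
  obtain N where N: "\<forall>m\<ge>N. \<forall>n\<ge>N. nrm T (\<lambda>\<beta>. w m \<beta> - w n \<beta>) < e"
    using w e unfolding cauchy_seqs_def T.nminus_eq by blast
  have "\<bar>lim (\<lambda>n. w n \<beta>) - w n \<beta>\<bar> \<le> e" if n: "n \<ge> N" and \<beta>: "\<beta> \<in> bilinear_ball" for n \<beta>
  proof (rule LIMSEQ_le_const2)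
    show "(\<lambda>m. \<bar>w m \<beta> - w n \<beta>\<bar>) \<longlonglongrightarrow> \<bar>lim (\<lambda>n. w n \<beta>) - w n \<beta>\<bar>"
      using eval_le[OF \<beta>]
      by (intro tendsto_rabs tendsto_diff tendsto_const T.form_cauchy_tendsto[OF linear_form_eval _ w]) blast
    have "\<bar>w m \<beta> - w n \<beta>\<bar> \<le> e" if "m \<ge> N" for m
      using eval_le[OF \<beta> T.diff_in[OF T.cauchy_in[OF w] T.cauchy_in[OF w]], of m n] N n that
      by (meson less_imp_le order_trans)
    then show "\<exists>M. \<forall>m\<ge>M. \<bar>w m \<beta> - w n \<beta>\<bar> \<le> e" by blast
  qed
  then show ?thesis using that by blast
qed

end

lemma sum_list_ex_large:
  fixes A B :: "'k \<Rightarrow> real"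
  assumes "(\<Sum>a\<leftarrow>r. k * B a) < (\<Sum>a\<leftarrow>r. A a)"
  shows "\<exists>a\<in>set r. k * B a < A a"
proof (rule ccontr)
  assume "\<not> ?thesis"
  then have "(\<Sum>a\<leftarrow>r. A a) \<le> (\<Sum>a\<leftarrow>r. k * B a)" by (intro sum_list_mono) force
  with assms show False by simp
qed

context lp_smooth
begin

lemma rep_tail_small:
  assumes "r \<in> reps" "0 < e"
  shows "\<exists>F0. finite F0 \<and> F0 \<subseteq> I \<and>
    (\<forall>F. F0 \<subseteq> F \<longrightarrow> (\<Sum>(x, z)\<leftarrow>r. nrm E (restr (- F) x) * nrm Z z) \<le> e)"
  using assms
proof (induction r arbitrary: e)
  case Nil
  then show ?case by (intro exI[of _ "{}"]) simp
next
  case (Cons a r)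
  obtain x z where a: "a = (x, z)" "x \<in> carr E" "z \<in> carr Z" using Cons.prems by force
  have z: "0 \<le> nrm Z z" by (rule Z.nrm_nonneg[OF a(3)])
  have "r \<in> reps" "0 < e / 2" using Cons.prems by auto
  from Cons.IH[OF this] obtain F1 where F1: "finite F1" "F1 \<subseteq> I"
    "\<forall>F. F1 \<subseteq> F \<longrightarrow> (\<Sum>(x, z)\<leftarrow>r. nrm E (restr (- F) x) * nrm Z z) \<le> e / 2" by blast
  have "0 < e / (2 * (1 + nrm Z z))" using Cons.prems z by simp
  then obtain F2 where F2: "finite F2" "F2 \<subseteq> I"
    "\<forall>F. F2 \<subseteq> F \<longrightarrow> nrm E (restr (- F) x) \<le> e / (2 * (1 + nrm Z z))"
    by (rule restr_tail_small[OF a(2)])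
  have "(\<Sum>(x, z)\<leftarrow>(a # r). nrm E (restr (- F) x) * nrm Z z) \<le> e" if F: "F1 \<union> F2 \<subseteq> F" for F
  proof -
    have "nrm E (restr (- F) x) * nrm Z z \<le> e / (2 * (1 + nrm Z z)) * nrm Z z"
      using F2 F z by (intro mult_right_mono) auto
    also have "\<dots> = nrm Z z / (1 + nrm Z z) * (e / 2)" by (simp add: algebra_simps)
    also have "\<dots> \<le> 1 * (e / 2)" using z Cons.prems by (intro mult_right_mono) auto
    finally have "nrm E (restr (- F) x) * nrm Z z \<le> e / 2" by simp
    moreover have "(\<Sum>(x, z)\<leftarrow>r. nrm E (restr (- F) x) * nrm Z z) \<le> e / 2" using F1(3) F by blast
    ultimately show ?thesis by (simp add: a(1))
  qed
  then show ?case using F1 F2 by (intro exI[of _ "F1 \<union> F2"]) auto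
qed

text \<open>
  Approximate the given point of the completion by a finite sum of elementary tensors of almost
  minimal cost, and truncate the first factors to a common finite set \<open>F\<close>. If the values of \<open>\<beta>\<close> at
  the summands add up almost to the cost, then at one summand \<open>\<beta>\<close> almost attains the product of the
  norms.
\<close>

lemma near_norming_concentrates:
  assumes w: "w \<in> cauchy_seqs T" "(\<lambda>n. nrm T (w n)) \<longlonglongrightarrow> 1" and \<delta>: "0 < \<delta>" "\<delta> \<le> 1"
  obtains F d where "finite F" "F \<subseteq> I" "0 < d"
    "\<forall>\<beta>\<in>bilinear_ball. lim (\<lambda>n. w n \<beta>) > 1 - d \<longrightarrow>
       (\<exists>x\<in>carr E. \<exists>f\<in>carr Z. nrm E x \<le> 1 \<and> nrm Z f \<le> 1 \<and> restr F x = x \<and> \<beta> x f > 1 - \<delta>)"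
proof -
  \<comment> \<open>the factor 8 gives \<open>(1 - \<delta>) (1 + 2 d) \<le> 1 - 3 d\<close>: cost against value after all the errors\<close>
  define d where "d = \<delta> / 8"
  have d: "0 < d" using \<delta> by (simp add: d_def)
  obtain N1 where N1: "\<forall>n\<ge>N1. \<forall>\<beta>\<in>bilinear_ball. \<bar>lim (\<lambda>n. w n \<beta>) - w n \<beta>\<bar> \<le> d"
    by (rule eval_lim_uniform[OF w(1) d])
  have "\<forall>\<^sub>F n in sequentially. nrm T (w n) < 1 + d" using order_tendstoD(2)[OF w(2)] d by simp
  then obtain N2 where N2: "\<forall>n\<ge>N2. nrm T (w n) < 1 + d" by (auto simp: eventually_sequentially)
  define n where "n = max N1 N2"
  have n: "\<forall>\<beta>\<in>bilinear_ball. \<bar>lim (\<lambda>n. w n \<beta>) - w n \<beta>\<bar> \<le> d" "nrm T (w n) < 1 + d"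
    using N1 N2 by (auto simp: n_def)
  obtain r where r: "r \<in> reps" "w n = tensor_sum E Z r" "cost r < nrm T (w n) + d"
    by (rule nrm_T_approx[OF T.cauchy_in[OF w(1)] d])
  obtain F where F: "finite F" "F \<subseteq> I" "(\<Sum>(x, z)\<leftarrow>r. nrm E (restr (- F) x) * nrm Z z) \<le> d"
    using rep_tail_small[OF r(1) d] by blast
  have r_in: "x \<in> carr E" "z \<in> carr Z" if "(x, z) \<in> set r" for x z using r(1) that by auto
  have "\<exists>x\<in>carr E. \<exists>f\<in>carr Z. nrm E x \<le> 1 \<and> nrm Z f \<le> 1 \<and> restr F x = x \<and> \<beta> x f > 1 - \<delta>"
    if \<beta>: "\<beta> \<in> bilinear_ball" and near: "lim (\<lambda>n. w n \<beta>) > 1 - d" for \<beta>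
  proof -
    note bil = bilinear_E_simps[OF bilinear_ball_bilinear[OF \<beta>]]
    have "w n \<beta> = (\<Sum>(x, z)\<leftarrow>r. \<beta> x z)"
      by (simp add: r(2) tensor_sum_apply bilinear_ball_bilinear[OF \<beta>])
    also have "\<dots> \<le> (\<Sum>(x, z)\<leftarrow>r. \<beta> (restr F x) z + nrm E (restr (- F) x) * nrm Z z)"
    proof (rule sum_list_mono)
      fix a assume "a \<in> set r"
      then obtain x z where a: "a = (x, z)" "x \<in> carr E" "z \<in> carr Z" using r(1) by force
      have "\<beta> x z = \<beta> (\<lambda>i. restr F x i + restr (- F) x i) z" by (simp flip: restr_split)
      also have "\<dots> = \<beta> (restr F x) z + \<beta> (restr (- F) x) z" 
        by (rule bil(1)[OF restr_in[OF a(2)] restr_in[OF a(2)] a(3)])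
      also have "\<dots> \<le> \<beta> (restr F x) z + nrm E (restr (- F) x) * nrm Z z"
        using bilinear_ball_le[OF \<beta> restr_in[OF a(2)] a(3), of "- F"] by simp
      finally show "(case a of (x, z) \<Rightarrow> \<beta> x z)
          \<le> (case a of (x, z) \<Rightarrow> \<beta> (restr F x) z + nrm E (restr (- F) x) * nrm Z z)"
        by (simp add: a)
    qed
    also have "\<dots> = (\<Sum>(x, z)\<leftarrow>r. \<beta> (restr F x) z) + (\<Sum>(x, z)\<leftarrow>r. nrm E (restr (- F) x) * nrm Z z)"
      by (simp add: case_prod_unfold sum_list_addf)
    finally have "w n \<beta> - d \<le> (\<Sum>(x, z)\<leftarrow>r. \<beta> (restr F x) z)" using F(3) by simp
    moreover have "lim (\<lambda>n. w n \<beta>) - d \<le> w n \<beta>" using bspec[OF n(1) \<beta>] by linarith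
    ultimately have large: "1 - 3 * d < (\<Sum>(x, z)\<leftarrow>r. \<beta> (restr F x) z)" using near by simp
    have "(\<Sum>(x, z)\<leftarrow>r. (1 - \<delta>) * (nrm E (restr F x) * nrm Z z)) \<le> (\<Sum>(x, z)\<leftarrow>r. (1 - \<delta>) * (nrm E x * nrm Z z))"
    proof (rule sum_list_mono)
      fix a assume "a \<in> set r"
      then obtain x z where a: "a = (x, z)" "x \<in> carr E" "z \<in> carr Z" using r(1) by force
      show "(case a of (x, z) \<Rightarrow> (1 - \<delta>) * (nrm E (restr F x) * nrm Z z))
          \<le> (case a of (x, z) \<Rightarrow> (1 - \<delta>) * (nrm E x * nrm Z z))"
        using nrm_restr_le[OF a(2), of F] Z.nrm_nonneg[OF a(3)] \<delta>
        by (simp add: a mult_left_mono mult_right_mono)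
    qed
    also have "\<dots> = (1 - \<delta>) * cost r" by (simp add: cost_def sum_list_const_mult case_prod_unfold)
    also have "\<dots> \<le> (1 - \<delta>) * (1 + 2 * d)" using r(3) n(2) \<delta> by (intro mult_left_mono) auto
    also have "\<dots> \<le> 1 - 3 * d" using \<delta> by (simp add: d_def algebra_simps)
    finally have "(\<Sum>a\<leftarrow>r. (1 - \<delta>) * (nrm E (restr F (fst a)) * nrm Z (snd a)))
        < (\<Sum>a\<leftarrow>r. \<beta> (restr F (fst a)) (snd a))"
      using large by (simp add: case_prod_unfold)
    from sum_list_ex_large[OF this] obtain x z where xz: "(x, z) \<in> set r"
      "(1 - \<delta>) * (nrm E (restr F x) * nrm Z z) < \<beta> (restr F x) z" by auto
    note x = restr_in[OF r_in(1)[OF xz(1)], of F] and z = r_in(2)[OF xz(1)]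
    have le: "\<beta> (restr F x) z \<le> nrm E (restr F x) * nrm Z z"
      using bilinear_ball_le[OF \<beta> x z] by simp
    have "nrm E (restr F x) * nrm Z z \<noteq> 0" using xz(2) le by auto
    then have pos: "0 < nrm E (restr F x)" "0 < nrm Z z"
      using nrm_E_nonneg[of "restr F x"] Z.nrm_nonneg[OF z] by auto
    let ?u = "\<lambda>i. (1 / nrm E (restr F x)) * restr F x i" and ?f = "\<lambda>t. (1 / nrm Z z) * z t"
    have in': "?u \<in> carr E" "?f \<in> carr Z" by (intro E.cmult_in x Z.cmult_in z)+
    have "\<beta> ?u ?f = 1 / nrm E (restr F x) * (1 / nrm Z z * \<beta> (restr F x) z)"
      by (simp only: bil(2,4) x z Z.cmult_in)
    also have "\<dots> = \<beta> (restr F x) z / (nrm E (restr F x) * nrm Z z)" by simp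
    also have "\<dots> > 1 - \<delta>" using xz(2) pos by (simp add: pos_less_divide_eq)
    finally have "\<beta> ?u ?f > 1 - \<delta>" .
    moreover have "nrm E ?u \<le> 1" using pos by (simp only: E.nrm_cmult[OF x]) simp
    moreover have "nrm Z ?f \<le> 1" using pos by (simp only: Z.nrm_cmult[OF z]) simp
    moreover have "restr F ?u = ?u" by (auto simp: restr_def)
    ultimately show ?thesis using in' by blast
  qed
  with F d show ?thesis by (intro that[of F d]) auto
qed

text \<open>
  Otherwise there are forms \<open>b k\<close> in the ball, with values tending to 1, that all stay away from the
  forms with value 1. A cluster point \<open>\<tau>\<close> of these forms has value 1; the finitely many coordinates in
  \<open>S\<close> and the tails together show that some \<open>b k\<close> is nevertheless close to \<open>\<tau>\<close>.
\<close>

lemma slices_near_face: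
  assumes unif: "\<And>(G :: (('i \<Rightarrow> real) \<Rightarrow> ('c \<Rightarrow> real) \<Rightarrow> real) filter) \<gamma> e.
      \<forall>\<^sub>F \<beta> in G. linear_form Z (\<gamma> \<beta>) \<Longrightarrow> (\<And>f. f \<in> carr Z \<Longrightarrow> ((\<lambda>\<beta>. \<gamma> \<beta> f) \<longlongrightarrow> 0) G) \<Longrightarrow> 0 < e \<Longrightarrow>
      \<forall>\<^sub>F \<beta> in G. \<forall>f\<in>carr Z. \<bar>\<gamma> \<beta> f\<bar> \<le> e * nrm Z f"
    and w: "w \<in> cauchy_seqs T" "(\<lambda>n. nrm T (w n)) \<longlonglongrightarrow> 1" and e: "0 < e"
  shows "\<exists>d>0. \<forall>\<beta>\<in>bilinear_ball. lim (\<lambda>n. w n \<beta>) > 1 - d \<longrightarrow>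
     (\<exists>\<psi>\<in>bilinear_ball. lim (\<lambda>n. w n \<psi>) = 1 \<and> (\<forall>u\<in>carr T. \<bar>u \<beta> - u \<psi>\<bar> \<le> e * nrm T u))"
proof (rule ccontr)
  define L where "L = (\<lambda>\<beta>. lim (\<lambda>n. w n \<beta>))"
  assume "\<not> ?thesis"
  then have bad: "\<exists>\<beta>. \<beta> \<in> bilinear_ball \<and> L \<beta> > 1 - d \<and>
      (\<forall>\<psi>\<in>bilinear_ball. L \<psi> = 1 \<longrightarrow> \<not> (\<forall>u\<in>carr T. \<bar>u \<beta> - u \<psi>\<bar> \<le> e * nrm T u))" if "0 < d" for d
    using that unfolding L_def by blast
  have "\<exists>b. \<forall>k. b k \<in> bilinear_ball \<and> L (b k) > 1 - 1 / real (Suc k) \<and>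
      (\<forall>\<psi>\<in>bilinear_ball. L \<psi> = 1 \<longrightarrow> \<not> (\<forall>u\<in>carr T. \<bar>u (b k) - u \<psi>\<bar> \<le> e * nrm T u))"
    by (intro choice allI bad) simp
  then obtain b where b: "\<And>k. b k \<in> bilinear_ball" "\<And>k. L (b k) > 1 - 1 / real (Suc k)"
    "\<And>k \<psi>. \<psi> \<in> bilinear_ball \<Longrightarrow> L \<psi> = 1 \<Longrightarrow> \<not> (\<forall>u\<in>carr T. \<bar>u (b k) - u \<psi>\<bar> \<le> e * nrm T u)"
    by blast
  define F where "F = filtermap b sequentially"
  have "F \<noteq> bot" "\<forall>\<^sub>F \<beta> in F. \<beta> \<in> bilinear_ball"
    by (simp_all add: F_def filtermap_bot_iff eventually_filtermap b)
  then obtain \<tau> where \<tau>: "\<tau> \<in> bilinear_ball" "inf (nhds \<tau>) F \<noteq> bot"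
    using compact_bilinear_ball unfolding compact_filter by blast
  \<comment> \<open>along \<open>G\<close> the forms \<open>b k\<close> converge pointwise to \<open>\<tau>\<close>\<close>
  define G where "G = inf (nhds \<tau>) F"
  have G: "G \<noteq> bot" "G \<le> nhds \<tau>" "G \<le> F" using \<tau>(2) by (simp_all add: G_def)
  have GF: "\<forall>\<^sub>F \<beta> in G. P \<beta>" if "\<forall>\<^sub>F k in sequentially. P (b k)" for P
    using filter_leD[OF G(3), of P] that by (simp add: F_def eventually_filtermap)
  have G_ball: "\<forall>\<^sub>F \<beta> in G. \<beta> \<in> bilinear_ball" by (rule GF) (simp add: b)
  have L_le: "L \<beta> \<le> 1" if \<beta>: "\<beta> \<in> bilinear_ball" for \<beta>
    unfolding L_def
    using eval_le[OF \<beta> T.cauchy_in[OF w(1)]] eval_le[OF \<beta>]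
    by (intro LIMSEQ_le[OF T.form_cauchy_tendsto[OF linear_form_eval _ w(1)] w(2)]) (auto intro: abs_le_D1)
  have L_tendsto: "(L \<longlongrightarrow> L \<tau>) G"
  proof (rule tendstoI)
    fix \<epsilon> :: real assume \<epsilon>: "0 < \<epsilon>"
    obtain N where N: "\<forall>n\<ge>N. \<forall>\<beta>\<in>bilinear_ball. \<bar>L \<beta> - w n \<beta>\<bar> \<le> \<epsilon> / 4"
      unfolding L_def by (rule eval_lim_uniform[OF w(1), of "\<epsilon> / 4"]) (use \<epsilon> in auto)
    have "\<forall>\<^sub>F \<beta> in G. dist (w N \<beta>) (w N \<tau>) < \<epsilon> / 4"
      using tendstoD[OF tendsto_eval[OF \<tau>(1) G(2) G_ball T.cauchy_in[OF w(1), of N]], of "\<epsilon> / 4"] \<epsilon> by simp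
    with G_ball show "\<forall>\<^sub>F \<beta> in G. dist (L \<beta>) (L \<tau>) < \<epsilon>"
    proof eventually_elim
      case (elim \<beta>)
      have "\<bar>L \<beta> - w N \<beta>\<bar> \<le> \<epsilon> / 4" "\<bar>L \<tau> - w N \<tau>\<bar> \<le> \<epsilon> / 4" using N elim(1) \<tau>(1) by auto
      then show ?case using elim(2) \<epsilon> unfolding dist_real_def by linarith
    qed
  qed
  moreover have "(L \<longlongrightarrow> 1) G"
  proof -
    have "(\<lambda>k. 1 - 1 / real (Suc k)) \<longlonglongrightarrow> 1 - 0"
      by (intro tendsto_diff tendsto_const LIMSEQ_Suc lim_1_over_n)
    then have low: "(\<lambda>k. 1 - 1 / real (Suc k)) \<longlonglongrightarrow> 1" by simp
    have "(\<lambda>k. L (b k)) \<longlonglongrightarrow> 1"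
    proof (rule tendsto_sandwich[OF always_eventually always_eventually low tendsto_const])
      show "\<forall>k. 1 - 1 / real (Suc k) \<le> L (b k)" using b(2) by (blast intro: less_imp_le)
      show "\<forall>k. L (b k) \<le> 1" using L_le b(1) by blast
    qed
    then have "(L \<longlongrightarrow> 1) F" by (simp add: F_def filterlim_filtermap)
    then show ?thesis by (rule tendsto_mono[OF G(3)])
  qed
  ultimately have L\<tau>: "L \<tau> = 1" using tendsto_unique[OF G(1)] by blast
  have "0 < e / 4" using e by simp
  then obtain \<delta> where \<delta>: "0 < \<delta>" "\<delta> \<le> 1"
    "\<forall>\<beta>\<in>bilinear_ball. \<forall>F. \<forall>x\<in>carr E. \<forall>f\<in>carr Z. nrm E x \<le> 1 \<longrightarrow> nrm Z f \<le> 1 \<longrightarrow> restr F x = x \<longrightarrow>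
       \<beta> x f > 1 - \<delta> \<longrightarrow> (\<forall>y\<in>carr E. \<forall>g\<in>carr Z. \<bar>\<beta> (restr (- F) y) g\<bar> \<le> e / 4 * (nrm E y * nrm Z g))"
    by (rule tail_bound)
  obtain S d where S: "finite S" "S \<subseteq> I" "0 < d"
    "\<forall>\<beta>\<in>bilinear_ball. lim (\<lambda>n. w n \<beta>) > 1 - d \<longrightarrow>
       (\<exists>x\<in>carr E. \<exists>f\<in>carr Z. nrm E x \<le> 1 \<and> nrm Z f \<le> 1 \<and> restr S x = x \<and> \<beta> x f > 1 - \<delta>)"
    by (rule near_norming_concentrates[OF w \<delta>(1,2)])
  have tail: "\<bar>\<beta> (restr (- S) y) g\<bar> \<le> e / 4 * (nrm E y * nrm Z g)"
    if "\<beta> \<in> bilinear_ball" "L \<beta> > 1 - d" "y \<in> carr E" "g \<in> carr Z" for \<beta> y g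
    using that S(4) \<delta>(3) unfolding L_def by blast
  define m where "m = e / (2 * (1 + real (card S)))"
  have m: "0 < m" using e by (simp add: m_def)
  let ?unit = "\<lambda>i j. if j = i then 1 else (0 :: real)"
  have co: "\<forall>\<^sub>F \<beta> in G. \<forall>f\<in>carr Z. \<bar>\<beta> (?unit i) f - \<tau> (?unit i) f\<bar> \<le> m * nrm Z f" if i: "i \<in> S" for i
  proof (rule unif[OF _ _ m])
    have ui: "?unit i \<in> carr E" using unit_in i S(2) by blast
    show "\<forall>\<^sub>F \<beta> in G. linear_form Z (\<lambda>f. \<beta> (?unit i) f - \<tau> (?unit i) f)"
      using G_ball
    proof eventually_elim
      case (elim \<beta>)
      have "linear_form Z (\<beta> (?unit i))" "linear_form Z (\<tau> (?unit i))"
        using bilinear_ball_bilinear[OF elim] bilinear_ball_bilinear[OF \<tau>(1)] ui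
        by (auto simp: bilinear_forms_def)
      then show ?case by (simp add: linear_form_def algebra_simps)
    qed
    fix f assume f: "f \<in> carr Z"
    have u: "tensor_sum E Z [(?unit i, f)] \<in> carr T" unfolding carr_T using ui f by (intro imageI) simp
    have "((\<lambda>\<beta>. tensor_sum E Z [(?unit i, f)] \<beta>) \<longlongrightarrow> tensor_sum E Z [(?unit i, f)] \<tau>) G"
      by (rule tendsto_eval[OF \<tau>(1) G(2) G_ball u])
    moreover have "\<forall>\<^sub>F \<beta> in G. tensor_sum E Z [(?unit i, f)] \<beta> = \<beta> (?unit i) f"
      using G_ball by eventually_elim (simp add: tensor_sum_apply bilinear_ball_bilinear)
    ultimately have "((\<lambda>\<beta>. \<beta> (?unit i) f) \<longlongrightarrow> \<tau> (?unit i) f) G"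
      using tendsto_cong[of "\<lambda>\<beta>. tensor_sum E Z [(?unit i, f)] \<beta>" "\<lambda>\<beta>. \<beta> (?unit i) f"]
      by (simp add: tensor_sum_apply bilinear_ball_bilinear \<tau>(1))
    then show "((\<lambda>\<beta>. \<beta> (?unit i) f - \<tau> (?unit i) f) \<longlongrightarrow> 0) G"
      using tendsto_diff[OF _ tendsto_const[of "\<tau> (?unit i) f"]] by fastforce
  qed
  have "\<forall>\<^sub>F \<beta> in G. \<forall>i\<in>S. \<forall>f\<in>carr Z. \<bar>\<beta> (?unit i) f - \<tau> (?unit i) f\<bar> \<le> m * nrm Z f"
    using co S(1) by (simp add: eventually_ball_finite)
  moreover have "\<forall>\<^sub>F \<beta> in G. L \<beta> > 1 - d"
    using order_tendstoD(1)[OF L_tendsto, of "1 - d"] L\<tau> S(3) by simp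
  moreover have "\<forall>\<^sub>F \<beta> in G. \<not> (\<forall>u\<in>carr T. \<bar>u \<beta> - u \<tau>\<bar> \<le> e * nrm T u)"
    by (intro GF always_eventually allI b(3) \<tau>(1) L\<tau>)
  ultimately have "\<forall>\<^sub>F \<beta> in G. False"
    using G_ball
  proof eventually_elim
    case (elim \<beta>)
    note \<beta> = \<open>\<beta> \<in> bilinear_ball\<close>
    have "\<bar>u \<beta> - u \<tau>\<bar> \<le> e * nrm T u" if u: "u \<in> carr T" for u
    proof (rule eval_diff_le[OF bilinear_ball_bilinear[OF \<beta>] bilinear_ball_bilinear[OF \<tau>(1)] _ _ u])
      show "0 \<le> e" using e by simp
      fix x f assume x: "x \<in> carr E" and f: "f \<in> carr Z"
      have nf: "0 \<le> nrm Z f" by (rule Z.nrm_nonneg[OF f])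
      have split: "\<gamma> x f = (\<Sum>i\<in>S. x i * \<gamma> (?unit i) f) + \<gamma> (restr (- S) x) f" if \<gamma>: "\<gamma> \<in> bilinear_ball" for \<gamma>
      proof -
        have lin: "linear_form E (\<lambda>x. \<gamma> x f)"
          using bilinear_ball_bilinear[OF \<gamma>] f by (simp add: bilinear_forms_def)
        have "\<gamma> x f = \<gamma> (\<lambda>i. restr S x i + restr (- S) x i) f" by (simp flip: restr_split)
        also have "\<dots> = \<gamma> (restr S x) f + \<gamma> (restr (- S) x) f"
          by (rule E.linear_form_add[OF lin restr_in[OF x] restr_in[OF x]])
        finally show ?thesis using linear_form_restr_finite[OF lin S(1,2) x] by simp
      qed
      have "\<bar>(\<Sum>i\<in>S. x i * (\<beta> (?unit i) f - \<tau> (?unit i) f))\<bar> \<le> (\<Sum>i\<in>S. nrm E x * (m * nrm Z f))"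
      proof (rule order_trans[OF sum_abs sum_mono])
        fix i assume "i \<in> S"
        then show "\<bar>x i * (\<beta> (?unit i) f - \<tau> (?unit i) f)\<bar> \<le> nrm E x * (m * nrm Z f)"
          unfolding abs_mult using elim(1) f abs_coord_le[OF x] nrm_E_nonneg[of x] by (intro mult_mono) auto
      qed
      also have "\<dots> = (real (card S) / (1 + real (card S))) * (e / 2 * (nrm E x * nrm Z f))"
        by (simp add: m_def algebra_simps)
      also have "\<dots> \<le> 1 * (e / 2 * (nrm E x * nrm Z f))"
        using e nf nrm_E_nonneg[of x] by (intro mult_right_mono) auto
      finally have "\<bar>(\<Sum>i\<in>S. x i * (\<beta> (?unit i) f - \<tau> (?unit i) f))\<bar> \<le> e / 2 * (nrm E x * nrm Z f)" by simp
      moreover have "\<beta> x f - \<tau> x f = (\<Sum>i\<in>S. x i * (\<beta> (?unit i) f - \<tau> (?unit i) f))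
          + \<beta> (restr (- S) x) f - \<tau> (restr (- S) x) f"
        by (simp add: split[OF \<beta>] split[OF \<tau>(1)] right_diff_distrib sum_subtractf)
      moreover have "\<bar>\<beta> (restr (- S) x) f\<bar> \<le> e / 4 * (nrm E x * nrm Z f)"
        by (rule tail[OF \<beta> elim(2) x f])
      moreover have "\<bar>\<tau> (restr (- S) x) f\<bar> \<le> e / 4 * (nrm E x * nrm Z f)"
        by (rule tail[OF \<tau>(1) _ x f]) (use L\<tau> S(3) in simp)
      ultimately show "\<bar>\<beta> x f - \<tau> x f\<bar> \<le> e * (nrm E x * nrm Z f)" by linarith
    qed
    with elim(3) show False by blast
  qed
  then show False using G(1) by (simp add: eventually_False)
qed

end

section \<open>The projective tensor product\<close>

theorem corollary3p5:
  fixes I :: "'i set" and p q :: real and M :: "'m measure" and Y :: "('m \<Rightarrow> real) set set"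
  assumes "infinite I"
    and "1 < q"
    and "p > max 2 q"
    and "linear_subspace (Lq_space q M) Y"
    and "finite_dimensional (subspace_of (Lq_space q M) Y)"
  shows "SSD (proj_tensor (lp_space p I) (dual_space (subspace_of (Lq_space q M) Y)))"
proof -
  define L where "L = Lq_space q M"
  define S where "S = subspace_of L Y"
  define r where "r = max 2 q"
  have q: "1 < q" and r: "2 \<le> r" "r < p" using assms by (auto simp: r_def)
  have Y: "Y \<subseteq> carr L" "nzero L \<in> Y" "\<And>x y. x \<in> Y \<Longrightarrow> y \<in> Y \<Longrightarrow> nplus L x y \<in> Y"
    "\<And>c x. x \<in> Y \<Longrightarrow> scale L c x \<in> Y"
    using assms(4) by (auto simp: linear_subspace_def L_def)
  have S: "carr S = Y" "nplus S = nplus L" "nzero S = nzero L" "scale S = scale L" "nrm S = nrm L"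
    by (simp_all add: S_def subspace_of_def)
  have minus_S: "nminus S = nminus L" by (intro ext) (simp add: nminus_def S)
  interpret S: homogeneous_space S
  proof
    show "nrm S (scale S c u) = \<bar>c\<bar> * nrm S u" if "u \<in> carr S" for c u
      using that Y q by (auto simp: S L_def nrm_Lq_scale)
    show "0 \<le> nrm S u" if "u \<in> carr S" for u
      using that Y by (auto simp: S L_def nrm_Lq_nonneg)
  qed (use Y in \<open>auto simp: S\<close>)
  interpret Z: seminormed_function_space "dual_space S" by (rule S.seminormed_function_space_dual)
  show ?thesis
  proof (rule Lq_space_uniformly_convex[OF q, where 'm = 'm])
    fix \<kappa> :: real
    assume \<kappa>: "0 < \<kappa>"
      and uc: "\<And>(M :: 'm measure) P Q. P \<in> carr (Lq_space q M) \<Longrightarrow> Q \<in> carr (Lq_space q M) \<Longrightarrow>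
       nrm (Lq_space q M) P \<le> 1 \<Longrightarrow> nrm (Lq_space q M) Q \<le> 1 \<Longrightarrow>
       nrm (Lq_space q M) (nplus (Lq_space q M) P Q)
         \<le> 2 - \<kappa> * nrm (Lq_space q M) (nminus (Lq_space q M) P Q) powr (max 2 q)"
    have ucS: "nrm S (nplus S P Q) \<le> 2 - \<kappa> * nrm S (nminus S P Q) powr r"
      if "P \<in> carr S" "Q \<in> carr S" "nrm S P \<le> 1" "nrm S Q \<le> 1" for P Q
      using uc[of P M Q] that Y(1) by (auto simp: S minus_S L_def r_def)
    have conj: "1 / (r / (r - 1)) = 1 - 1 / r" using r by (simp add: diff_divide_distrib)
    interpret lp_smooth p I "dual_space S" "\<kappa> powr (- 1 / (r - 1))" "r / (r - 1)"
    proof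
      show "1 / p + 1 / (r / (r - 1)) < 1" unfolding conj using r by (simp add: field_simps)
      show "nrm (dual_space S) (\<lambda>x. f x + c * g x) + nrm (dual_space S) (\<lambda>x. f x - c * g x)
          \<le> 2 + \<kappa> powr (- 1 / (r - 1)) * c powr (r / (r - 1))"
        if "f \<in> carr (dual_space S)" "g \<in> carr (dual_space S)"
          "nrm (dual_space S) f \<le> 1" "nrm (dual_space S) g \<le> 1" "0 \<le> c" for f g c
        using r that by (intro S.uniformly_convex_imp_dual_smooth[OF \<kappa> _ ucS]) auto
    qed (use r in auto)
    have zero: "nzero S \<in> carr S" "nzero S = scale S 0 (nzero S)"
    proof -
      have z: "(\<lambda>x. 0) \<in> Lq_functions q M" by (simp add: Lq_functions_def)
      have "nzero L = Lq_class q M (\<lambda>x. 0)" by (simp add: L_def Lq_space_def Lq_class_def)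
      then show "nzero S = scale S 0 (nzero S)" by (simp add: S L_def scale_Lq_class[OF z])
      show "nzero S \<in> carr S" using Y by (simp add: S)
    qed
    have fd: "finite_dimensional S" using assms(5) by (simp add: S_def L_def)
    have "SSD (completion T)"
    proof (rule T.SSD_completion[of "(\<lambda>\<beta> u. u \<beta>) ` bilinear_ball"])
      show "linear_form T \<phi>" if "\<phi> \<in> (\<lambda>\<beta> u. u \<beta>) ` bilinear_ball" for \<phi>
        using that linear_form_eval by blast
      show "\<forall>u\<in>carr T. \<bar>\<phi> u\<bar> \<le> nrm T u" if "\<phi> \<in> (\<lambda>\<beta> u. u \<beta>) ` bilinear_ball" for \<phi>
        using that eval_le by blast
      show "\<exists>\<phi>\<in>(\<lambda>\<beta> u. u \<beta>) ` bilinear_ball. \<phi> u = nrm T u" if u: "u \<in> carr T" for u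
      proof (rule ex_norming_form[OF u])
        fix \<beta> assume "\<beta> \<in> bilinear_ball" "u \<beta> = nrm T u"
        then show ?thesis by (intro bexI[of _ "\<lambda>u. u \<beta>"]) auto
      qed
      show "\<exists>d>0. \<forall>\<phi>\<in>(\<lambda>\<beta> u. u \<beta>) ` bilinear_ball. lim (\<lambda>n. \<phi> (w n)) > 1 - d \<longrightarrow>
         (\<exists>\<psi>\<in>(\<lambda>\<beta> u. u \<beta>) ` bilinear_ball. lim (\<lambda>n. \<psi> (w n)) = 1 \<and> (\<forall>u\<in>carr T. \<bar>\<phi> u - \<psi> u\<bar> \<le> e * nrm T u))"
        if "w \<in> cauchy_seqs T" "(\<lambda>n. nrm T (w n)) \<longlonglongrightarrow> 1" "0 < e" for w and e :: real
      proof -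
        have "\<exists>d>0. \<forall>\<beta>\<in>bilinear_ball. lim (\<lambda>n. w n \<beta>) > 1 - d \<longrightarrow>
          (\<exists>\<psi>\<in>bilinear_ball. lim (\<lambda>n. w n \<psi>) = 1 \<and> (\<forall>u\<in>carr T. \<bar>u \<beta> - u \<psi>\<bar> \<le> e * nrm T u))"
          by (rule slices_near_face[OF _ that], rule S.finite_dimensional_dual_pointwise_imp_uniform[OF fd zero])
        then show ?thesis by simp
      qed
    qed
    then show ?thesis by (simp add: proj_tensor_def S_def L_def)
  qed
qed

end
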